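(* Let $F$ be a field of characteristic zero and let $X$ be a twist of $\mathbb{P}^1\times\mathbb{P}^1$ over $F$ which is not isomorphic over $F$ to $\mathbb{P}^1\times\mathbb{P}^1$ and not isomorphic over $F$ to $S_a$ for any $a\in F^*\setminus(F^* )^2$. Then $X$ does not have a parametrization over $F$.
   Context: A twist over $F$ of a variety $Y$ is a variety over $F$ that becomes isomorphic to $Y$ over the algebraic closure of $F$. A (rational) parametrization over $F$ of a surface $X$ is a dominant rational map $\mathbb{P}^2\dashrightarrow X$ defined over $F$. Definition of the sphere $S_a$, for $a\in F^*\setminus(F^* )^2$: let $E=F[\alpha]/(\alpha^2-a)$ and let $\sigma$ be the generator of $\mathrm{Gal}(E/F)$. Let $e_{ij}$ ($0\le i,j\le 2$) be the standard basis of $E^9$, and embed $\mathbb{P}^1_E\times\mathbb{P}^1_E$ anticanonically in $\mathbb{P}^8_E$ by sending $((s:1),(t:1))$ to the point with coordinates $x_{ij}=s^it^j$. Let $\Sigma:E^9\to E^9$ be the $F$-linear map with $\Sigma(c\,e_{ij})=\sigma(c)e_{ji}$; it preserves $\mathbb{P}^1_E\times\mathbb{P}^1_E$ and hence defines an $F$-structure on it by Galois descent. $S_a$ is the $F$-variety defined by this $F$-structure (embedded in $\mathbb{P}(V)\cong\mathbb{P}^8_F$, where $V$ is the 9-dimensional $F$-space of vectors of $E^9$ fixed by $\Sigma$). *)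

theory Defs
  imports "HOL-Algebra.Algebraic_Closure_Type" "HOL-Library.Poly_Mapping"
begin

section \<open>Varieties over a subfield of an algebraically closed field\<close>

text \<open>
  Everything takes place in the projective spaces over an algebraically closed field \<open>'k\<close> of
  characteristic zero. The parameter \<open>K\<close> is the subfield over which objects are defined: it is
  \<^term>\<open>range to_ac\<close> for the base field and \<^term>\<open>UNIV\<close> for its algebraic closure.
  As the characteristic is zero, reduced schemes over \<open>K\<close> are geometrically reduced and are
  determined by their sets of geometric points.
\<close>

type_synonym 'k mpol = "(nat \<Rightarrow>\<^sub>0 nat) \<Rightarrow>\<^sub>0 'k"

definition mpol_eval :: "'k::field mpol \<Rightarrow> (nat \<Rightarrow> 'k) \<Rightarrow> 'k" where
  "mpol_eval p x =
     (\<Sum>m\<in>Poly_Mapping.keys p. Poly_Mapping.lookup p m *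
        (\<Prod>i\<in>Poly_Mapping.keys m. x i ^ Poly_Mapping.lookup m i))"

definition forms :: "'k::field set \<Rightarrow> nat \<Rightarrow> nat \<Rightarrow> 'k mpol set" where
  "forms K n d = {p. \<forall>m\<in>Poly_Mapping.keys p. Poly_Mapping.lookup p m \<in> K \<and>
     Poly_Mapping.keys m \<subseteq> {..n} \<and> (\<Sum>i\<in>Poly_Mapping.keys m. Poly_Mapping.lookup m i) = d}"

text \<open>A point of projective \<open>n\<close>-space is the set of all its homogeneous coordinate vectors.\<close>

definition coord_vecs :: "nat \<Rightarrow> (nat \<Rightarrow> 'k::field) set" where
  "coord_vecs n = {x. (\<forall>i>n. x i = 0) \<and> (\<exists>i\<le>n. x i \<noteq> 0)}"

definition pt :: "(nat \<Rightarrow> 'k::field) \<Rightarrow> (nat \<Rightarrow> 'k) set" where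
  "pt x = {(\<lambda>i. c * x i) | c. c \<noteq> 0}"

definition proj_space :: "nat \<Rightarrow> (nat \<Rightarrow> 'k::field) set set" where
  "proj_space n = pt ` coord_vecs n"

definition vanishes :: "'k::field mpol \<Rightarrow> (nat \<Rightarrow> 'k) set \<Rightarrow> bool" where
  "vanishes p P \<longleftrightarrow> (\<forall>x\<in>P. mpol_eval p x = 0)"

definition zclosed :: "'k::field set \<Rightarrow> nat \<Rightarrow> (nat \<Rightarrow> 'k) set set \<Rightarrow> bool" where
  "zclosed K n Z \<longleftrightarrow>
     (\<exists>S \<subseteq> (\<Union>d. forms K n d). Z = {P \<in> proj_space n. \<forall>p\<in>S. vanishes p P})"

text \<open>
  Quasi-projective, and irreducible over \<open>K\<close> (not necessarily over \<open>'k\<close>), so that these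
  correspond to the integral locally closed subschemes of projective \<open>n\<close>-space over \<open>K\<close>.
\<close>

definition is_variety :: "'k::field set \<Rightarrow> nat \<Rightarrow> (nat \<Rightarrow> 'k) set set \<Rightarrow> bool" where
  "is_variety K n V \<longleftrightarrow>
     (\<exists>Z W. zclosed K n Z \<and> zclosed K n W \<and> V = Z - W) \<and> V \<noteq> {} \<and>
     (\<forall>Z1 Z2. zclosed K n Z1 \<and> zclosed K n Z2 \<and> V \<subseteq> Z1 \<union> Z2 \<longrightarrow> V \<subseteq> Z1 \<or> V \<subseteq> Z2)"

text \<open>
  No neighbourhood of \<open>P\<close> is mentioned: if a tuple of forms describes \<open>\<phi>\<close> only off the closed
  set of zeros of some forms, multiply the tuple by one of these that does not vanish at \<open>P\<close>.
\<close>

definition is_morphism ::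
  "'k::field set \<Rightarrow> nat \<Rightarrow> (nat \<Rightarrow> 'k) set set \<Rightarrow> nat \<Rightarrow> (nat \<Rightarrow> 'k) set set
    \<Rightarrow> ((nat \<Rightarrow> 'k) set \<Rightarrow> (nat \<Rightarrow> 'k) set) \<Rightarrow> bool" where
  "is_morphism K n V m Y \<phi> \<longleftrightarrow>
     (\<forall>P\<in>V. \<phi> P \<in> Y \<and>
       (\<exists>d f. (\<forall>i\<le>m. f i \<in> forms K n d) \<and> (\<exists>i\<le>m. \<not> vanishes (f i) P) \<and>
          (\<forall>Q\<in>V. (\<exists>i\<le>m. \<not> vanishes (f i) Q) \<longrightarrow>
             (\<forall>x\<in>Q. \<phi> Q = pt (\<lambda>i. if i \<le> m then mpol_eval (f i) x else 0)))))"

definition isomorphic_over ::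
  "'k::field set \<Rightarrow> nat \<Rightarrow> (nat \<Rightarrow> 'k) set set \<Rightarrow> nat \<Rightarrow> (nat \<Rightarrow> 'k) set set \<Rightarrow> bool" where
  "isomorphic_over K n V m Y \<longleftrightarrow>
     (\<exists>\<phi> \<psi>. is_morphism K n V m Y \<phi> \<and> is_morphism K m Y n V \<psi> \<and>
        (\<forall>P\<in>V. \<psi> (\<phi> P) = P) \<and> (\<forall>Q\<in>Y. \<phi> (\<psi> Q) = Q))"

definition is_twist ::
  "nat \<Rightarrow> (nat \<Rightarrow> 'f::field_char_0 alg_closure) set set
    \<Rightarrow> nat \<Rightarrow> (nat \<Rightarrow> 'f alg_closure) set set \<Rightarrow> bool" where
  "is_twist n V m Y \<longleftrightarrow> is_variety (range to_ac) n V \<and> isomorphic_over UNIV n V m Y"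

text \<open>
  A dominant rational map from the projective plane, represented by a morphism on a nonempty
  open subset whose image is dense.
\<close>

definition has_parametrization ::
  "'k::field set \<Rightarrow> nat \<Rightarrow> (nat \<Rightarrow> 'k) set set \<Rightarrow> bool" where
  "has_parametrization K n V \<longleftrightarrow>
     (\<exists>W \<phi>. zclosed K 2 W \<and> proj_space 2 - W \<noteq> {} \<and>
        is_morphism K 2 (proj_space 2 - W) n V \<phi> \<and>
        (\<forall>Z. zclosed K n Z \<and> \<phi> ` (proj_space 2 - W) \<subseteq> Z \<longrightarrow> V \<subseteq> Z))"

section \<open>The surfaces\<close>

text \<open>The product of two projective lines, as a subvariety of projective 3-space (Segre).\<close>

definition P1xP1 :: "(nat \<Rightarrow> 'k::field) set set" where
  "P1xP1 = {pt (\<lambda>l. if l \<le> 3 then s (l div 2) * t (l mod 2) else 0) | s t.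
     s \<in> coord_vecs 1 \<and> t \<in> coord_vecs 1}"

text \<open>
  The quadratic extension \<open>E = F(\<alpha>)\<close> is realised inside the algebraic closure. An element of
  \<open>E\<^sup>9\<close> is a 3 by 3 matrix (a function that vanishes off \<open>{..2} \<times> {..2}\<close>).
\<close>

definition sqrt_ac :: "'f::field_char_0 \<Rightarrow> 'f alg_closure" where
  "sqrt_ac a = (SOME z. z ^ 2 = to_ac a)"

definition quad_ext :: "'f::field_char_0 \<Rightarrow> 'f alg_closure set" where
  "quad_ext a = {to_ac x + to_ac y * sqrt_ac a | x y. True}"

definition quad_conj :: "'f::field_char_0 \<Rightarrow> 'f alg_closure \<Rightarrow> 'f alg_closure" where
  "quad_conj a c =
     (THE d. \<exists>x y. c = to_ac x + to_ac y * sqrt_ac a \<and> d = to_ac x - to_ac y * sqrt_ac a)"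

definition Sigma_map ::
  "'f::field_char_0 \<Rightarrow> (nat \<Rightarrow> nat \<Rightarrow> 'f alg_closure) \<Rightarrow> (nat \<Rightarrow> nat \<Rightarrow> 'f alg_closure)" where
  "Sigma_map a v = (\<lambda>i j. quad_conj a (v j i))"

definition fixed_space :: "'f::field_char_0 \<Rightarrow> (nat \<Rightarrow> nat \<Rightarrow> 'f alg_closure) set" where
  "fixed_space a =
     {v. (\<forall>i j. v i j \<in> quad_ext a) \<and> (\<forall>i j. \<not> (i \<le> 2 \<and> j \<le> 2) \<longrightarrow> v i j = 0) \<and>
         Sigma_map a v = v}"

definition sym_mat :: "nat \<Rightarrow> nat \<Rightarrow> nat \<Rightarrow> nat \<Rightarrow> 'k::field" where
  "sym_mat p q = (\<lambda>i j. if (i, j) = (p, q) \<or> (i, j) = (q, p) then 1 else 0)"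

definition skew_mat :: "'k \<Rightarrow> nat \<Rightarrow> nat \<Rightarrow> nat \<Rightarrow> nat \<Rightarrow> 'k::field" where
  "skew_mat \<alpha> p q = (\<lambda>i j. if (i, j) = (p, q) then \<alpha> else if (i, j) = (q, p) then - \<alpha> else 0)"

definition fixed_basis :: "'f::field_char_0 \<Rightarrow> nat \<Rightarrow> nat \<Rightarrow> nat \<Rightarrow> 'f alg_closure" where
  "fixed_basis a k =
     [sym_mat 0 0, sym_mat 1 1, sym_mat 2 2, sym_mat 0 1, sym_mat 0 2, sym_mat 1 2,
      skew_mat (sqrt_ac a) 0 1, skew_mat (sqrt_ac a) 0 2, skew_mat (sqrt_ac a) 1 2] ! k"

text \<open>
  \<open>fixed_basis a\<close> is an \<open>F\<close>-basis of the space of vectors fixed by \<open>Sigma_map a\<close>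
  (\<open>fixed_space_eq\<close> and \<open>fixed_basis_independent\<close> below). It identifies the projective space of
  that space with projective 8-space: over the algebraic closure, the coordinates \<open>y\<close> belong to
  the vector \<open>\<Sum>k\<le>8. y k * fixed_basis a k\<close>. The sphere consists of those \<open>y\<close> whose vector lies
  on the anticanonically embedded product of two lines, \<open>x\<^sub>i\<^sub>j = s\<^sup>i t\<^sup>j\<close> homogenised.
\<close>

definition sphere_surface :: "'f::field_char_0 \<Rightarrow> (nat \<Rightarrow> 'f alg_closure) set set" where
  "sphere_surface a = {pt y | y. y \<in> coord_vecs 8 \<and>
     (\<exists>s0 s1 t0 t1. (s0, s1) \<noteq> (0, 0) \<and> (t0, t1) \<noteq> (0, 0) \<and>
        (\<forall>i\<le>2. \<forall>j\<le>2. (\<Sum>k\<le>8. y k * fixed_basis a k i j) =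
            (s0 ^ i * s1 ^ (2 - i)) * (t0 ^ j * t1 ^ (2 - j))))}"

lemma sqrt_ac_power2: "sqrt_ac a ^ 2 = to_ac a"
  unfolding sqrt_ac_def by (rule someI_ex, rule nth_root_exists) simp

lemma quad_coords_unique:
  assumes "\<not> (\<exists>b. a = b ^ 2)"
    and "to_ac x + to_ac y * sqrt_ac a = to_ac x' + to_ac y' * sqrt_ac a"
  shows "x = x' \<and> y = y'"
proof -
  have e: "to_ac (x - x') = to_ac (y' - y) * sqrt_ac a"
    using assms(2) by (simp add: algebra_simps)
  have "y' = y"
  proof (rule ccontr)
    assume "y' \<noteq> y"
    then have "sqrt_ac a = to_ac ((x - x') / (y' - y))"
      using e by (simp add: field_simps del: to_ac_diff)
    then have "to_ac a = to_ac (((x - x') / (y' - y)) ^ 2)"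
      by (metis sqrt_ac_power2 to_ac_power)
    then show False using assms(1) by (metis to_ac_eq_iff)
  qed
  with e show ?thesis by simp
qed

lemma quad_conj_eq:
  assumes "\<not> (\<exists>b. a = b ^ 2)"
  shows "quad_conj a (to_ac x + to_ac y * sqrt_ac a) = to_ac x - to_ac y * sqrt_ac a"
  unfolding quad_conj_def
  by (rule the_equality) (use quad_coords_unique[OF assms] in blast)+

lemma sum_fixed_basis:
  "(\<Sum>k\<le>8. y k * fixed_basis a k i j) =
     y 0 * sym_mat 0 0 i j + y 1 * sym_mat 1 1 i j + y 2 * sym_mat 2 2 i j +
     y 3 * sym_mat 0 1 i j + y 4 * sym_mat 0 2 i j + y 5 * sym_mat 1 2 i j +
     y 6 * skew_mat (sqrt_ac a) 0 1 i j + y 7 * skew_mat (sqrt_ac a) 0 2 i j +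
     y 8 * skew_mat (sqrt_ac a) 1 2 i j"
proof -
  have "{..8::nat} = {0, 1, 2, 3, 4, 5, 6, 7, 8}" by auto
  then show ?thesis by (simp add: fixed_basis_def algebra_simps)
qed

lemma fixed_space_eq:
  fixes a :: "'f::field_char_0"
  assumes a: "\<not> (\<exists>b. a = b ^ 2)"
  shows "fixed_space a =
    {(\<lambda>i j. \<Sum>k\<le>8. to_ac (c k) * fixed_basis a k i j) | c. True}" (is "_ = ?R")
proof (intro equalityI subsetI)
  fix v assume v: "v \<in> fixed_space a"
  then have "\<forall>i j. \<exists>x y. v i j = to_ac x + to_ac y * sqrt_ac a"
    by (auto simp: fixed_space_def quad_ext_def)
  then obtain x y where xy: "\<And>i j. v i j = to_ac (x i j) + to_ac (y i j) * sqrt_ac a"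
    by metis
  have "Sigma_map a v = v" using v by (simp add: fixed_space_def)
  then have conj: "quad_conj a (v j i) = v i j" for i j
    unfolding Sigma_map_def by (rule fun_cong[OF fun_cong])
  have "to_ac (x i j) + to_ac (y i j) * sqrt_ac a =
      to_ac (x j i) + to_ac (- y j i) * sqrt_ac a" for i j
    using quad_conj_eq[OF a, of "x j i" "y j i"]
    by (simp add: xy[symmetric] conj[of j i])
  then have s: "x i j = x j i \<and> y i j = - y j i" for i j
    using quad_coords_unique[OF a] by blast
  have d: "y i i = 0" for i
  proof -
    have "2 * y i i = y i i + - y i i" using s[of i i] by simp
    then show ?thesis by simp
  qed
  have s': "x 1 0 = x 0 1" "x 2 0 = x 0 2" "x 2 1 = x 1 2"
    "y 1 0 = - y 0 1" "y 2 0 = - y 0 2" "y 2 1 = - y 1 2"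
    using s by blast+
  define c where "c k = [x 0 0, x 1 1, x 2 2, x 0 1, x 0 2, x 1 2, y 0 1, y 0 2, y 1 2] ! k" for k
  have "v i j = (\<Sum>k\<le>8. to_ac (c k) * fixed_basis a k i j)" for i j
  proof (cases "i \<le> 2 \<and> j \<le> 2")
    case True
    then have "i \<in> {0, 1, 2}" "j \<in> {0, 1, 2}" by auto
    then show ?thesis
      by (elim insertE emptyE;
          simp add: sum_fixed_basis sym_mat_def skew_mat_def c_def xy d s' del: One_nat_def)
  next
    case False
    then have "v i j = 0" using v by (auto simp: fixed_space_def)
    with False show ?thesis by (auto simp: sum_fixed_basis sym_mat_def skew_mat_def)
  qed
  then show "v \<in> ?R" by blast
next
  fix v assume "v \<in> ?R"
  then obtain c where v: "v = (\<lambda>i j. \<Sum>k\<le>8. to_ac (c k) * fixed_basis a k i j)" by blast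
  define x where "x i j =
     (if (i, j) = (0, 0) then c 0 else if (i, j) = (1, 1) then c 1 else
      if (i, j) = (2, 2) then c 2 else if (i, j) = (0, 1) \<or> (i, j) = (1, 0) then c 3 else
      if (i, j) = (0, 2) \<or> (i, j) = (2, 0) then c 4 else
      if (i, j) = (1, 2) \<or> (i, j) = (2, 1) then c 5 else 0)" for i j :: nat
  define y where "y i j = (if (i, j) = (0, 1) then c 6 else if (i, j) = (1, 0) then - c 6 else
     if (i, j) = (0, 2) then c 7 else if (i, j) = (2, 0) then - c 7 else
     if (i, j) = (1, 2) then c 8 else if (i, j) = (2, 1) then - c 8 else 0)" for i j :: nat
  have z: "v i j = 0" "x i j = 0" "y i j = 0" if "\<not> (i \<le> 2 \<and> j \<le> 2)" for i j
    using that by (auto simp: v sum_fixed_basis sym_mat_def skew_mat_def x_def y_def)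
  have xy: "v i j = to_ac (x i j) + to_ac (y i j) * sqrt_ac a" for i j
  proof (cases "i \<le> 2 \<and> j \<le> 2")
    case True
    then have "i \<in> {0, 1, 2}" "j \<in> {0, 1, 2}" by auto
    then show ?thesis
      by (elim insertE emptyE;
          simp add: v sum_fixed_basis sym_mat_def skew_mat_def x_def y_def)
  qed (simp add: z)
  have s: "x i j = x j i \<and> y j i = - y i j" for i j
  proof (cases "i \<le> 2 \<and> j \<le> 2")
    case True
    then have "i \<in> {0, 1, 2}" "j \<in> {0, 1, 2}" by auto
    then show ?thesis by (elim insertE emptyE; simp add: x_def y_def)
  next
    case False
    then show ?thesis using z[of i j] z[of j i] by auto
  qed
  have "Sigma_map a v i j = v i j" for i j
  proof -
    have "Sigma_map a v i j = to_ac (x j i) - to_ac (y j i) * sqrt_ac a"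
      unfolding Sigma_map_def xy[of j i] by (rule quad_conj_eq[OF a])
    also have "\<dots> = v i j"
      unfolding xy[of i j] using s[of i j] by simp
    finally show ?thesis .
  qed
  then have "Sigma_map a v = v" by blast
  moreover have "v i j \<in> quad_ext a" for i j using xy by (auto simp: quad_ext_def)
  ultimately show "v \<in> fixed_space a" using z(1) unfolding fixed_space_def by blast
qed

lemma fixed_basis_independent:
  assumes a: "a \<noteq> 0" and z: "\<And>i j. (\<Sum>k\<le>8. y k * fixed_basis a k i j) = 0" and k: "k \<le> 8"
  shows "y k = 0"
proof -
  have nz: "sqrt_ac a \<noteq> 0" using sqrt_ac_power2[of a] a by auto
  have d: "y 0 = 0" "y 1 = 0" "y 2 = 0"
    using z[of 0 0] z[of 1 1] z[of 2 2] by (auto simp: sum_fixed_basis sym_mat_def skew_mat_def)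
  have p: "u = 0 \<and> w = 0" if "u + w * sqrt_ac a = 0" "u - w * sqrt_ac a = 0" for u w
  proof -
    have "2 * u = (u + w * sqrt_ac a) + (u - w * sqrt_ac a)" by simp
    then have "u = 0" using that by simp
    with that nz show ?thesis by simp
  qed
  have "y 3 = 0 \<and> y 6 = 0" "y 4 = 0 \<and> y 7 = 0" "y 5 = 0 \<and> y 8 = 0"
    using z[of 0 1] z[of 1 0] z[of 0 2] z[of 2 0] z[of 1 2] z[of 2 1]
    by (intro p; simp add: sum_fixed_basis sym_mat_def skew_mat_def)+
  moreover have "k \<in> {0, 1, 2, 3, 4, 5, 6, 7, 8}" using k by auto
  ultimately show ?thesis using d by auto
qed

end

theory Submission
  imports Defs
begin

text \<open>Three rational points in general position make an isomorphism with the product of two lines so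
  rigid that the Galois group can act on it only by exchanging the two rulings.

  Let \<open>F\<close> be the base field, \<open>k\<close> its algebraic closure and \<open>\<phi>\<close> an isomorphism over \<open>k\<close> from \<open>V\<close> to
  \<open>P\<^sup>1 \<times> P\<^sup>1\<close>. A parametrization carries the rational points of the plane to rational points of \<open>V\<close>
  that are dense even for closed sets over \<open>k\<close> (\<open>rational_points_dense\<close>). Hence there are
  three of them whose images under \<open>\<phi>\<close> have pairwise distinct first and pairwise distinct second
  coordinates, and Moebius transformations of the two factors move the images to \<open>(0, 0)\<close>,
  \<open>(\<infinity>, \<infinity>)\<close> and \<open>(1, 1)\<close> (\<open>normalized_isomorphism\<close>). For a Galois automorphism \<open>s\<close> the map
  \<open>(s \<phi> s\<^sup>-\<^sup>1) \<phi>\<^sup>-\<^sup>1\<close> is an automorphism of \<open>P\<^sup>1 \<times> P\<^sup>1\<close> that fixes these three points, so it is the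
  identity or the exchange of the factors (\<open>P1xP1_automorphism\<close>).

  If it is the identity for all \<open>s\<close>, then \<open>\<phi>\<close> commutes with the Galois action and is defined over
  \<open>F\<close> (\<open>galois_descent_morphism\<close>), so that \<open>V\<close> is \<open>P\<^sup>1 \<times> P\<^sup>1\<close>. Otherwise the points \<open>(0, \<infinity>)\<close> and
  \<open>(\<infinity>, 0)\<close> are exchanged by some \<open>s\<close>, and a difference \<open>c\<close> of coordinates of their preimages is
  fixed or negated by \<open>s\<close> according to whether \<open>s\<close> preserves or exchanges the rulings. Then
  \<open>a = c\<^sup>2\<close> lies in \<open>F\<close>, it is not a square, and \<open>\<phi>\<close> followed by the embedding of \<open>P\<^sup>1 \<times> P\<^sup>1\<close> as
  \<open>S\<^sub>a\<close> commutes with the Galois action. Both outcomes contradict the hypotheses. The three points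
  take the place of Hilbert 90 and of the conics that a descent of the two factors would bring in.

  The automorphisms of \<open>P\<^sup>1 \<times> P\<^sup>1\<close> are found by a degree count. A morphism \<open>g\<close> to \<open>P\<^sup>1\<close> is given by
  two forms of some bidegree \<open>(d, e)\<close> with finitely many common zeros (\<open>bi_mor_min\<close>). If \<open>g\<close> is a
  coordinate of an automorphism, its fibres are disjoint rational curves. On a fibre whose
  parametrization has degrees \<open>(m, n)\<close> the two forms become multiples of one form of degree
  \<open>d m + e n\<close>; if that is positive, the form has a zero, so every such fibre contains a common zero,
  which is too many. Hence \<open>d = 0\<close> or \<open>e = 0\<close>, and \<open>g\<close> depends on one variable only
  (\<open>bi_mor_one_variable\<close>).\<close>

section \<open>Automorphisms of the algebraic closure\<close>

text \<open>The Galois group of the closure. Bijectivity is part of the definition, so that inverses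
  need no argument about algebraic elements.\<close>

definition gal :: "('f::field_char_0 alg_closure \<Rightarrow> 'f alg_closure) set" where
  "gal = {s. bij s \<and> (\<forall>x y. s (x + y) = s x + s y) \<and> (\<forall>x y. s (x * y) = s x * s y) \<and>
             (\<forall>a. s (to_ac a) = to_ac a)}"

text \<open>The graph of a homomorphism over the base field from a subring of the closure to the
  closure. Graphs are used because unions of chains of graphs are graphs; closure under
  inverses is automatic (\<open>emb_inverse\<close>).\<close>

definition partial_emb :: "('f::field_char_0 alg_closure \<times> 'f alg_closure) set \<Rightarrow> bool" where
  "partial_emb R \<longleftrightarrow> (\<forall>a. (to_ac a, to_ac a) \<in> R) \<and>
     (\<forall>x y x' y'. (x, y) \<in> R \<longrightarrow> (x', y') \<in> R \<longrightarrow> (x + x', y + y') \<in> R \<and> (x * x', y * y') \<in> R) \<and>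
     (\<forall>y. (0, y) \<in> R \<longrightarrow> y = 0)"

definition coeffs_rel :: "('a::zero \<times> 'a) set \<Rightarrow> 'a poly \<Rightarrow> 'a poly \<Rightarrow> bool" where
  "coeffs_rel R p q \<longleftrightarrow> (\<forall>i. (coeff p i, coeff q i) \<in> R)"

context
  fixes R :: "('f::field_char_0 alg_closure \<times> 'f alg_closure) set"
  assumes R: "partial_emb R"
begin

lemma emb_const: "(to_ac a, to_ac a) \<in> R"
  using R by (auto simp: partial_emb_def)

lemma emb_0: "(0, 0) \<in> R" and emb_1: "(1, 1) \<in> R" and emb_m1: "(-1, -1) \<in> R"
  using emb_const[of 0] emb_const[of 1] emb_const[of "-1"] by auto

lemma emb_add: "(x, y) \<in> R \<Longrightarrow> (x', y') \<in> R \<Longrightarrow> (x + x', y + y') \<in> R"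
  and emb_mult: "(x, y) \<in> R \<Longrightarrow> (x', y') \<in> R \<Longrightarrow> (x * x', y * y') \<in> R"
  and emb_zeroD: "(0, y) \<in> R \<Longrightarrow> y = 0"
  using R by (auto simp: partial_emb_def)

lemma emb_diff: "(x, y) \<in> R \<Longrightarrow> (x', y') \<in> R \<Longrightarrow> (x - x', y - y') \<in> R"
  using emb_add[of x y "- x'" "- y'"] emb_mult[OF emb_m1, of x' y'] by simp

lemma emb_unique: "(x, y) \<in> R \<Longrightarrow> (x, y') \<in> R \<Longrightarrow> y = y'"
  using emb_diff[of x y x y'] emb_zeroD[of "y - y'"] by simp

lemma emb_sum: "(\<And>i. i \<in> A \<Longrightarrow> (f i, g i) \<in> R) \<Longrightarrow> (sum f A, sum g A) \<in> R"
  by (induction A rule: infinite_finite_induct) (auto intro: emb_add emb_0)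

lemma emb_poly:
  assumes "coeffs_rel R p q" "(x, y) \<in> R"
  shows "(poly p x, poly q y) \<in> R"
  using assms(1)
proof (induction p arbitrary: q)
  case 0
  then have "(0, coeff q i) \<in> R" for i by (auto simp: coeffs_rel_def)
  then have "q = 0" using emb_zeroD by (intro poly_eqI) auto
  then show ?case using emb_0 by simp
next
  case (pCons a p)
  obtain b q' where q: "q = pCons b q'" by (cases q)
  have 1: "(a, b) \<in> R" using pCons.prems unfolding coeffs_rel_def q by (metis coeff_pCons_0)
  have "coeffs_rel R p q'" using pCons.prems unfolding coeffs_rel_def q by (metis coeff_pCons_Suc)
  from pCons.IH[OF this] have "(poly p x, poly q' y) \<in> R" .
  then show ?case using 1 assms(2) unfolding q by (auto intro: emb_add emb_mult)
qed

lemma emb_poly_const: "(x, y) \<in> R \<Longrightarrow> (poly (map_poly to_ac f) x, poly (map_poly to_ac f) y) \<in> R"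
  by (rule emb_poly) (auto simp: coeffs_rel_def coeff_map_poly emb_const)

text \<open>The inverse of an algebraic element is a polynomial in it: divide its equation of least
  degree, whose constant term is not zero, by the element.\<close>

lemma emb_inverse:
  assumes "(x, y) \<in> R" "x \<noteq> 0"
  shows "(inverse x, inverse y) \<in> R \<and> y \<noteq> 0"
proof -
  define N where "N = (LEAST d. \<exists>f. f \<noteq> 0 \<and> poly (map_poly to_ac f) x = 0 \<and> degree f = d)"
  have "\<exists>d f. f \<noteq> 0 \<and> poly (map_poly to_ac f) x = 0 \<and> degree f = d"
    using alg_closure_algebraic[of x] by metis
  from LeastI_ex[OF this] obtain f where f: "f \<noteq> 0" "poly (map_poly to_ac f) x = 0" "degree f = N"
    unfolding N_def by blast
  obtain c g where fc: "f = pCons c g" by (cases f)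
  have "c \<noteq> 0"
  proof
    assume c: "c = 0"
    then have "g \<noteq> 0" "poly (map_poly to_ac g) x = 0"
      using f fc assms(2) by (auto simp: map_poly_pCons)
    then have "N \<le> degree g" unfolding N_def by (intro Least_le) blast
    then show False using f(3) fc \<open>g \<noteq> 0\<close> by simp
  qed
  have px: "(poly (map_poly to_ac g) x, poly (map_poly to_ac g) y) \<in> R"
    by (rule emb_poly_const[OF assms(1)])
  have "(poly (map_poly to_ac f) x, poly (map_poly to_ac f) y) \<in> R"
    by (rule emb_poly_const[OF assms(1)])
  then have fy: "poly (map_poly to_ac f) y = 0" using f emb_zeroD by auto
  have ex: "x * poly (map_poly to_ac g) x = - to_ac c" and ey: "y * poly (map_poly to_ac g) y = - to_ac c"
    using f(2) fy by (auto simp: fc map_poly_pCons eq_neg_iff_add_eq_0 add.commute)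
  have y: "y \<noteq> 0" using ey \<open>c \<noteq> 0\<close> by auto
  have "inverse x = to_ac (- inverse c) * poly (map_poly to_ac g) x"
    using ex assms(2) \<open>c \<noteq> 0\<close> by (simp add: field_simps)
  moreover have "inverse y = to_ac (- inverse c) * poly (map_poly to_ac g) y"
    using ey y \<open>c \<noteq> 0\<close> by (simp add: field_simps)
  ultimately show ?thesis using emb_mult[OF emb_const px] y by metis
qed

lemma emb_divide: "(x, y) \<in> R \<Longrightarrow> (x', y') \<in> R \<Longrightarrow> x' \<noteq> 0 \<Longrightarrow> (x / x', y / y') \<in> R"
  using emb_mult[of x y "inverse x'" "inverse y'"] emb_inverse[of x' y'] by (simp add: divide_inverse)

lemma coeffs_rel_degree:
  assumes "coeffs_rel R p q"
  shows "degree q = degree p"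
proof -
  have "coeff p i = 0 \<longleftrightarrow> coeff q i = 0" for i
    using assms emb_zeroD emb_inverse[of "coeff p i" "coeff q i"] unfolding coeffs_rel_def by metis
  then show ?thesis by (simp add: Polynomial.degree_def)
qed

lemma coeffs_rel_add: "coeffs_rel R p q \<Longrightarrow> coeffs_rel R p' q' \<Longrightarrow> coeffs_rel R (p + p') (q + q')"
  and coeffs_rel_diff: "coeffs_rel R p q \<Longrightarrow> coeffs_rel R p' q' \<Longrightarrow> coeffs_rel R (p - p') (q - q')"
  by (auto simp: coeffs_rel_def emb_add emb_diff)

lemma coeffs_rel_mult: "coeffs_rel R p q \<Longrightarrow> coeffs_rel R p' q' \<Longrightarrow> coeffs_rel R (p * p') (q * q')"
  by (auto simp: coeffs_rel_def coeff_mult intro!: emb_sum emb_mult)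

lemma coeffs_rel_monom: "(a, b) \<in> R \<Longrightarrow> coeffs_rel R (monom a n) (monom b n)"
  by (auto simp: coeffs_rel_def emb_0)

text \<open>The usual extension to a simple extension, \<open>x\<close> going to a root \<open>y\<close> of the transported
  minimal polynomial. Well-definedness is the division by \<open>p0\<close>, done as an induction that cancels
  leading terms on both sides at once.\<close>

lemma partial_emb_adjoin:
  assumes pq: "coeffs_rel R p0 q0" "p0 \<noteq> 0" "poly p0 x = 0" "poly q0 y = 0"
    and min: "\<And>p q. coeffs_rel R p q \<Longrightarrow> p \<noteq> 0 \<Longrightarrow> poly p x = 0 \<Longrightarrow> degree p0 \<le> degree p"
  shows "\<exists>R'. partial_emb R' \<and> R \<subseteq> R' \<and> (x, y) \<in> R'"
proof -
  define R' where "R' = {(poly p x, poly q y) | p q. coeffs_rel R p q}"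
  have zero: "poly q y = 0" if "coeffs_rel R p q" "poly p x = 0" for p q
    using that
  proof (induction "degree p" arbitrary: p q rule: less_induct)
    case less
    show ?case
    proof (cases "p = 0")
      case True
      then have "(0, coeff q i) \<in> R" for i using less.prems by (auto simp: coeffs_rel_def)
      then have "q = 0" using emb_zeroD by (intro poly_eqI) auto
      then show ?thesis by simp
    next
      case False
      have dle: "degree p0 \<le> degree p" using min less.prems False by blast
      define n where "n = degree p - degree p0"
      define a where "a = lead_coeff p / lead_coeff p0"
      define b where "b = coeff q (degree p) / coeff q0 (degree p0)"
      have "(a, b) \<in> R" unfolding a_def b_def
        by (rule emb_divide) (use less.prems pq in \<open>auto simp: coeffs_rel_def\<close>)
      define p' where "p' = p - monom a n * p0"
      define q' where "q' = q - monom b n * q0"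
      have rel: "coeffs_rel R p' q'" unfolding p'_def q'_def
        by (intro coeffs_rel_diff coeffs_rel_mult coeffs_rel_monom less.prems pq \<open>(a,b) \<in> R\<close>)
      have px: "poly p' x = 0" unfolding p'_def using less.prems pq by simp
      have qy: "poly q' y = poly q y" unfolding q'_def using pq by simp
      have a0: "a \<noteq> 0" using False pq by (auto simp: a_def)
      have dm: "degree (monom a n * p0) = degree p"
        using a0 pq dle by (simp add: degree_mult_eq degree_monom_eq n_def)
      have "coeff (monom a n * p0) (degree p) = lead_coeff p"
        using pq dle by (simp add: coeff_monom_mult n_def a_def)
      then have c0: "coeff p' (degree p) = 0" by (simp add: p'_def)
      have dle': "degree p' \<le> degree p" unfolding p'_def using dm
        by (metis degree_diff_le order_refl)
      show ?thesis
      proof (cases "p' = 0")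
        case True
        then have "(0, coeff q' i) \<in> R" for i using rel by (auto simp: coeffs_rel_def)
        then have "q' = 0" using emb_zeroD by (intro poly_eqI) auto
        then show ?thesis using qy by simp
      next
        case F: False
        then have "degree p' < degree p"
          using c0 dle' by (metis le_neq_implies_less leading_coeff_neq_0)
        from less.hyps[OF this rel px] qy show ?thesis by simp
      qed
    qed
  qed
  have emb: "partial_emb R'"
    unfolding partial_emb_def
  proof (intro conjI allI impI)
    fix a show "(to_ac a, to_ac a) \<in> R'" unfolding R'_def
      using coeffs_rel_monom[OF emb_const, of a 0] by (force simp: monom_0)
  next
    fix u v u' v' assume "(u, v) \<in> R'" "(u', v') \<in> R'"
    then obtain p q p' q' where r: "coeffs_rel R p q" "coeffs_rel R p' q'"
      and e: "u = poly p x" "v = poly q y" "u' = poly p' x" "v' = poly q' y"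
      unfolding R'_def by blast
    show "(u + u', v + v') \<in> R'" unfolding R'_def e
      using coeffs_rel_add[OF r] by (metis (mono_tags, lifting) mem_Collect_eq poly_add)
    show "(u * u', v * v') \<in> R'" unfolding R'_def e
      using coeffs_rel_mult[OF r] by (metis (mono_tags, lifting) mem_Collect_eq poly_mult)
  next
    fix v assume "(0, v) \<in> R'"
    then show "v = 0" unfolding R'_def using zero by force
  qed
  have "R \<subseteq> R'"
  proof
    fix z assume "z \<in> R"
    then obtain u v where z: "z = (u, v)" "(u, v) \<in> R" by (cases z) auto
    have "(poly (monom u 0) x, poly (monom v 0) y) \<in> R'" unfolding R'_def
      using coeffs_rel_monom[OF z(2), of 0] by blast
    then show "z \<in> R'" by (simp add: z monom_0)
  qed
  moreover have "(poly (monom 1 1) x, poly (monom 1 1) y) \<in> R'"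
    unfolding R'_def using coeffs_rel_monom[OF emb_1, of 1] by blast
  then have "(x, y) \<in> R'" by (simp add: monom_altdef)
  ultimately show ?thesis using emb by blast
qed

lemma partial_emb_extend:
  shows "\<exists>R' y. partial_emb R' \<and> R \<subseteq> R' \<and> (x, y) \<in> R'"
proof -
  define P where "P p d \<longleftrightarrow> (\<exists>q. coeffs_rel R p q) \<and> p \<noteq> 0 \<and> poly p x = 0 \<and> degree p = d" for p d
  obtain f where f: "f \<noteq> 0" "poly (map_poly to_ac f) x = 0"
    using alg_closure_algebraic[of x] by metis
  have "coeffs_rel R (map_poly to_ac f) (map_poly to_ac f)"
    by (auto simp: coeffs_rel_def coeff_map_poly emb_const)
  moreover have "map_poly to_ac f \<noteq> 0" using f by (simp add: map_poly_eq_0_iff)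
  ultimately have "\<exists>d p. P p d" unfolding P_def using f by blast
  from LeastI_ex[OF this] obtain p where p: "P p (LEAST d. \<exists>p. P p d)" by blast
  then obtain q where q: "coeffs_rel R p q" "p \<noteq> 0" "poly p x = 0" unfolding P_def by blast
  have min: "degree p \<le> degree p'" if "coeffs_rel R p' q'" "p' \<noteq> 0" "poly p' x = 0" for p' q'
  proof -
    have "P p' (degree p')" using that by (auto simp: P_def)
    then have "(LEAST d. \<exists>p. P p d) \<le> degree p'" by (metis (mono_tags) Least_le)
    then show ?thesis using p by (auto simp: P_def)
  qed
  have "degree p > 0"
  proof (rule ccontr)
    assume "\<not> degree p > 0"
    then obtain c where "p = [:c:]" by (metis degree_eq_zeroE gr0I)
    then show False using q by auto
  qed
  then have "degree q > 0" using coeffs_rel_degree[OF q(1)] by simp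
  then obtain y where "poly q y = 0" using alg_closed_imp_poly_has_root by blast
  from partial_emb_adjoin[OF q this] min show ?thesis by blast
qed

end

text \<open>By Zorn's lemma there is a maximal graph, and it is total because one more element could
  be adjoined. It is surjective because it permutes the finitely many roots of each polynomial over
  the base field.\<close>

lemma partial_emb_extends_to_gal:
  fixes R :: "('f::field_char_0 alg_closure \<times> 'f alg_closure) set"
  assumes R: "partial_emb R"
  shows "\<exists>s\<in>gal. \<forall>(x, y)\<in>R. s x = y"
proof -
  define A where "A = {R'. partial_emb R' \<and> R \<subseteq> R'}"
  have "\<exists>M\<in>A. \<forall>S\<in>A. M \<subseteq> S \<longrightarrow> S = M"
  proof (rule subset_Zorn_nonempty)
    show "A \<noteq> {}" using R by (auto simp: A_def)
  next
    fix C assume C: "C \<noteq> {}" "subset.chain A C"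
    then have CA: "C \<subseteq> A" and ch: "\<And>S T. S \<in> C \<Longrightarrow> T \<in> C \<Longrightarrow> S \<subseteq> T \<or> T \<subseteq> S"
      by (auto simp: subset_chain_def)
    have "partial_emb (\<Union>C)"
      unfolding partial_emb_def
    proof (intro conjI allI impI)
      fix a show "(to_ac a, to_ac a) \<in> \<Union>C"
      proof -
        obtain S where "S \<in> C" using C(1) by blast
        then have "(to_ac a, to_ac a) \<in> S" using CA by (intro emb_const) (auto simp: A_def)
        then show ?thesis using \<open>S \<in> C\<close> by blast
      qed
    next
      fix x y x' y' assume "(x, y) \<in> \<Union>C" "(x', y') \<in> \<Union>C"
      then obtain S T where ST: "S \<in> C" "T \<in> C" "(x, y) \<in> S" "(x', y') \<in> T" by blast
      then obtain U where U: "U \<in> C" "(x, y) \<in> U" "(x', y') \<in> U" using ch[of S T] by blast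
      then have "partial_emb U" using CA by (auto simp: A_def)
      from emb_add[OF this U(2,3)] emb_mult[OF this U(2,3)] U(1)
      show "(x + x', y + y') \<in> \<Union>C" "(x * x', y * y') \<in> \<Union>C" by blast+
    next
      fix y assume "(0, y) \<in> \<Union>C"
      then obtain S where S: "S \<in> C" "(0, y) \<in> S" by blast
      then have "partial_emb S" using CA by (auto simp: A_def)
      from emb_zeroD[OF this S(2)] show "y = 0" .
    qed
    moreover have "R \<subseteq> \<Union>C" using C(1) CA by (auto simp: A_def)
    ultimately show "\<Union>C \<in> A" by (simp add: A_def)
  qed
  then obtain M where MA: "M \<in> A" and max': "\<And>S. S \<in> A \<Longrightarrow> M \<subseteq> S \<Longrightarrow> S = M" by blast
  then have M: "partial_emb M" "R \<subseteq> M" by (auto simp: A_def)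
  have max: "S = M" if "partial_emb S" "M \<subseteq> S" for S
    using max'[of S] that M(2) by (auto simp: A_def)
  have tot: "\<exists>y. (x, y) \<in> M" for x
    using partial_emb_extend[OF M(1), of x] max by blast
  define s where "s x = (SOME y. (x, y) \<in> M)" for x
  have sM: "(x, s x) \<in> M" for x unfolding s_def by (rule someI_ex[OF tot])
  have sI: "s x = y" if "(x, y) \<in> M" for x y using emb_unique[OF M(1) sM that] .
  have add: "s (x + y) = s x + s y" and mult: "s (x * y) = s x * s y" and const: "s (to_ac a) = to_ac a" for x y a
    by (rule sI, intro emb_add[OF M(1)] emb_mult[OF M(1)] emb_const[OF M(1)] sM)+
  have inj: "inj s"
  proof (rule injI, rule ccontr)
    fix x y assume e: "s x = s y" "x \<noteq> y"
    have "(x - y, s x - s y) \<in> M" by (intro emb_diff[OF M(1)] sM)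
    from emb_inverse[OF M(1) this] e show False by simp
  qed
  have surj: "y \<in> range s" for y
  proof -
    obtain f where f: "f \<noteq> 0" "poly (map_poly to_ac f) y = 0"
      using alg_closure_algebraic[of y] by metis
    let ?U = "{z. poly (map_poly to_ac f) z = 0}"
    have "map_poly to_ac f \<noteq> 0" using f by (simp add: map_poly_eq_0_iff)
    then have fin: "finite ?U" by (rule poly_roots_finite)
    have "s ` ?U \<subseteq> ?U"
    proof clarify
      fix z assume z: "poly (map_poly to_ac f) z = 0"
      have "(poly (map_poly to_ac f) z, poly (map_poly to_ac f) (s z)) \<in> M"
        by (rule emb_poly_const[OF M(1) sM])
      then show "poly (map_poly to_ac f) (s z) = 0" using z emb_zeroD[OF M(1)] by auto
    qed
    then have "s ` ?U = ?U" using fin inj by (metis endo_inj_surj inj_on_subset subset_UNIV)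
    then show ?thesis using f by blast
  qed
  have "s \<in> gal" using inj surj add mult const unfolding gal_def bij_def by blast
  moreover have "\<forall>(x, y)\<in>R. s x = y" using M(2) sI by blast
  ultimately show ?thesis by blast
qed

text \<open>The equation of least degree of an element outside the base field has degree at least two.
  In characteristic zero the derivative shows that the element is a simple root, so there is another
  root, and some automorphism moves one to the other.\<close>

theorem gal_fixed_field:
  fixes x :: "'f::field_char_0 alg_closure"
  assumes fx: "\<And>s. s \<in> gal \<Longrightarrow> s x = x"
  shows "x \<in> range to_ac"
proof (rule ccontr)
  assume nx: "x \<notin> range to_ac"
  define R where "R = range (\<lambda>a::'f. (to_ac a, to_ac a))"
  have R: "partial_emb R"
    unfolding partial_emb_def R_def by (auto simp flip: to_ac_add to_ac_mult) 
  define P where "P f d \<longleftrightarrow> f \<noteq> 0 \<and> poly (map_poly to_ac f) x = 0 \<and> degree f = d" for f :: "'f poly" and d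
  have "\<exists>d f. P f d" using alg_closure_algebraic[of x] unfolding P_def by metis
  from LeastI_ex[OF this] obtain f where f: "P f (LEAST d. \<exists>f. P f d)" by blast
  have min: "degree f \<le> degree g" if "g \<noteq> 0" "poly (map_poly to_ac g) x = 0" for g
  proof -
    have "P g (degree g)" using that by (auto simp: P_def)
    then have "(LEAST d. \<exists>p. P p d) \<le> degree g" by (metis (mono_tags) Least_le)
    then show ?thesis using f by (auto simp: P_def)
  qed
  have f0: "f \<noteq> 0" and fx0: "poly (map_poly to_ac f) x = 0" using f by (auto simp: P_def)
  have deg: "degree (map_poly to_ac f) = degree f" by (simp add: degree_map_poly)
  define p where "p = map_poly to_ac f"
  have p0: "p \<noteq> 0" using f0 by (simp add: p_def map_poly_eq_0_iff)
  obtain r where r: "p = [:- x, 1:] * r" using fx0 unfolding p_def poly_eq_0_iff_dvd by (elim dvdE)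
  have r0: "r \<noteq> 0" using p0 r by auto
  have dpr: "degree p = Suc (degree r)" using r0 unfolding r by (subst degree_mult_eq) auto
  have "degree r > 0"
  proof (rule ccontr)
    assume "\<not> degree r > 0"
    then have "degree f = 1" using dpr deg by (simp add: p_def)
    obtain a g where ag: "f = pCons a g" by (cases f)
    with \<open>degree f = 1\<close> have "degree g = 0" "g \<noteq> 0" by (auto split: if_splits)
    then obtain b where ab: "f = [:a, b:]" "b \<noteq> 0" using ag by (metis degree_eq_zeroE pCons_0_0)
    then have "to_ac a + x * to_ac b = 0" using fx0 by (simp add: map_poly_pCons)
    then have "x = to_ac (- a / b)" using ab(2) by (simp add: field_simps eq_neg_iff_add_eq_0)
    then show False using nx by blast
  qed
  then obtain y where y: "poly r y = 0" using alg_closed_imp_poly_has_root by blast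
  have "y \<noteq> x"
  proof
    assume "y = x"
    have pd: "pderiv p = map_poly to_ac (pderiv f)"
      by (rule poly_eqI) (simp add: p_def coeff_pderiv coeff_map_poly)
    have "poly (pderiv p) x = 0"
      using y \<open>y = x\<close> unfolding r by (simp add: pderiv_mult pderiv_pCons del: mult_pCons_left)
    then have z: "poly (map_poly to_ac (pderiv f)) x = 0" by (simp add: pd)
    have "degree f > 0" using dpr deg by (simp add: p_def)
    then have nz: "pderiv f \<noteq> 0" by (simp add: pderiv_eq_0_iff)
    from min[OF nz z] \<open>degree f > 0\<close> show False by (simp add: degree_pderiv)
  qed
  have rel: "coeffs_rel R p p" by (auto simp: coeffs_rel_def p_def coeff_map_poly R_def)
  have py: "poly p y = 0" using y by (simp add: r)
  have px: "poly p x = 0" using fx0 by (simp add: p_def)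
  have dmin: "degree p \<le> degree p'" if c: "coeffs_rel R p' q'" "p' \<noteq> 0" "poly p' x = 0" for p' q'
  proof -
    have "\<forall>i. coeff p' i \<in> range to_ac" using c(1) by (auto simp: coeffs_rel_def R_def)
    then have "p' = map_poly to_ac (map_poly of_ac p')"
      by (intro poly_eqI) (auto simp: coeff_map_poly to_ac_of_ac)
    then have "degree f \<le> degree (map_poly of_ac p')"
      using min[of "map_poly of_ac p'"] c by fastforce
    also have "\<dots> \<le> degree p'" by (rule map_poly_degree_leq)
    finally show ?thesis using deg by (simp add: p_def)
  qed
  have "\<exists>R'. partial_emb R' \<and> R \<subseteq> R' \<and> (x, y) \<in> R'"
    by (rule partial_emb_adjoin[OF R rel p0 px py]) (rule dmin)
  then
  obtain R' where R': "partial_emb R'" "(x, y) \<in> R'" by blast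
  obtain s where s: "s \<in> gal" "\<forall>(x, y)\<in>R'. s x = y"
    using partial_emb_extends_to_gal[OF R'(1)] by (elim bexE)
  from s(2) R'(2) have "s x = y" by auto
  then show False using fx[OF s(1)] \<open>y \<noteq> x\<close> by simp
qed

lemma galD:
  assumes "s \<in> gal"
  shows "bij s" "s (x + y) = s x + s y" "s (x * y) = s x * s y" "s (to_ac a) = to_ac a"
  using assms by (auto simp: gal_def)

lemma gal_simps:
  assumes "s \<in> gal"
  shows "s 0 = 0" "s 1 = 1" "s (- x) = - s x" "s (x - y) = s x - s y" "s (x ^ n) = s x ^ n"
    "s (sum f A) = (\<Sum>i\<in>A. s (f i))" "s (prod f A) = (\<Prod>i\<in>A. s (f i))"
    "s x = s y \<longleftrightarrow> x = y" "s x = 0 \<longleftrightarrow> x = 0"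
proof -
  show 0: "s 0 = 0" using galD(4)[OF assms, of 0] by simp
  show 1: "s 1 = 1" using galD(4)[OF assms, of 1] by simp
  have m: "s (- x) = - s x" for x
    using galD(2)[OF assms, of x "- x"] 0 by (simp add: eq_neg_iff_add_eq_0 add.commute)
  show "s (- x) = - s x" by (rule m)
  show "s (x - y) = s x - s y"
    using galD(2)[OF assms, of x "- y"] m by simp
  show "s (x ^ n) = s x ^ n" by (induction n) (simp_all add: 1 galD[OF assms])
  show "s (sum f A) = (\<Sum>i\<in>A. s (f i))"
    by (induction A rule: infinite_finite_induct) (simp_all add: 0 galD[OF assms])
  show "s (prod f A) = (\<Prod>i\<in>A. s (f i))"
    by (induction A rule: infinite_finite_induct) (simp_all add: 1 galD[OF assms])
  show i: "s x = s y \<longleftrightarrow> x = y" for x y using galD(1)[OF assms] by (metis bij_is_inj inj_eq)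
  show "s x = 0 \<longleftrightarrow> x = 0" using i[of x 0] 0 by simp
qed

lemma gal_inv_ex:
  assumes "s \<in> gal"
  obtains t where "t \<in> gal" "\<And>x. t (s x) = x" "\<And>x. s (t x) = x"
proof -
  have b: "bij s" using galD[OF assms] by simp
  let ?t = "inv_into UNIV s"
  have st: "s (?t x) = x" "?t (s x) = x" for x
    using b by (simp_all add: bij_is_surj surj_f_inv_f bij_is_inj inv_f_f)
  have "?t \<in> gal" unfolding gal_def
    using b st galD[OF assms] by (auto simp: bij_imp_bij_inv) (metis st galD[OF assms])+
  with st that show ?thesis by blast
qed

section \<open>Descent of linear spaces\<close>

text \<open>A Galois stable space of vectors is spanned by its rational vectors: a nonzero vector of
  minimal support, scaled to have an entry 1, is rational, since its difference from a conjugate has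
  smaller support. The subspace \<open>B\<close> lets the result be used to find a rational vector that does not
  satisfy some further linear conditions.\<close>

lemma galois_descent_vector:
  fixes W B :: "('i \<Rightarrow> 'f::field_char_0 alg_closure) set"
  assumes fin: "\<And>w. w \<in> W \<Longrightarrow> finite {i. w i \<noteq> 0}"
    and Wlin: "\<And>a b w w'. w \<in> W \<Longrightarrow> w' \<in> W \<Longrightarrow> (\<lambda>i. a * w i + b * w' i) \<in> W"
    and Wgal: "\<And>s w. s \<in> gal \<Longrightarrow> w \<in> W \<Longrightarrow> s \<circ> w \<in> W"
    and B0: "(\<lambda>_. 0) \<in> B"
    and Blin: "\<And>a w w'. w \<in> B \<Longrightarrow> w' \<in> B \<Longrightarrow> (\<lambda>i. w i + a * w' i) \<in> B"
    and w0: "w0 \<in> W" "w0 \<notin> B"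
  shows "\<exists>w\<in>W. w \<notin> B \<and> (\<forall>i. w i \<in> range to_ac)"
  using w0
proof (induction "card {i. w0 i \<noteq> 0}" arbitrary: w0 rule: less_induct)
  case less
  define supp where "supp w = {i. w i \<noteq> 0}" for w :: "'i \<Rightarrow> 'f alg_closure"
  define P where "P w k \<longleftrightarrow> w \<in> W \<and> w \<noteq> (\<lambda>_. 0) \<and> supp w \<subseteq> supp w0 \<and> card (supp w) = k" for w k
  have nz: "w0 \<noteq> (\<lambda>_. 0)" using less.prems B0 by metis
  have "\<exists>k w. P w k" using less.prems nz by (auto simp: P_def)
  from LeastI_ex[OF this] obtain w where w: "P w (LEAST k. \<exists>w. P w k)" by blast
  have min: "card (supp w) \<le> card (supp v)" if "v \<in> W" "v \<noteq> (\<lambda>_. 0)" "supp v \<subseteq> supp w0" for v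
  proof -
    have "P v (card (supp v))" using that by (simp add: P_def)
    then have "(LEAST k. \<exists>w. P w k) \<le> card (supp v)" by (metis (mono_tags) Least_le)
    then show ?thesis using w by (simp add: P_def)
  qed
  obtain c where c: "w c \<noteq> 0" using w by (auto simp: P_def)
  define w1 where "w1 = (\<lambda>i. inverse (w c) * w i + 0 * w i)"
  have w1W: "w1 \<in> W" unfolding w1_def by (rule Wlin) (use w in \<open>auto simp: P_def\<close>)
  have w1c: "w1 c = 1" using c by (simp add: w1_def)
  have sw1: "supp w1 = supp w" using c by (auto simp: w1_def supp_def)
  have sub: "supp w \<subseteq> supp w0" using w by (simp add: P_def)
  have rat: "w1 i \<in> range to_ac" for i
  proof (rule gal_fixed_field)
    fix s :: "'f alg_closure \<Rightarrow> 'f alg_closure" assume s: "s \<in> gal"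
    define v where "v = (\<lambda>i. 1 * (s \<circ> w1) i + (-1) * w1 i)"
    have vW: "v \<in> W" unfolding v_def by (intro Wlin Wgal s w1W)
    have "v c = 0" by (simp add: v_def w1c gal_simps[OF s])
    moreover have "supp v \<subseteq> supp w1" by (auto simp: supp_def v_def gal_simps[OF s])
    ultimately have lt: "supp v \<subset> supp w" using c sw1 by (auto simp: supp_def)
    have "finite (supp w)" unfolding supp_def by (rule fin) (use w in \<open>auto simp: P_def\<close>)
    from psubset_card_mono[OF this lt] have "v = (\<lambda>_. 0)"
      using min[OF vW] lt sub by fastforce
    then have "v i = 0" by simp
    then show "s (w1 i) = w1 i" by (simp add: v_def)
  qed
  show ?case
  proof (cases "w1 \<in> B")
    case False
    then show ?thesis using w1W rat by blast
  next
    case True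
    \<comment> \<open>The rational vector lies in \<open>B\<close>; subtracting a multiple of it shrinks the support of \<open>w0\<close>.\<close>
    define w2 where "w2 = (\<lambda>i. 1 * w0 i + (- w0 c) * w1 i)"
    have w2W: "w2 \<in> W" unfolding w2_def by (intro Wlin less.prems w1W)
    have "w2 \<notin> B"
    proof
      assume "w2 \<in> B"
      from Blin[OF this True, of "w0 c"] have "w0 \<in> B" by (simp add: w2_def)
      then show False using less.prems by simp
    qed
    have "w2 c = 0" by (simp add: w2_def w1c)
    moreover have "supp w2 \<subseteq> supp w0" using sub sw1 unfolding supp_def w2_def by force
    moreover have "w0 c \<noteq> 0" using c sub by (auto simp: supp_def)
    ultimately have "supp w2 \<subset> supp w0" by (auto simp: supp_def)
    then have "card (supp w2) < card (supp w0)"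
      by (intro psubset_card_mono) (use fin less.prems in \<open>auto simp: supp_def\<close>)
    from less.hyps[OF this[unfolded supp_def] w2W \<open>w2 \<notin> B\<close>] show ?thesis .
  qed
qed

section \<open>Forms as functions\<close>

definition expons :: "nat \<Rightarrow> nat \<Rightarrow> (nat \<Rightarrow>\<^sub>0 nat) set" where
  "expons n d = {m. Poly_Mapping.keys m \<subseteq> {..n} \<and> (\<Sum>i\<le>n. Poly_Mapping.lookup m i) = d}"

definition mono_eval :: "nat \<Rightarrow> (nat \<Rightarrow>\<^sub>0 nat) \<Rightarrow> (nat \<Rightarrow> 'k::field) \<Rightarrow> 'k" where
  "mono_eval n m x = (\<Prod>i\<le>n. x i ^ Poly_Mapping.lookup m i)"

text \<open>The polynomial functions of the forms of degree \<open>d\<close> over \<open>K\<close>. Sums, products and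
  substitutions of forms are easier to handle as functions than as formal polynomials.\<close>

definition formfun :: "'k::field set \<Rightarrow> nat \<Rightarrow> nat \<Rightarrow> ((nat \<Rightarrow> 'k) \<Rightarrow> 'k) set" where
  "formfun K n d = {\<lambda>x. \<Sum>m\<in>expons n d. c m * mono_eval n m x | c. \<forall>m. c m \<in> K}"

lemma finite_expons: "finite (expons n d)"
proof -
  have "Poly_Mapping.lookup ` expons n d \<subseteq> {f. \<forall>i. (i \<in> {..n} \<longrightarrow> f i \<in> {..d}) \<and> (i \<notin> {..n} \<longrightarrow> f i = 0)}"
  proof clarsimp
    fix m i assume m: "m \<in> expons n d"
    have "Poly_Mapping.lookup m i \<le> d" if "i \<le> n"
    proof -
      have "Poly_Mapping.lookup m i \<le> (\<Sum>i\<le>n. Poly_Mapping.lookup m i)"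
        by (rule member_le_sum) (use that in auto)
      then show ?thesis using m by (simp add: expons_def)
    qed
    moreover have "Poly_Mapping.lookup m i = 0" if "\<not> i \<le> n"
      using m that by (auto simp: expons_def in_keys_iff)
    ultimately show "(i \<le> n \<longrightarrow> Poly_Mapping.lookup m i \<le> d) \<and> (\<not> i \<le> n \<longrightarrow> Poly_Mapping.lookup m i = 0)"
      by blast
  qed
  then have "finite (Poly_Mapping.lookup ` expons n d)"
    by (rule finite_subset) (rule finite_set_of_finite_funs; simp)
  then show ?thesis by (rule finite_imageD) (simp add: inj_on_def poly_mapping_eqI)
qed

lemma keys_sum_atMost:
  assumes "Poly_Mapping.keys m \<subseteq> {..n}"
  shows "(\<Sum>i\<in>Poly_Mapping.keys m. Poly_Mapping.lookup m i) = (\<Sum>i\<le>n. Poly_Mapping.lookup m i)"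
    and "(\<Prod>i\<in>Poly_Mapping.keys m. (x i :: 'k::field) ^ Poly_Mapping.lookup m i) = mono_eval n m x"
  unfolding mono_eval_def
  using assms by (auto intro!: sum.mono_neutral_left prod.mono_neutral_left simp: in_keys_iff)

lemma forms_keys: "p \<in> forms K n d \<Longrightarrow> Poly_Mapping.keys p \<subseteq> expons n d"
  using keys_sum_atMost(1) by (auto simp: forms_def expons_def)

lemma mpol_eval_forms:
  assumes "p \<in> forms K n d"
  shows "mpol_eval p x = (\<Sum>m\<in>expons n d. Poly_Mapping.lookup p m * mono_eval n m x)"
proof -
  have "mpol_eval p x = (\<Sum>m\<in>Poly_Mapping.keys p. Poly_Mapping.lookup p m * mono_eval n m x)"
    unfolding mpol_eval_def
    using assms by (intro sum.cong arg_cong2[where f = "(*)"] keys_sum_atMost(2) refl) (auto simp: forms_def)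
  also have "\<dots> = (\<Sum>m\<in>expons n d. Poly_Mapping.lookup p m * mono_eval n m x)"
    by (rule sum.mono_neutral_left[OF finite_expons forms_keys[OF assms]]) (auto simp: in_keys_iff)
  finally show ?thesis .
qed

lemma formfun_eq:
  assumes "0 \<in> K"
  shows "formfun K n d = mpol_eval ` forms K n d"
proof (intro equalityI subsetI)
  fix f :: "(nat \<Rightarrow> 'a) \<Rightarrow> 'a" assume "f \<in> mpol_eval ` forms K n d"
  then obtain p where p: "p \<in> forms K n d" "f = mpol_eval p" by blast
  have "Poly_Mapping.lookup p m \<in> K" for m
    using p assms by (cases "m \<in> Poly_Mapping.keys p") (auto simp: forms_def in_keys_iff)
  moreover have "f = (\<lambda>x. \<Sum>m\<in>expons n d. Poly_Mapping.lookup p m * mono_eval n m x)"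
    using p mpol_eval_forms by blast
  ultimately show "f \<in> formfun K n d" unfolding formfun_def by blast
next
  fix f :: "(nat \<Rightarrow> 'a) \<Rightarrow> 'a" assume "f \<in> formfun K n d"
  then obtain c where c: "f = (\<lambda>x. \<Sum>m\<in>expons n d. c m * mono_eval n m x)" "\<forall>m. c m \<in> K"
    unfolding formfun_def by blast
  define p where "p = Abs_poly_mapping (\<lambda>m. if m \<in> expons n d then c m else 0)"
  have lp: "Poly_Mapping.lookup p m = (if m \<in> expons n d then c m else 0)" for m
    unfolding p_def by (subst lookup_Abs_poly_mapping) (auto intro: finite_subset[OF _ finite_expons[of n d]])
  have pf: "p \<in> forms K n d"
    unfolding forms_def
  proof (intro CollectI ballI)
    fix m assume "m \<in> Poly_Mapping.keys p"
    then have m: "m \<in> expons n d" by (auto simp: in_keys_iff lp split: if_splits)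
    then have k: "Poly_Mapping.keys m \<subseteq> {..n}" by (simp add: expons_def)
    show "Poly_Mapping.lookup p m \<in> K \<and> Poly_Mapping.keys m \<subseteq> {..n} \<and>
        (\<Sum>i\<in>Poly_Mapping.keys m. Poly_Mapping.lookup m i) = d"
      using m k c(2) keys_sum_atMost(1)[OF k] by (simp add: lp expons_def)
  qed
  have "mpol_eval p x = f x" for x
    by (simp add: mpol_eval_forms[OF pf] c lp)
  then show "f \<in> mpol_eval ` forms K n d" using pf by (metis ext image_eqI)
qed

lemma formfun_mono: "K \<subseteq> L \<Longrightarrow> formfun K n d \<subseteq> formfun L n d"
  by (auto simp: formfun_def)

abbreviation FF :: "nat \<Rightarrow> nat \<Rightarrow> ((nat \<Rightarrow> 'k::field) \<Rightarrow> 'k) set" where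
  "FF \<equiv> formfun UNIV"

lemma FF_lin:
  assumes "f \<in> FF n d" "g \<in> FF n d"
  shows "(\<lambda>x. a * f x + b * g x) \<in> FF n d"
proof -
  obtain c e where "f = (\<lambda>x. \<Sum>m\<in>expons n d. c m * mono_eval n m x)"
     "g = (\<lambda>x. \<Sum>m\<in>expons n d. e m * mono_eval n m x)" using assms by (auto simp: formfun_def)
  then have "(\<lambda>x. a * f x + b * g x) = (\<lambda>x. \<Sum>m\<in>expons n d. (a * c m + b * e m) * mono_eval n m x)"
    by (simp add: sum_distrib_left sum.distrib algebra_simps)
  then show ?thesis by (auto simp: formfun_def)
qed

lemma FF_zero: "(\<lambda>x. 0) \<in> FF n d"
  unfolding formfun_def by (intro CollectI exI[of _ "\<lambda>_. 0"]) auto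

lemma FF_add: "f \<in> FF n d \<Longrightarrow> g \<in> FF n d \<Longrightarrow> (\<lambda>x. f x + g x) \<in> FF n d"
  using FF_lin[of f n d g 1 1] by simp

lemma FF_diff: "f \<in> FF n d \<Longrightarrow> g \<in> FF n d \<Longrightarrow> (\<lambda>x. f x - g x) \<in> FF n d"
  using FF_lin[of f n d g 1 "-1"] by simp

lemma FF_scale: "f \<in> FF n d \<Longrightarrow> (\<lambda>x. a * f x) \<in> FF n d"
  using FF_lin[of f n d f a 0] by simp

lemma FF_sum: "(\<And>i. i \<in> A \<Longrightarrow> f i \<in> FF n d) \<Longrightarrow> (\<lambda>x. \<Sum>i\<in>A. f i x) \<in> FF n d"
  by (induction A rule: infinite_finite_induct) (auto intro: FF_add FF_zero)

lemma FF_mono: 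
  assumes "m \<in> expons n d" shows "mono_eval n m \<in> FF n d"
proof -
  have "mono_eval n m x = (\<Sum>m'\<in>expons n d. (if m' = m then 1 else 0) * mono_eval n m' x)" for x
  proof -
    have "(\<Sum>m'\<in>expons n d. (if m' = m then 1 else 0) * mono_eval n m' x) =
      (\<Sum>m'\<in>expons n d. if m' = m then mono_eval n m' x else 0)"
      by (rule sum.cong) auto
    then show ?thesis using finite_expons assms by simp
  qed
  then show ?thesis unfolding formfun_def by (intro CollectI exI[of _ "\<lambda>m'. if m' = m then 1 else 0"]) auto
qed

lemma expons_add: "m \<in> expons n d \<Longrightarrow> m' \<in> expons n e \<Longrightarrow> m + m' \<in> expons n (d + e)"
  using keys_add[of m m'] by (auto simp: expons_def lookup_add sum.distrib)

lemma FF_mult: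
  assumes "f \<in> FF n d" "g \<in> FF n e"
  shows "(\<lambda>x. f x * g x) \<in> FF n (d + e)"
proof -
  obtain c b where fg: "f = (\<lambda>x. \<Sum>m\<in>expons n d. c m * mono_eval n m x)"
     "g = (\<lambda>x. \<Sum>m\<in>expons n e. b m * mono_eval n m x)" using assms by (auto simp: formfun_def)
  have "(\<lambda>x. f x * g x) =
     (\<lambda>x. \<Sum>m\<in>expons n d. \<Sum>m'\<in>expons n e. (c m * b m') * mono_eval n (m + m') x)"
    unfolding fg sum_product
    by (intro ext sum.cong refl) (simp add: mono_eval_def lookup_add power_add prod.distrib mult_ac)
  also have "\<dots> \<in> FF n (d + e)"
    by (intro FF_sum FF_scale FF_mono expons_add)
  finally show ?thesis .
qed

lemma FF_const: "(\<lambda>x. c) \<in> FF n 0"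
proof -
  have "(0 :: nat \<Rightarrow>\<^sub>0 nat) \<in> expons n 0" by (simp add: expons_def)
  from FF_scale[OF FF_mono[OF this], of c] show ?thesis by (simp add: mono_eval_def)
qed

lemma FF_var: assumes "i \<le> n" shows "(\<lambda>x. x i) \<in> FF n 1"
proof -
  have "Poly_Mapping.single i (1::nat) \<in> expons n 1"
    using assms by (simp add: expons_def lookup_single when_def)
  from FF_mono[OF this] show ?thesis
    using assms by (simp add: mono_eval_def[abs_def] lookup_single when_def if_distrib prod.delta cong: if_cong)
qed

lemma FF_power: "f \<in> FF n d \<Longrightarrow> (\<lambda>x. f x ^ k) \<in> FF n (k * d)"
  by (induction k) (auto intro: FF_const FF_mult)

lemma FF_prod: "finite A \<Longrightarrow> (\<And>i. i \<in> A \<Longrightarrow> f i \<in> FF n (d i)) \<Longrightarrow> (\<lambda>x. \<Prod>i\<in>A. f i x) \<in> FF n (sum d A)"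
  by (induction A rule: finite_induct) (auto intro: FF_const FF_mult)

text \<open>Coordinate vectors of points vanish beyond the dimension of the space.\<close>

definition trunc :: "nat \<Rightarrow> (nat \<Rightarrow> 'k) \<Rightarrow> nat \<Rightarrow> 'k::zero" where
  "trunc m x = (\<lambda>i. if i \<le> m then x i else 0)"

lemma mono_eval_cong: "(\<And>i. i \<le> n \<Longrightarrow> x i = y i) \<Longrightarrow> mono_eval n m x = mono_eval n m y"
  unfolding mono_eval_def by (rule prod.cong) auto

lemma FF_compose:
  assumes "g \<in> FF m e" "\<And>i. i \<le> m \<Longrightarrow> f i \<in> FF n d"
  shows "(\<lambda>x. g (trunc m (\<lambda>i. f i x))) \<in> FF n (e * d)"
proof -
  obtain c where c: "g = (\<lambda>x. \<Sum>a\<in>expons m e. c a * mono_eval m a x)" using assms by (auto simp: formfun_def)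
  have "(\<lambda>x. mono_eval m a (trunc m (\<lambda>i. f i x))) \<in> FF n (e * d)" if "a \<in> expons m e" for a
  proof -
    have "(\<lambda>x. mono_eval m a (trunc m (\<lambda>i. f i x))) = (\<lambda>x. \<Prod>i\<le>m. f i x ^ Poly_Mapping.lookup a i)"
      by (simp add: mono_eval_def trunc_def)
    also have "\<dots> \<in> FF n (\<Sum>i\<le>m. Poly_Mapping.lookup a i * d)"
      by (intro FF_prod FF_power assms) auto
    also have "(\<Sum>i\<le>m. Poly_Mapping.lookup a i * d) = e * d"
      using that by (simp add: expons_def sum_distrib_right[symmetric])
    finally show ?thesis .
  qed
  then show ?thesis unfolding c by (intro FF_sum FF_scale)
qed

lemma formfun_homog:
  assumes "f \<in> formfun K n d"
  shows "f (\<lambda>i. c * x i) = c ^ d * f x"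
proof -
  obtain b where b: "f = (\<lambda>x. \<Sum>m\<in>expons n d. b m * mono_eval n m x)" using assms by (auto simp: formfun_def)
  have "mono_eval n m (\<lambda>i. c * x i) = c ^ d * mono_eval n m x" if "m \<in> expons n d" for m
    using that by (simp add: mono_eval_def expons_def power_mult_distrib prod.distrib power_sum[symmetric])
  then show ?thesis unfolding b by (auto simp: sum_distrib_left algebra_simps intro!: sum.cong)
qed

lemma formfun_cong:
  assumes "f \<in> formfun K n d" "\<And>i. i \<le> n \<Longrightarrow> x i = y i"
  shows "f x = f y"
  using assms mono_eval_cong[of n x y] by (auto simp: formfun_def)

lemma formfun_gal:
  assumes f: "f \<in> formfun K n d" and s: "s \<in> gal" and t: "\<And>x. t (s x) = x" "\<And>x. s (t x) = x"
  shows "(\<lambda>x. s (f (t \<circ> x))) \<in> FF n d"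
proof -
  obtain b where b: "f = (\<lambda>x. \<Sum>m\<in>expons n d. b m * mono_eval n m x)" using f by (auto simp: formfun_def)
  have "s (f (t \<circ> x)) = (\<Sum>m\<in>expons n d. s (b m) * mono_eval n m x)" for x
    by (simp add: b gal_simps[OF s] galD[OF s] mono_eval_def t)
  then show ?thesis by (auto simp: formfun_def)
qed

lemma formfun_rational_gal:
  assumes "f \<in> formfun (range to_ac) n d" "s \<in> gal"
  shows "f (s \<circ> x) = s (f x)"
proof -
  obtain b where b: "f = (\<lambda>x. \<Sum>m\<in>expons n d. b m * mono_eval n m x)" "\<forall>m. b m \<in> range to_ac"
    using assms by (auto simp: formfun_def)
  have "s (b m) = b m" for m using b(2) galD(4)[OF assms(2)] by (metis rangeE)
  then show ?thesis
    by (simp add: b gal_simps[OF assms(2)] galD[OF assms(2)] mono_eval_def)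
qed

text \<open>Restrictions of forms to lines are functions of this kind. That such a function with
  infinitely many zeros vanishes is what makes rational values plentiful.\<close>

definition polyfun :: "('k::field \<Rightarrow> 'k) \<Rightarrow> bool" where
  "polyfun h \<longleftrightarrow> (\<exists>q. h = poly q)"

lemma polyfun_intros:
  "polyfun (\<lambda>c. a)" "polyfun (\<lambda>c. c)"
  "polyfun f \<Longrightarrow> polyfun g \<Longrightarrow> polyfun (\<lambda>c. f c + g c)"
  "polyfun f \<Longrightarrow> polyfun g \<Longrightarrow> polyfun (\<lambda>c. f c - g c)"
  "polyfun f \<Longrightarrow> polyfun g \<Longrightarrow> polyfun (\<lambda>c. f c * g c)"
  "polyfun f \<Longrightarrow> polyfun (\<lambda>c. f c ^ n)"
  unfolding polyfun_def
  subgoal by (rule exI[of _ "[:a:]"]) auto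
  subgoal by (rule exI[of _ "[:0, 1:]"]) auto
  subgoal by (metis (no_types, lifting) ext poly_add)
  subgoal by (metis (no_types, lifting) ext poly_diff)
  subgoal by (metis (no_types, lifting) ext poly_mult)
  subgoal by (metis (no_types, lifting) ext poly_power)
  done

lemma polyfun_sum: "(\<And>i. i \<in> A \<Longrightarrow> polyfun (f i)) \<Longrightarrow> polyfun (\<lambda>c. \<Sum>i\<in>A. f i c)"
  by (induction A rule: infinite_finite_induct) (auto intro: polyfun_intros)

lemma polyfun_prod: "(\<And>i. i \<in> A \<Longrightarrow> polyfun (f i)) \<Longrightarrow> polyfun (\<lambda>c. \<Prod>i\<in>A. f i c)"
  by (induction A rule: infinite_finite_induct) (auto intro: polyfun_intros)

lemma formfun_polyfun:
  assumes "f \<in> formfun K n d" "\<And>i. polyfun (\<lambda>c. x c i)"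
  shows "polyfun (\<lambda>c. f (x c))"
  using assms unfolding formfun_def mono_eval_def
  by (auto intro!: polyfun_sum polyfun_prod polyfun_intros)

lemma polyfun_zero:
  assumes "polyfun h" "infinite {c. h c = 0}"
  shows "h c = 0"
proof -
  obtain q where "h = poly q" using assms by (auto simp: polyfun_def)
  then show ?thesis using assms(2) poly_roots_finite[of q] by (cases "q = 0") auto
qed

lemma polyfun_finite_roots: "polyfun h \<Longrightarrow> h c \<noteq> 0 \<Longrightarrow> finite {c. h c = 0}"
  using polyfun_zero by blast

section \<open>Points, morphisms and the Galois action\<close>

lemma mem_pt: "x \<in> pt x"
  unfolding pt_def by (rule CollectI, rule exI[of _ 1]) auto

lemma mem_ptE: "y \<in> pt x \<Longrightarrow> \<exists>c. c \<noteq> 0 \<and> y = (\<lambda>i. c * x i)"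
  by (auto simp: pt_def)

lemma pt_scale: 
  assumes "c \<noteq> 0" shows "pt (\<lambda>i. c * x i) = pt x"
proof -
  have "(\<exists>d. y = (\<lambda>i. d * (c * x i)) \<and> d \<noteq> 0) \<longleftrightarrow> (\<exists>d. y = (\<lambda>i. d * x i) \<and> d \<noteq> 0)" for y
  proof
    assume "\<exists>d. y = (\<lambda>i. d * (c * x i)) \<and> d \<noteq> 0"
    then obtain d where "y = (\<lambda>i. d * (c * x i))" "d \<noteq> 0" by blast
    then show "\<exists>d. y = (\<lambda>i. d * x i) \<and> d \<noteq> 0" using assms
      by (intro exI[of _ "d * c"]) (auto simp: algebra_simps)
  next
    assume "\<exists>d. y = (\<lambda>i. d * x i) \<and> d \<noteq> 0"
    then obtain d where "y = (\<lambda>i. d * x i)" "d \<noteq> 0" by blast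
    then show "\<exists>d. y = (\<lambda>i. d * (c * x i)) \<and> d \<noteq> 0" using assms
      by (intro exI[of _ "d / c"]) auto
  qed
  then show ?thesis unfolding pt_def by auto
qed

lemma pt_eq_iff: "pt x = pt y \<longleftrightarrow> (\<exists>c. c \<noteq> 0 \<and> y = (\<lambda>i. c * x i))"
  using mem_pt[of y] mem_ptE[of y x] pt_scale[of _ x] by auto

lemma proj_spaceD:
  assumes "P \<in> proj_space n" "x \<in> P"
  shows "x \<in> coord_vecs n" "P = pt x"
proof -
  obtain y where y: "y \<in> coord_vecs n" "P = pt y" using assms by (auto simp: proj_space_def)
  then obtain c where c: "c \<noteq> 0" "x = (\<lambda>i. c * y i)" using assms(2) mem_ptE by blast
  show "x \<in> coord_vecs n" using y c by (auto simp: coord_vecs_def)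
  show "P = pt x" using y c pt_scale by metis
qed

lemma pt_in_proj_space: "pt x \<in> proj_space n \<longleftrightarrow> x \<in> coord_vecs n"
  using proj_spaceD(1)[OF _ mem_pt] by (auto simp: proj_space_def)

lemma proj_space_ne: "P \<in> proj_space n \<Longrightarrow> \<exists>x. P = pt x \<and> x \<in> coord_vecs n"
  by (auto simp: proj_space_def)

lemma vanishes_pt:
  assumes "p \<in> forms K n d" "0 \<in> K"
  shows "vanishes p (pt x) \<longleftrightarrow> mpol_eval p x = 0"
proof -
  have "mpol_eval p \<in> formfun K n d" using assms formfun_eq by blast
  from formfun_homog[OF this] show ?thesis
    unfolding vanishes_def using mem_pt mem_ptE by fastforce
qed

text \<open>Proportionality of coordinate vectors in cross-multiplied form. This form is linear in
  \<open>v\<close>, which is what descent needs.\<close>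

lemma pt_eqI:
  assumes "z \<in> coord_vecs m" "i0 \<le> m" "v i0 \<noteq> 0" "\<And>i j. i \<le> m \<Longrightarrow> j \<le> m \<Longrightarrow> v i * z j = v j * z i"
  shows "pt z = pt (trunc m v)"
proof -
  have "z i0 \<noteq> 0"
  proof
    assume "z i0 = 0"
    then have "z j = 0" if "j \<le> m" for j using assms(4)[OF assms(2) that] assms(3) by simp
    then show False using assms(1) by (auto simp: coord_vecs_def)
  qed
  have "trunc m v = (\<lambda>j. (v i0 / z i0) * z j)"
  proof
    fix j
    show "trunc m v j = (v i0 / z i0) * z j"
      using assms(1,2,3) assms(4)[of i0 j] \<open>z i0 \<noteq> 0\<close>
      by (auto simp: trunc_def coord_vecs_def field_simps)
  qed
  then show ?thesis using assms(3) \<open>z i0 \<noteq> 0\<close> unfolding pt_eq_iff by (metis divide_eq_0_iff)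
qed

lemma pt_eq_cross:
  assumes "pt z = pt (trunc m v)" "i \<le> m" "j \<le> m"
  shows "v i * z j = v j * z i"
proof -
  obtain c where "trunc m v = (\<lambda>i. c * z i)" using assms(1) pt_eq_iff by blast
  then have "v i = c * z i" "v j = c * z j" using assms by (metis trunc_def)+
  then show ?thesis by simp
qed

lemma is_morphism_iff:
  assumes V: "V \<subseteq> proj_space n" and K: "0 \<in> K"
  shows "is_morphism K n V m Y \<phi> \<longleftrightarrow>
    (\<forall>x. pt x \<in> V \<longrightarrow> \<phi> (pt x) \<in> Y \<and>
       (\<exists>d f. (\<forall>i\<le>m. f i \<in> formfun K n d) \<and> (\<exists>i\<le>m. f i x \<noteq> 0) \<and>
          (\<forall>y. pt y \<in> V \<longrightarrow> (\<exists>i\<le>m. f i y \<noteq> 0) \<longrightarrow> \<phi> (pt y) = pt (trunc m (\<lambda>i. f i y)))))"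
    (is "_ \<longleftrightarrow> ?R")
proof
  assume M: "is_morphism K n V m Y \<phi>"
  show ?R
  proof (intro allI impI)
    fix x assume x: "pt x \<in> V"
    note Mx = bspec[OF M[unfolded is_morphism_def] x]
    obtain d f where df0: "(\<forall>i\<le>m. f i \<in> forms K n d) \<and> (\<exists>i\<le>m. \<not> vanishes (f i) (pt x)) \<and>
      (\<forall>Q\<in>V. (\<exists>i\<le>m. \<not> vanishes (f i) Q) \<longrightarrow>
         (\<forall>x\<in>Q. \<phi> Q = pt (\<lambda>i. if i \<le> m then mpol_eval (f i) x else 0)))"
      using conjunct2[OF Mx] by (elim exE) (rule that)
    note df = conjunct1[OF Mx] conjunct1[OF df0, rule_format] conjunct1[OF conjunct2[OF df0]]
       conjunct2[OF conjunct2[OF df0], rule_format]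
    define g where "g i = mpol_eval (f i)" for i
    have van: "vanishes (f i) (pt y) \<longleftrightarrow> g i y = 0" if "i \<le> m" for i y
      unfolding g_def by (rule vanishes_pt[OF df(2)[OF that] K])
    have 1: "\<forall>i\<le>m. g i \<in> formfun K n d" unfolding g_def using df(2) formfun_eq[OF K] by blast
    have 2: "\<exists>i\<le>m. g i x \<noteq> 0" using df(3) van by blast
    have 3: "\<forall>y. pt y \<in> V \<longrightarrow> (\<exists>i\<le>m. g i y \<noteq> 0) \<longrightarrow> \<phi> (pt y) = pt (trunc m (\<lambda>i. g i y))"
    proof (intro allI impI)
      fix y assume y: "pt y \<in> V" "\<exists>i\<le>m. g i y \<noteq> 0"
      then have "\<exists>i\<le>m. \<not> vanishes (f i) (pt y)" using van by blast
      from df(4)[OF y(1) this mem_pt] show "\<phi> (pt y) = pt (trunc m (\<lambda>i. g i y))"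
        by (simp add: trunc_def g_def)
    qed
    show "\<phi> (pt x) \<in> Y \<and> (\<exists>d f. (\<forall>i\<le>m. f i \<in> formfun K n d) \<and> (\<exists>i\<le>m. f i x \<noteq> 0) \<and>
          (\<forall>y. pt y \<in> V \<longrightarrow> (\<exists>i\<le>m. f i y \<noteq> 0) \<longrightarrow> \<phi> (pt y) = pt (trunc m (\<lambda>i. f i y))))"
      using df(1) 1 2 3 by blast
  qed
next
  assume R: ?R
  show "is_morphism K n V m Y \<phi>"
    unfolding is_morphism_def
  proof (rule ballI)
    fix P assume P: "P \<in> V"
    then obtain x where x: "P = pt x" using V proj_space_ne by blast
    note Rx = mp[OF spec[OF R, of x] P[unfolded x]]
    obtain d g where dg0: "(\<forall>i\<le>m. g i \<in> formfun K n d) \<and> (\<exists>i\<le>m. g i x \<noteq> 0) \<and>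
      (\<forall>y. pt y \<in> V \<longrightarrow> (\<exists>i\<le>m. g i y \<noteq> 0) \<longrightarrow> \<phi> (pt y) = pt (trunc m (\<lambda>i. g i y)))"
      using conjunct2[OF Rx] by (elim exE) (rule that)
    note dg = conjunct1[OF Rx] conjunct1[OF dg0, rule_format] conjunct1[OF conjunct2[OF dg0]]
       conjunct2[OF conjunct2[OF dg0], rule_format]
    have "\<forall>i. \<exists>p. i \<le> m \<longrightarrow> p \<in> forms K n d \<and> g i = mpol_eval p"
      using dg(2) formfun_eq[OF K] by blast
    then obtain f where f: "\<And>i. i \<le> m \<Longrightarrow> f i \<in> forms K n d" "\<And>i. i \<le> m \<Longrightarrow> g i = mpol_eval (f i)"
      by metis
    have van: "vanishes (f i) (pt y) \<longleftrightarrow> g i y = 0" if "i \<le> m" for i y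
      using vanishes_pt[OF f(1)[OF that] K] f(2)[OF that] by simp
    have "\<phi> Q = pt (\<lambda>i. if i \<le> m then mpol_eval (f i) y else 0)"
      if Q: "Q \<in> V" "\<exists>i\<le>m. \<not> vanishes (f i) Q" "y \<in> Q" for Q y
    proof -
      have Qy: "Q = pt y" using proj_spaceD Q V by blast
      have "(\<lambda>i. if i \<le> m then mpol_eval (f i) y else 0) = trunc m (\<lambda>i. g i y)"
        using f(2) by (auto simp: trunc_def)
      then show ?thesis using dg(4)[of y] Q van unfolding Qy by auto
    qed
    then show "\<phi> P \<in> Y \<and> (\<exists>d f. (\<forall>i\<le>m. f i \<in> forms K n d) \<and> (\<exists>i\<le>m. \<not> vanishes (f i) P) \<and>
          (\<forall>Q\<in>V. (\<exists>i\<le>m. \<not> vanishes (f i) Q) \<longrightarrow>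
             (\<forall>x\<in>Q. \<phi> Q = pt (\<lambda>i. if i \<le> m then mpol_eval (f i) x else 0))))"
      using dg(1) f(1) dg(3) van unfolding x by blast
  qed
qed

lemma morphism_maps: "is_morphism K n V m Y \<phi> \<Longrightarrow> P \<in> V \<Longrightarrow> \<phi> P \<in> Y"
  by (auto simp: is_morphism_def)

lemma morphism_local:
  assumes "is_morphism K n V m Y \<phi>" "V \<subseteq> proj_space n" "0 \<in> K" "pt x \<in> V"
  obtains d f where "\<And>i. i \<le> m \<Longrightarrow> f i \<in> formfun K n d" "\<exists>i\<le>m. f i x \<noteq> 0"
    "\<And>y. pt y \<in> V \<Longrightarrow> (\<exists>i\<le>m. f i y \<noteq> 0) \<Longrightarrow> \<phi> (pt y) = pt (trunc m (\<lambda>i. f i y))"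
proof -
  note R = mp[OF spec[OF assms(1)[unfolded is_morphism_iff[OF assms(2,3)]]] assms(4)]
  obtain d f where f: "(\<forall>i\<le>m. f i \<in> formfun K n d) \<and> (\<exists>i\<le>m. f i x \<noteq> 0) \<and>
    (\<forall>y. pt y \<in> V \<longrightarrow> (\<exists>i\<le>m. f i y \<noteq> 0) \<longrightarrow> \<phi> (pt y) = pt (trunc m (\<lambda>i. f i y)))"
    using conjunct2[OF R] by (elim exE) (rule that)
  from f show thesis
    by (intro that[of f d]) (rule conjunct1[OF f, rule_format] conjunct1[OF conjunct2[OF f]]
      conjunct2[OF conjunct2[OF f], rule_format]; assumption)+
qed

text \<open>The composed forms are multiplied by a coordinate \<open>f' i0\<close> that does not vanish at the
  given point. Otherwise forms of degree zero could take nonzero values where the first tuple of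
  forms vanishes and describes nothing.\<close>

lemma is_morphism_comp:
  fixes \<phi> :: "(nat \<Rightarrow> 'k::field) set \<Rightarrow> (nat \<Rightarrow> 'k) set"
  assumes V: "V \<subseteq> proj_space n" and Y: "Y \<subseteq> proj_space m"
    and f: "is_morphism UNIV n V m Y \<phi>" and g: "is_morphism UNIV m Y l Z \<psi>"
  shows "is_morphism UNIV n V l Z (\<lambda>P. \<psi> (\<phi> P))"
  unfolding is_morphism_iff[OF V UNIV_I]
proof (intro allI impI conjI)
  fix x assume x: "pt x \<in> V"
  show "\<psi> (\<phi> (pt x)) \<in> Z" using morphism_maps[OF f x] morphism_maps[OF g] by blast
  obtain d f' where 1: "\<And>i. i \<le> m \<Longrightarrow> f' i \<in> FF n d" "\<exists>i\<le>m. f' i x \<noteq> 0"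
    "\<And>y. pt y \<in> V \<Longrightarrow> (\<exists>i\<le>m. f' i y \<noteq> 0) \<Longrightarrow> \<phi> (pt y) = pt (trunc m (\<lambda>i. f' i y))"
    by (rule morphism_local[OF f V UNIV_I x], rule that)
  obtain i0 where i0: "i0 \<le> m" "f' i0 x \<noteq> 0" using 1 by blast
  let ?F = "\<lambda>y. trunc m (\<lambda>i. f' i y)"
  have Y1: "pt (?F y) \<in> Y" if "pt y \<in> V" "f' i0 y \<noteq> 0" for y
    using 1(3)[OF that(1)] morphism_maps[OF f that(1)] i0 that(2) by metis
  obtain e g' where 2: "\<And>i. i \<le> l \<Longrightarrow> g' i \<in> FF m e" "\<exists>i\<le>l. g' i (?F x) \<noteq> 0"
    "\<And>y. pt y \<in> Y \<Longrightarrow> (\<exists>i\<le>l. g' i y \<noteq> 0) \<Longrightarrow> \<psi> (pt y) = pt (trunc l (\<lambda>i. g' i y))"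
    by (rule morphism_local[OF g Y UNIV_I Y1[OF x i0(2)]], rule that)
  define h where "h i y = f' i0 y * g' i (?F y)" for i y
  have "h i \<in> FF n (d + e * d)" if "i \<le> l" for i
    unfolding h_def[abs_def] by (intro FF_mult FF_compose 1 2 i0 that)
  moreover have "\<exists>i\<le>l. h i x \<noteq> 0" using 2(2) i0 by (auto simp: h_def)
  moreover have "\<psi> (\<phi> (pt y)) = pt (trunc l (\<lambda>i. h i y))" if y: "pt y \<in> V" "\<exists>i\<le>l. h i y \<noteq> 0" for y
  proof -
    have n0: "f' i0 y \<noteq> 0" "\<exists>i\<le>l. g' i (?F y) \<noteq> 0" using y(2) by (auto simp: h_def)
    have "trunc l (\<lambda>i. h i y) = (\<lambda>i. f' i0 y * trunc l (\<lambda>i. g' i (?F y)) i)"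
      by (auto simp: trunc_def h_def)
    then have "pt (trunc l (\<lambda>i. h i y)) = pt (trunc l (\<lambda>i. g' i (?F y)))" using n0 pt_scale by metis
    also have "\<dots> = \<psi> (pt (?F y))" using 2(3)[OF Y1[OF y(1) n0(1)] n0(2)] by simp
    also have "pt (?F y) = \<phi> (pt y)" using 1(3)[OF y(1)] n0(1) i0(1) by metis
    finally show ?thesis by simp
  qed
  ultimately show "\<exists>d f. (\<forall>i\<le>l. f i \<in> FF n d) \<and> (\<exists>i\<le>l. f i x \<noteq> 0) \<and>
          (\<forall>y. pt y \<in> V \<longrightarrow> (\<exists>i\<le>l. f i y \<noteq> 0) \<longrightarrow> \<psi> (\<phi> (pt y)) = pt (trunc l (\<lambda>i. f i y)))"
    by blast
qed

definition gact :: "('k \<Rightarrow> 'k) \<Rightarrow> (nat \<Rightarrow> 'k) set \<Rightarrow> (nat \<Rightarrow> 'k) set" where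
  "gact s P = (\<lambda>x. s \<circ> x) ` P"

definition gal_stable :: "(nat \<Rightarrow> 'f::field_char_0 alg_closure) set set \<Rightarrow> bool" where
  "gal_stable V \<longleftrightarrow> (\<forall>s\<in>gal. \<forall>P\<in>V. gact s P \<in> V)"

lemma gact_pt:
  assumes "s \<in> gal" shows "gact s (pt x) = pt (s \<circ> x)"
proof -
  obtain t where t: "\<And>x. t (s x) = x" "\<And>x. s (t x) = x" using gal_inv_ex[OF assms] by metis
  show ?thesis
  proof (intro equalityI subsetI)
    fix y assume "y \<in> gact s (pt x)"
    then obtain c where "c \<noteq> 0" "y = s \<circ> (\<lambda>i. c * x i)" by (auto simp: gact_def pt_def)
    then have "s c \<noteq> 0" "y = (\<lambda>i. s c * (s \<circ> x) i)"
      using galD(3)[OF assms] gal_simps(9)[OF assms] by (auto simp: fun_eq_iff)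
    then show "y \<in> pt (s \<circ> x)" unfolding pt_def by blast
  next
    fix y assume "y \<in> pt (s \<circ> x)"
    then obtain c where c: "c \<noteq> 0" "y = (\<lambda>i. c * (s \<circ> x) i)" using mem_ptE by blast
    then have "y = s \<circ> (\<lambda>i. t c * x i)"
      by (auto simp: fun_eq_iff galD[OF assms] t)
    moreover have "t c \<noteq> 0" using c(1) t(2)[of c] gal_simps(1)[OF assms] by metis
    ultimately show "y \<in> gact s (pt x)" unfolding gact_def pt_def by blast
  qed
qed

lemma gact_inverse:
  assumes "\<And>x. t (s x) = x" shows "gact t (gact s P) = P"
proof -
  have "t \<circ> (s \<circ> x) = x" for x :: "nat \<Rightarrow> 'a" using assms by (auto simp: fun_eq_iff)
  then show ?thesis by (simp add: gact_def image_image)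
qed

lemma gact_coord_vecs: "s \<in> gal \<Longrightarrow> s \<circ> x \<in> coord_vecs n \<longleftrightarrow> x \<in> coord_vecs n"
  by (auto simp: coord_vecs_def gal_simps)

lemma gact_proj_space: "s \<in> gal \<Longrightarrow> P \<in> proj_space n \<Longrightarrow> gact s P \<in> proj_space n"
  using proj_space_ne gact_pt gact_coord_vecs pt_in_proj_space by metis

text \<open>Equations over the base field are invariant under the Galois group.\<close>

lemma zclosed_gal:
  assumes "zclosed (range to_ac) n Z" "s \<in> gal" "P \<in> proj_space n"
  shows "gact s P \<in> Z \<longleftrightarrow> P \<in> Z"
proof -
  obtain S where S: "S \<subseteq> (\<Union>d. forms (range to_ac) n d)" "Z = {P \<in> proj_space n. \<forall>p\<in>S. vanishes p P}"
    using assms(1) unfolding zclosed_def by blast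
  obtain x where x: "P = pt x" "x \<in> coord_vecs n" using proj_space_ne[OF assms(3)] by blast
  have 0: "(0 :: 'a alg_closure) \<in> range to_ac" using to_ac_0 by (metis rangeI)
  have "vanishes p (gact s P) \<longleftrightarrow> vanishes p P" if pS: "p \<in> S" for p
  proof -
    obtain d where p: "p \<in> forms (range to_ac) n d" using S pS by blast
    then have "mpol_eval p \<in> formfun (range to_ac) n d" using formfun_eq[OF 0] by blast
    from formfun_rational_gal[OF this assms(2)] show ?thesis
      unfolding x gact_pt[OF assms(2)] vanishes_pt[OF p 0] by (simp add: gal_simps[OF assms(2)])
  qed
  then show ?thesis using S(2) assms gact_proj_space[OF assms(2,3)] by auto
qed

lemma zclosed_subset: "zclosed K n Z \<Longrightarrow> Z \<subseteq> proj_space n"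
  by (auto simp: zclosed_def)

lemma variety_gal_stable:
  assumes "is_variety (range to_ac) n V"
  shows "gal_stable V" "V \<subseteq> proj_space n"
proof -
  obtain Z W where ZW: "zclosed (range to_ac) n Z" "zclosed (range to_ac) n W" "V = Z - W"
    using assms unfolding is_variety_def by blast
  show "V \<subseteq> proj_space n" using ZW zclosed_subset by blast
  then show "gal_stable V" unfolding gal_stable_def using ZW zclosed_gal by blast
qed

lemma range_to_ac_0: "(0 :: 'f::field alg_closure) \<in> range to_ac"
  using to_ac_0 by (metis rangeI)

section \<open>Descent of morphisms\<close>

text \<open>A pair \<open>(y, v)\<close> in \<open>L\<close> stands for the linear condition \<open>\<Sum> v i * f i y = 0\<close> on tuples of
  forms. The coefficients of the tuples that satisfy all of them form a Galois stable space. The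
  conditions are used to say that forms describe a given map (\<open>galois_descent_morphism\<close>), and that
  they vanish on a given set (\<open>parametrization_image_dense\<close>).\<close>

lemma galois_descent_forms:
  fixes L :: "((nat \<Rightarrow> 'f::field_char_0 alg_closure) \<times> (nat \<Rightarrow> 'f alg_closure)) set"
  assumes L: "\<And>s y v. s \<in> gal \<Longrightarrow> (y, v) \<in> L \<Longrightarrow> (s \<circ> y, s \<circ> v) \<in> L"
    and f: "\<And>i. i \<le> m \<Longrightarrow> f i \<in> FF n d" "\<And>y v. (y, v) \<in> L \<Longrightarrow> (\<Sum>i\<le>m. v i * f i y) = 0"
      "\<exists>i\<le>m. f i x \<noteq> 0"
  shows "\<exists>g. (\<forall>i. g i \<in> formfun (range to_ac) n d) \<and>
    (\<forall>y v. (y, v) \<in> L \<longrightarrow> (\<Sum>i\<le>m. v i * g i y) = 0) \<and> (\<exists>i\<le>m. g i x \<noteq> 0)"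
proof -
  define ev where "ev w i y = (\<Sum>e\<in>expons n d. w (i, e) * mono_eval n e y)"
    for w :: "nat \<times> (nat \<Rightarrow>\<^sub>0 nat) \<Rightarrow> 'f alg_closure" and i y
  define W where "W = {w. (\<forall>i e. \<not> (i \<le> m \<and> e \<in> expons n d) \<longrightarrow> w (i, e) = 0) \<and>
     (\<forall>y v. (y, v) \<in> L \<longrightarrow> (\<Sum>i\<le>m. v i * ev w i y) = 0)}"
  define B where "B = {w. \<forall>i\<le>m. ev w i x = 0}"
  have ev_lin: "ev (\<lambda>i. a * w i + b * w' i) i y = a * ev w i y + b * ev w' i y" for a b w w' i y
    by (simp add: ev_def sum_distrib_left sum.distrib algebra_simps)
  have "\<forall>i. \<exists>c. i \<le> m \<longrightarrow> f i = (\<lambda>x. \<Sum>e\<in>expons n d. c e * mono_eval n e x)"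
    using f(1) by (auto simp: formfun_def)
  then obtain c where c: "\<And>i. i \<le> m \<Longrightarrow> f i = (\<lambda>x. \<Sum>e\<in>expons n d. c i e * mono_eval n e x)" by metis
  define w0 where "w0 = (\<lambda>(i, e). if i \<le> m \<and> e \<in> expons n d then c i e else 0)"
  have evw0: "ev w0 i y = f i y" if "i \<le> m" for i y
    unfolding c[OF that] ev_def w0_def using that by auto
  have "\<exists>w\<in>W. w \<notin> B \<and> (\<forall>i. w i \<in> range to_ac)"
  proof (rule galois_descent_vector[where ?w0.0 = w0])
    fix w assume "w \<in> W"
    then have "{i. w i \<noteq> 0} \<subseteq> {..m} \<times> expons n d" unfolding W_def by fastforce
    then show "finite {i. w i \<noteq> 0}" by (rule finite_subset) (auto simp: finite_expons)
  next
    fix a b w w' assume w: "w \<in> W" "w' \<in> W"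
    have "(\<Sum>i\<le>m. v i * ev (\<lambda>i. a * w i + b * w' i) i y) =
        a * (\<Sum>i\<le>m. v i * ev w i y) + b * (\<Sum>i\<le>m. v i * ev w' i y)" for v y
      by (simp add: ev_lin sum_distrib_left sum.distrib algebra_simps)
    then show "(\<lambda>i. a * w i + b * w' i) \<in> W" using w unfolding W_def by simp
  next
    fix s :: "'f alg_closure \<Rightarrow> 'f alg_closure" and w assume s: "s \<in> gal" and w: "w \<in> W"
    obtain t where t: "t \<in> gal" "\<And>x. t (s x) = x" "\<And>x. s (t x) = x" using gal_inv_ex[OF s] by metis
    have ev_s: "ev (s \<circ> w) i y = s (ev w i (t \<circ> y))" for i y
      by (simp add: ev_def mono_eval_def gal_simps[OF s] galD[OF s] t)
    have "(\<Sum>i\<le>m. v i * ev (s \<circ> w) i y) = 0" if yv: "(y, v) \<in> L" for y v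
    proof -
      have "(\<Sum>i\<le>m. (t \<circ> v) i * ev w i (t \<circ> y)) = 0" using w L[OF t(1) yv] unfolding W_def by blast
      then have "s (\<Sum>i\<le>m. (t \<circ> v) i * ev w i (t \<circ> y)) = 0" by (simp add: gal_simps[OF s])
      then show ?thesis by (simp add: gal_simps(6)[OF s] galD[OF s] t ev_s)
    qed
    then show "s \<circ> w \<in> W" using w unfolding W_def by (simp add: gal_simps[OF s])
  next
    show "(\<lambda>_. 0) \<in> B" by (simp add: B_def ev_def)
  next
    fix a w w' assume "w \<in> B" "w' \<in> B"
    then show "(\<lambda>i. w i + a * w' i) \<in> B" unfolding B_def using ev_lin[of 1 w a w'] by simp
  next
    have "(\<Sum>i\<le>m. v i * ev w0 i y) = 0" if "(y, v) \<in> L" for y v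
      using f(2)[OF that] evw0 by simp
    then show "w0 \<in> W" unfolding W_def by (auto simp: w0_def)
    show "w0 \<notin> B" using f(3) evw0 by (auto simp: B_def)
  qed
  then obtain w where w: "w \<in> W" "w \<notin> B" "\<And>i. w i \<in> range to_ac" by blast
  have "ev w i \<in> formfun (range to_ac) n d" for i
    unfolding formfun_def ev_def[abs_def]
    by (rule CollectI, rule exI[of _ "\<lambda>e. w (i, e)"]) (use w(3) in auto)
  then show ?thesis using w(1,2) by (intro exI[of _ "ev w"]) (auto simp: W_def B_def)
qed

text \<open>That forms describe \<open>\<phi>\<close> wherever they do not all vanish is a system of linear conditions
  on the forms: the vector of their values is proportional to a coordinate vector of the image point.
  The system is Galois stable because \<open>\<phi>\<close> is equivariant.\<close>

theorem galois_descent_morphism: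
  fixes V :: "(nat \<Rightarrow> 'f::field_char_0 alg_closure) set set"
  assumes V: "V \<subseteq> proj_space n" "gal_stable V" and Y: "Y \<subseteq> proj_space m"
    and mor: "is_morphism UNIV n V m Y \<phi>"
    and eq: "\<And>s P. s \<in> gal \<Longrightarrow> P \<in> V \<Longrightarrow> \<phi> (gact s P) = gact s (\<phi> P)"
  shows "is_morphism (range to_ac) n V m Y \<phi>"
  unfolding is_morphism_iff[OF V(1) range_to_ac_0]
proof (intro allI impI conjI)
  fix x assume x: "pt x \<in> V"
  show "\<phi> (pt x) \<in> Y" using morphism_maps[OF mor x] .
  obtain d f where 1: "\<And>i. i \<le> m \<Longrightarrow> f i \<in> FF n d" "\<exists>i\<le>m. f i x \<noteq> 0"
    "\<And>y. pt y \<in> V \<Longrightarrow> (\<exists>i\<le>m. f i y \<noteq> 0) \<Longrightarrow> \<phi> (pt y) = pt (trunc m (\<lambda>i. f i y))"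
    by (rule morphism_local[OF mor V(1) UNIV_I x], rule that)
  \<comment> \<open>The condition \<open>g i * z j = g j * z i\<close> on a tuple \<open>g\<close>, written as a linear functional.\<close>
  define cross where "cross z i j = (\<lambda>l. (if l = i then z j else 0) - (if l = j then z i else 0))"
    for z :: "nat \<Rightarrow> 'f alg_closure" and i j :: nat
  define L where "L = {(y, cross z i j) | y z i j. pt y \<in> V \<and> pt z = \<phi> (pt y) \<and> i \<le> m \<and> j \<le> m}"
  have cross: "(\<Sum>l\<le>m. cross z i j l * g l) = g i * z j - g j * z i"
    if "i \<le> m" "j \<le> m" for z i j and g :: "nat \<Rightarrow> 'f alg_closure"
  proof -
    have "(\<Sum>l\<le>m. cross z i j l * g l) =
        (\<Sum>l\<le>m. (if l = i then g i * z j else 0) - (if l = j then g j * z i else 0))"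
      by (rule sum.cong) (auto simp: cross_def algebra_simps)
    then show ?thesis using that by (simp add: sum_subtractf)
  qed
  have "\<exists>g. (\<forall>i. g i \<in> formfun (range to_ac) n d) \<and>
    (\<forall>y v. (y, v) \<in> L \<longrightarrow> (\<Sum>i\<le>m. v i * g i y) = 0) \<and> (\<exists>i\<le>m. g i x \<noteq> 0)"
  proof (rule galois_descent_forms[OF _ 1(1) _ 1(2)])
    fix s :: "'f alg_closure \<Rightarrow> 'f alg_closure" and y v assume s: "s \<in> gal" and "(y, v) \<in> L"
    then obtain z i j where h: "v = cross z i j" "pt y \<in> V" "pt z = \<phi> (pt y)" "i \<le> m" "j \<le> m"
      unfolding L_def by blast
    have "s \<circ> v = cross (s \<circ> z) i j" by (auto simp: h(1) cross_def fun_eq_iff gal_simps[OF s])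
    moreover have "pt (s \<circ> y) \<in> V" using V(2) s h(2) gact_pt[OF s] unfolding gal_stable_def by metis
    moreover have "pt (s \<circ> z) = \<phi> (pt (s \<circ> y))" using eq[OF s h(2)] h(3) gact_pt[OF s] by metis
    ultimately show "(s \<circ> y, s \<circ> v) \<in> L" using h(4,5) unfolding L_def by blast
  next
    fix y v assume "(y, v) \<in> L"
    then obtain z i j where h: "v = cross z i j" "pt y \<in> V" "pt z = \<phi> (pt y)" "i \<le> m" "j \<le> m"
      unfolding L_def by blast
    have "f i y * z j = f j y * z i"
    proof (cases "\<exists>i\<le>m. f i y \<noteq> 0")
      case True
      then have "pt z = pt (trunc m (\<lambda>i. f i y))" using 1(3) h(2,3) by simp
      from pt_eq_cross[OF this h(4,5)] show ?thesis .
    qed (use h in simp)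
    then show "(\<Sum>l\<le>m. v l * f l y) = 0" by (simp add: h(1) cross[OF h(4,5)])
  qed
  then obtain g where g: "\<And>i. g i \<in> formfun (range to_ac) n d" "\<exists>i\<le>m. g i x \<noteq> 0"
    and gL: "\<And>y v. (y, v) \<in> L \<Longrightarrow> (\<Sum>i\<le>m. v i * g i y) = 0" by blast
  have "\<phi> (pt y) = pt (trunc m (\<lambda>i. g i y))" if y: "pt y \<in> V" "\<exists>i\<le>m. g i y \<noteq> 0" for y
  proof -
    have "\<phi> (pt y) \<in> proj_space m" using morphism_maps[OF mor y(1)] Y by blast
    then obtain z where z: "\<phi> (pt y) = pt z" "z \<in> coord_vecs m" using proj_space_ne by blast
    obtain i0 where i0: "i0 \<le> m" "g i0 y \<noteq> 0" using y by blast
    have "g i y * z j = g j y * z i" if ij: "i \<le> m" "j \<le> m" for i j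
    proof -
      have "(y, cross z i j) \<in> L" unfolding L_def using y(1) z(1) ij by force
      from gL[OF this] show ?thesis by (simp add: cross[OF ij])
    qed
    from pt_eqI[OF z(2) i0 this] show ?thesis using z(1) by simp
  qed
  then show "\<exists>d f. (\<forall>i\<le>m. f i \<in> formfun (range to_ac) n d) \<and> (\<exists>i\<le>m. f i x \<noteq> 0) \<and>
      (\<forall>y. pt y \<in> V \<longrightarrow> (\<exists>i\<le>m. f i y \<noteq> 0) \<longrightarrow> \<phi> (pt y) = pt (trunc m (\<lambda>i. f i y)))"
    using g by (intro exI[of _ d] exI[of _ g]) blast
qed

lemma is_morphism_conjugate:
  fixes V :: "(nat \<Rightarrow> 'f::field_char_0 alg_closure) set set"
  assumes V: "V \<subseteq> proj_space n" "gal_stable V" and Y: "gal_stable Y"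
    and mor: "is_morphism UNIV n V m Y \<phi>"
    and s: "s \<in> gal" and t: "t \<in> gal" "\<And>x. t (s x) = x" "\<And>x. s (t x) = x"
  shows "is_morphism UNIV n V m Y (\<lambda>P. gact s (\<phi> (gact t P)))"
  unfolding is_morphism_iff[OF V(1) UNIV_I]
proof (intro allI impI conjI)
  fix x assume x: "pt x \<in> V"
  have tV: "pt (t \<circ> y) \<in> V" if "pt y \<in> V" for y
    using V(2) t(1) that gact_pt[OF t(1)] unfolding gal_stable_def by metis
  show "gact s (\<phi> (gact t (pt x))) \<in> Y"
    using morphism_maps[OF mor tV[OF x]] Y s unfolding gact_pt[OF t(1)] gal_stable_def by blast
  obtain d f where 1: "\<And>i. i \<le> m \<Longrightarrow> f i \<in> FF n d" "\<exists>i\<le>m. f i (t \<circ> x) \<noteq> 0"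
    "\<And>y. pt y \<in> V \<Longrightarrow> (\<exists>i\<le>m. f i y \<noteq> 0) \<Longrightarrow> \<phi> (pt y) = pt (trunc m (\<lambda>i. f i y))"
    by (rule morphism_local[OF mor V(1) UNIV_I tV[OF x]], rule that)
  define g where "g i y = s (f i (t \<circ> y))" for i y
  have "g i \<in> FF n d" if "i \<le> m" for i
    unfolding g_def[abs_def] by (rule formfun_gal[OF 1(1)[OF that] s t(2,3)])
  moreover have "\<exists>i\<le>m. g i x \<noteq> 0" using 1(2) by (simp add: g_def gal_simps[OF s])
  moreover have "gact s (\<phi> (gact t (pt y))) = pt (trunc m (\<lambda>i. g i y))" if y: "pt y \<in> V" "\<exists>i\<le>m. g i y \<noteq> 0" for y
  proof -
    have "\<phi> (pt (t \<circ> y)) = pt (trunc m (\<lambda>i. f i (t \<circ> y)))"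
      using 1(3)[OF tV[OF y(1)]] y(2) by (simp add: g_def gal_simps[OF s])
    moreover have "s \<circ> trunc m (\<lambda>i. f i (t \<circ> y)) = trunc m (\<lambda>i. g i y)"
      by (auto simp: trunc_def g_def gal_simps[OF s])
    ultimately show ?thesis by (simp add: gact_pt t(1) s)
  qed
  ultimately show "\<exists>d f. (\<forall>i\<le>m. f i \<in> FF n d) \<and> (\<exists>i\<le>m. f i x \<noteq> 0) \<and>
      (\<forall>y. pt y \<in> V \<longrightarrow> (\<exists>i\<le>m. f i y \<noteq> 0) \<longrightarrow> gact s (\<phi> (gact t (pt y))) = pt (trunc m (\<lambda>i. f i y)))"
    by (intro exI[of _ d] exI[of _ g]) blast
qed

section \<open>Density of the rational points\<close>

lemma formfun_rational_value:
  assumes "f \<in> formfun (range to_ac) n d" "\<And>i. y i \<in> range to_ac"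
  shows "f (y :: nat \<Rightarrow> 'a::field_char_0 alg_closure) \<in> range to_ac"
proof (rule gal_fixed_field)
  fix s :: "'a alg_closure \<Rightarrow> 'a alg_closure" assume s: "s \<in> gal"
  have "s \<circ> y = y"
  proof
    fix i show "(s \<circ> y) i = y i" using assms(2)[of i] galD(4)[OF s] by auto
  qed
  then show "s (f y) = f y" using formfun_rational_gal[OF assms(1) s, of y] by simp
qed

lemma common_nonzero:
  fixes hs :: "((nat \<Rightarrow> 'k::field_char_0) \<Rightarrow> 'k) list"
  assumes "\<And>h. h \<in> set hs \<Longrightarrow> (\<exists>d. h \<in> FF n d) \<and> (\<exists>y. h y \<noteq> 0)"
  shows "\<exists>H d. H \<in> FF n d \<and> (\<exists>y. H y \<noteq> 0) \<and> (\<forall>y. H y \<noteq> 0 \<longrightarrow> (\<forall>h\<in>set hs. h y \<noteq> 0))"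
  using assms
proof (induction hs)
  case Nil
  then show ?case using FF_const[of 1 n] by (intro exI[of _ "\<lambda>_. 1"] exI[of _ 0]) auto
next
  case (Cons h hs)
  then obtain H d where H: "H \<in> FF n d" "\<exists>y. H y \<noteq> 0" "\<And>y. H y \<noteq> 0 \<Longrightarrow> \<forall>h\<in>set hs. h y \<noteq> 0"
    by (metis list.set_intros(2))
  obtain e where e: "h \<in> FF n e" "\<exists>y. h y \<noteq> 0" using Cons.prems by force
  obtain a b where ab: "h a \<noteq> 0" "H b \<noteq> 0" using H e by blast
  define L where "L c i = a i + c * (b i - a i)" for c i
  have pL: "polyfun (\<lambda>c. L c i)" for i unfolding L_def by (intro polyfun_intros)
  have ph: "polyfun (\<lambda>c. h (L c))" "polyfun (\<lambda>c. H (L c))"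
    using formfun_polyfun[OF e(1) pL] formfun_polyfun[OF H(1) pL] .
  have "L 0 = a" "L 1 = b" by (auto simp: L_def)
  then have "finite {c. h (L c) = 0}" "finite {c. H (L c) = 0}"
    using polyfun_finite_roots[OF ph(1), of 0] polyfun_finite_roots[OF ph(2), of 1] ab by auto
  then have "finite ({c. h (L c) = 0} \<union> {c. H (L c) = 0})" by simp
  then obtain c where c: "h (L c) \<noteq> 0" "H (L c) \<noteq> 0"
    using infinite_UNIV_char_0 by (metis (mono_tags, lifting) UNIV_eq_I UnCI mem_Collect_eq)
  have "(\<lambda>y. h y * H y) \<in> FF n (e + d)" by (rule FF_mult[OF e(1) H(1)])
  then show ?case using c H(3) by (intro exI[of _ "\<lambda>y. h y * H y"] exI[of _ "e + d"]) auto
qed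

text \<open>One coordinate after the other is replaced by a nonzero rational number, avoiding the
  finitely many roots of a polynomial in that coordinate.\<close>

lemma rational_nonzero:
  fixes H :: "(nat \<Rightarrow> 'f::field_char_0 alg_closure) \<Rightarrow> 'f alg_closure"
  assumes H: "H \<in> FF n d" "H y \<noteq> 0"
  shows "\<exists>y\<in>coord_vecs n. H y \<noteq> 0 \<and> (\<forall>i. y i \<in> range to_ac)"
proof -
  have "\<exists>y. H y \<noteq> 0 \<and> (\<forall>i<k. y i \<in> to_ac ` (- {0}))" for k
  proof (induction k)
    case 0
    then show ?case using H by auto
  next
    case (Suc k)
    then obtain y where y: "H y \<noteq> 0" "\<forall>i<k. y i \<in> to_ac ` (- {0})" by blast
    have "polyfun (\<lambda>c. (y(k := c)) i)" for i by (cases "i = k") (auto intro: polyfun_intros)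
    from formfun_polyfun[OF H(1) this] have "polyfun (\<lambda>c. H (y(k := c)))" .
    from polyfun_finite_roots[OF this, of "y k"] have fin: "finite {c. H (y(k := c)) = 0}" using y by simp
    have "infinite (to_ac ` (- {0 :: 'f}))"
      
      using infinite_UNIV_char_0[where 'a = 'f] finite_imageD[OF _ inj_on_subset[OF inj_to_ac subset_UNIV]]
      by (metis finite.emptyI finite_compl finite_insert)
    then have "\<not> to_ac ` (- {0 :: 'f}) \<subseteq> {c. H (y(k := c)) = 0}"
      using finite_subset[OF _ fin] by (rule contrapos_nn)
    then obtain c where c: "c \<in> to_ac ` (- {0 :: 'f})" "H (y(k := c)) \<noteq> 0" by auto
    define y' where "y' = y(k := c)"
    have "y' i \<in> to_ac ` (- {0})" if "i < Suc k" for i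
      using c(1) y(2) that by (cases "i = k") (auto simp: y'_def)
    then show ?case using c(2) unfolding y'_def[symmetric] by blast
  qed
  then obtain y where y: "H y \<noteq> 0" "\<And>i. i < Suc n \<Longrightarrow> y i \<in> to_ac ` (- {0})" by blast
  have "H (trunc n y) = H y" by (rule formfun_cong[OF H(1)]) (simp add: trunc_def)
  moreover have "trunc n y \<in> coord_vecs n"
    using y(2)[of 0] by (auto simp: coord_vecs_def trunc_def intro!: exI[of _ 0])
  moreover have "trunc n y i \<in> range to_ac" for i
    using y(2)[of i] range_to_ac_0 by (auto simp: trunc_def)
  ultimately show ?thesis using y(1) by metis
qed

lemma rational_morphism_equivariant:
  fixes U :: "(nat \<Rightarrow> 'f::field_char_0 alg_closure) set set"
  assumes U: "U \<subseteq> proj_space r" "gal_stable U" and \<phi>: "is_morphism (range to_ac) r U n V \<phi>"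
    and s: "s \<in> gal" and P: "P \<in> U"
  shows "\<phi> (gact s P) = gact s (\<phi> P)"
proof -
  obtain x where x: "P = pt x" using P U proj_space_ne by blast
  obtain d f where 1: "\<And>i. i \<le> n \<Longrightarrow> f i \<in> formfun (range to_ac) r d" "\<exists>i\<le>n. f i x \<noteq> 0"
    "\<And>y. pt y \<in> U \<Longrightarrow> (\<exists>i\<le>n. f i y \<noteq> 0) \<Longrightarrow> \<phi> (pt y) = pt (trunc n (\<lambda>i. f i y))"
    by (rule morphism_local[OF \<phi> U(1) range_to_ac_0 P[unfolded x]], rule that)
  have fs: "f i (s \<circ> x) = s (f i x)" if "i \<le> n" for i
    by (rule formfun_rational_gal[OF 1(1)[OF that] s])
  have sU: "pt (s \<circ> x) \<in> U" using U(2) s P gact_pt[OF s] unfolding gal_stable_def x by metis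
  have "\<exists>i\<le>n. f i (s \<circ> x) \<noteq> 0" using 1(2) fs by (auto simp: gal_simps[OF s])
  from 1(3)[OF sU this] have "\<phi> (pt (s \<circ> x)) = pt (trunc n (\<lambda>i. f i (s \<circ> x)))" .
  moreover have "trunc n (\<lambda>i. f i (s \<circ> x)) = s \<circ> trunc n (\<lambda>i. f i x)"
    using fs by (auto simp: trunc_def gal_simps[OF s])
  ultimately show ?thesis using 1(3)[of x] 1(2) P by (simp add: x gact_pt[OF s])
qed

text \<open>Density is known for closed sets over the base field only. If a form over the closure
  vanished on the image but not on \<open>V\<close>, descent would give such a form over the base field.\<close>

lemma parametrization_image_dense:
  fixes V :: "(nat \<Rightarrow> 'f::field_char_0 alg_closure) set set"
  assumes V: "V \<subseteq> proj_space n"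
    and U: "U \<subseteq> proj_space r" "gal_stable U" and \<phi>: "is_morphism (range to_ac) r U n V \<phi>"
    and dense: "\<And>Z. zclosed (range to_ac) n Z \<Longrightarrow> \<phi> ` U \<subseteq> Z \<Longrightarrow> V \<subseteq> Z"
    and h: "h \<in> FF n d" "pt x0 \<in> V" "h x0 \<noteq> 0"
  shows "\<exists>y z. pt y \<in> U \<and> \<phi> (pt y) = pt z \<and> h z \<noteq> 0"
proof (rule ccontr)
  assume none: "\<not> ?thesis"
  define L where "L = {(z, \<lambda>_::nat. 1 :: 'f alg_closure) | y z. pt y \<in> U \<and> \<phi> (pt y) = pt z}"
  have "\<exists>g. (\<forall>i. g i \<in> formfun (range to_ac) n d) \<and>
    (\<forall>y v. (y, v) \<in> L \<longrightarrow> (\<Sum>i\<le>0::nat. v i * g i y) = 0) \<and> (\<exists>i\<le>0. g i x0 \<noteq> 0)"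
  proof (rule galois_descent_forms[where f = "\<lambda>_. h"])
    fix s :: "'f alg_closure \<Rightarrow> 'f alg_closure" and z v assume s: "s \<in> gal" and "(z, v) \<in> L"
    then obtain y where y: "v = (\<lambda>_. 1)" "pt y \<in> U" "\<phi> (pt y) = pt z" unfolding L_def by blast
    have "pt (s \<circ> y) \<in> U" using U(2) s y gact_pt[OF s] unfolding gal_stable_def by metis
    moreover have "\<phi> (pt (s \<circ> y)) = pt (s \<circ> z)"
      using rational_morphism_equivariant[OF U \<phi> s y(2)] y(3) gact_pt[OF s] by metis
    moreover have "s \<circ> v = (\<lambda>_. 1)" by (auto simp: y(1) gal_simps[OF s])
    ultimately show "(s \<circ> z, s \<circ> v) \<in> L" unfolding L_def by auto
  next
    show "(\<Sum>i\<le>0::nat. v i * h z) = 0" if "(z, v) \<in> L" for z v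
      using that none unfolding L_def by auto
  qed (use h in auto)
  then obtain g where gg: "(\<forall>i. g i \<in> formfun (range to_ac) n d) \<and>
    (\<forall>y v. (y, v) \<in> L \<longrightarrow> (\<Sum>i\<le>0::nat. v i * g i y) = 0) \<and> (\<exists>i\<le>0. g i x0 \<noteq> 0)"
    by (elim exE)
  have g: "\<And>i. g i \<in> formfun (range to_ac) n d" "g 0 x0 \<noteq> 0"
    "\<And>y v. (y, v) \<in> L \<Longrightarrow> v 0 * g 0 y = 0" using gg by (blast, simp, simp)
  obtain p where p: "p \<in> forms (range to_ac) n d" "g 0 = mpol_eval p"
    using formfun_eq[OF range_to_ac_0] g(1)[of 0] by blast
  define Z where "Z = {P \<in> proj_space n. vanishes p P}"
  have "zclosed (range to_ac) n Z"
    unfolding zclosed_def Z_def by (rule exI[of _ "{p}"]) (use p in auto)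
  moreover have "\<phi> ` U \<subseteq> Z"
  proof clarify
    fix P assume P: "P \<in> U"
    then obtain y where y: "P = pt y" using U proj_space_ne by blast
    have "\<phi> P \<in> proj_space n" using morphism_maps[OF \<phi> P] V by blast
    then obtain z where z: "\<phi> P = pt z" using proj_space_ne by blast
    have "(z, \<lambda>_. 1) \<in> L" unfolding L_def using P z y by blast
    then have "mpol_eval p z = 0" using g(3) p(2) by fastforce
    then show "\<phi> P \<in> Z"
      using \<open>\<phi> P \<in> proj_space n\<close> vanishes_pt[OF p(1) range_to_ac_0] by (simp add: Z_def z)
  qed
  ultimately have "V \<subseteq> Z" by (rule dense)
  then have "mpol_eval p x0 = 0" using h(2) vanishes_pt[OF p(1) range_to_ac_0] by (auto simp: Z_def)
  then show False using g(2) p(2) by simp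
qed

text \<open>Pulled back to the plane, the given forms become nonzero forms in three variables, which
  have a common rational point outside their zeros. The forms that cut out the complement of the
  domain of the parametrization are treated in the same way.\<close>

theorem rational_points_dense:
  fixes V :: "(nat \<Rightarrow> 'f::field_char_0 alg_closure) set set"
  assumes V: "V \<subseteq> proj_space n" and par: "has_parametrization (range to_ac) n V"
    and hs: "\<And>h. h \<in> set hs \<Longrightarrow> (\<exists>d. h \<in> FF n d) \<and> (\<exists>x. pt x \<in> V \<and> h x \<noteq> 0)"
  shows "\<exists>x. pt x \<in> V \<and> (\<forall>i. x i \<in> range to_ac) \<and> (\<forall>h\<in>set hs. h x \<noteq> 0)"
proof -
  obtain W \<phi> where W: "zclosed (range to_ac) 2 W" and \<phi>: "is_morphism (range to_ac) 2 (proj_space 2 - W) n V \<phi>"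
    and ne: "proj_space 2 - W \<noteq> {}"
    and dense': "\<forall>Z. zclosed (range to_ac) n Z \<and> \<phi> ` (proj_space 2 - W) \<subseteq> Z \<longrightarrow> V \<subseteq> Z"
    using par unfolding has_parametrization_def by (elim exE conjE) (rule that)
  have dense: "V \<subseteq> Z" if "zclosed (range to_ac) n Z" "\<phi> ` (proj_space 2 - W) \<subseteq> Z" for Z
    using dense' that by simp
  define U where "U = proj_space 2 - W"
  have U: "U \<subseteq> proj_space 2" "gal_stable U"
    using W zclosed_gal gact_proj_space unfolding U_def gal_stable_def by blast+
  obtain S where S: "S \<subseteq> (\<Union>d. forms (range to_ac) 2 d)" "W = {P \<in> proj_space 2. \<forall>p\<in>S. vanishes p P}"
    using W unfolding zclosed_def by blast
  have claim: "\<exists>G. (\<exists>e. G \<in> FF 2 e) \<and> (\<exists>y. G y \<noteq> 0) \<and>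
      (\<forall>y\<in>coord_vecs 2. G y \<noteq> 0 \<longrightarrow> pt y \<in> U \<and> (\<forall>z. \<phi> (pt y) = pt z \<longrightarrow> h z \<noteq> 0))"
    if h: "h \<in> FF n d" "pt x0 \<in> V" "h x0 \<noteq> 0" for h d x0
  proof -
    obtain y0 z0 where y0: "pt y0 \<in> U" "\<phi> (pt y0) = pt z0" "h z0 \<noteq> 0"
      using parametrization_image_dense[OF V U \<phi>[folded U_def] dense[folded U_def] h] by blast
    obtain p where p: "p \<in> S" "\<not> vanishes p (pt y0)" using y0(1) S(2) unfolding U_def by blast
    then obtain b where pb: "p \<in> forms (range to_ac) 2 b" using S(1) by blast
    have pF: "mpol_eval p \<in> FF 2 b"
      using pb formfun_eq[OF range_to_ac_0] formfun_mono[of "range to_ac" UNIV] by blast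
    obtain d' g where g: "\<And>i. i \<le> n \<Longrightarrow> g i \<in> formfun (range to_ac) 2 d'" "\<exists>i\<le>n. g i y0 \<noteq> 0"
      "\<And>y. pt y \<in> U \<Longrightarrow> (\<exists>i\<le>n. g i y \<noteq> 0) \<Longrightarrow> \<phi> (pt y) = pt (trunc n (\<lambda>i. g i y))"
      by (rule morphism_local[OF \<phi>[folded U_def] U(1) range_to_ac_0 y0(1)], rule that)
    obtain i0 where i0: "i0 \<le> n" "g i0 y0 \<noteq> 0" using g by blast
    have gF: "g i \<in> FF 2 d'" if "i \<le> n" for i using g(1)[OF that] formfun_mono[of _ UNIV] by blast
    have hpt: "h z \<noteq> 0" if "pt z = pt z'" "h z' \<noteq> 0" for z z'
      using that formfun_homog[OF h(1)] unfolding pt_eq_iff by auto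
    \<comment> \<open>The factors force the point into the domain, the local equations to be valid, and \<open>h\<close> to be nonzero at the image.\<close>
    define G where "G y = mpol_eval p y * g i0 y * h (trunc n (\<lambda>i. g i y))" for y
    have "G \<in> FF 2 ((b + d') + d * d')" unfolding G_def[abs_def]
      by (intro FF_mult FF_compose pF gF i0 h(1))
    moreover have "G y0 \<noteq> 0"
      using p(2) vanishes_pt[OF pb range_to_ac_0] i0 hpt[OF _ y0(3)] g(3)[OF y0(1) g(2)] y0(2)
      unfolding G_def by simp
    moreover have "pt y \<in> U \<and> (\<forall>z. \<phi> (pt y) = pt z \<longrightarrow> h z \<noteq> 0)" if y: "y \<in> coord_vecs 2" "G y \<noteq> 0" for y
    proof -
      have "\<not> vanishes p (pt y)" using y(2) vanishes_pt[OF pb range_to_ac_0] by (auto simp: G_def)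
      then have yU: "pt y \<in> U" using y(1) p(1) S(2) by (auto simp: U_def pt_in_proj_space)
      have "\<phi> (pt y) = pt (trunc n (\<lambda>i. g i y))" by (rule g(3)[OF yU]) (use i0 y(2) in \<open>auto simp: G_def\<close>)
      then show ?thesis using yU hpt y(2) by (auto simp: G_def)
    qed
    ultimately show ?thesis by blast
  qed
  define good where "good h G \<longleftrightarrow> (\<exists>e. G \<in> FF 2 e) \<and> (\<exists>y. G y \<noteq> 0) \<and>
      (\<forall>y\<in>coord_vecs 2. G y \<noteq> 0 \<longrightarrow> pt y \<in> U \<and> (\<forall>z. \<phi> (pt y) = pt z \<longrightarrow> h z \<noteq> 0))"
    for h G :: "(nat \<Rightarrow> 'f alg_closure) \<Rightarrow> 'f alg_closure"
  have "\<exists>G. h \<in> set hs \<longrightarrow> good h G" for h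
  proof (cases "h \<in> set hs")
    case True
    then obtain d x0 where "h \<in> FF n d" "pt x0 \<in> V" "h x0 \<noteq> 0" using hs by blast
    from claim[OF this] show ?thesis unfolding good_def by blast
  qed simp
  then obtain G where G0: "\<And>h. h \<in> set hs \<longrightarrow> good h (G h)" by metis
  have G: "(\<exists>e. G h \<in> FF 2 e) \<and> (\<exists>y. G h y \<noteq> 0)" if "h \<in> set hs" for h
    using G0 that by (simp add: good_def)
  have G': "pt y \<in> U \<and> (\<forall>z. \<phi> (pt y) = pt z \<longrightarrow> h z \<noteq> 0)"
    if "h \<in> set hs" "y \<in> coord_vecs 2" "G h y \<noteq> 0" for h y
    using G0 that by (simp add: good_def)
  obtain P1 where P1: "P1 \<in> U" using ne unfolding U_def by blast
  then have "\<phi> P1 \<in> V" using morphism_maps[OF \<phi>[folded U_def]] by simp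
  moreover from this V have "\<phi> P1 \<in> proj_space n" by (rule rev_subsetD)
  ultimately obtain x1 where x1: "pt x1 \<in> V" using proj_space_ne by metis
  have c1: "(\<lambda>_. 1) \<in> FF n 0" by (rule FF_const)
  obtain G1 where G1: "(\<exists>e. G1 \<in> FF 2 e) \<and> (\<exists>y. G1 y \<noteq> 0)"
      "\<And>y. y \<in> coord_vecs 2 \<Longrightarrow> G1 y \<noteq> 0 \<Longrightarrow> pt y \<in> U"
    using claim[OF c1 x1] by auto
  have "\<exists>H d. H \<in> FF 2 d \<and> (\<exists>y. H y \<noteq> 0) \<and> (\<forall>y. H y \<noteq> 0 \<longrightarrow> (\<forall>h\<in>set (G1 # map G hs). h y \<noteq> 0))"
    by (rule common_nonzero) (use G G1(1) in auto)
  then obtain H d y' where H: "H \<in> FF 2 d" "H y' \<noteq> 0" "\<And>y. H y \<noteq> 0 \<Longrightarrow> G1 y \<noteq> 0 \<and> (\<forall>h\<in>set hs. G h y \<noteq> 0)"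
    by auto
  obtain y where y: "y \<in> coord_vecs 2" "H y \<noteq> 0" "\<And>i. y i \<in> range to_ac" using rational_nonzero[OF H(1,2)] by blast
  have yU: "pt y \<in> U" using G1(2) H(3) y by blast
  obtain d' g where g: "\<And>i. i \<le> n \<Longrightarrow> g i \<in> formfun (range to_ac) 2 d'" "\<exists>i\<le>n. g i y \<noteq> 0"
      "\<And>y. pt y \<in> U \<Longrightarrow> (\<exists>i\<le>n. g i y \<noteq> 0) \<Longrightarrow> \<phi> (pt y) = pt (trunc n (\<lambda>i. g i y))"
      by (rule morphism_local[OF \<phi>[folded U_def] U(1) range_to_ac_0 yU], rule that)
  define x where "x = trunc n (\<lambda>i. g i y)"
  have px: "\<phi> (pt y) = pt x" unfolding x_def by (rule g(3)[OF yU g(2)])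
  have "pt x \<in> V" using morphism_maps[OF \<phi>[folded U_def] yU] px by simp
  moreover have "x i \<in> range to_ac" for i
    using formfun_rational_value[OF g(1) y(3)] range_to_ac_0 by (auto simp: x_def trunc_def)
  moreover have "h x \<noteq> 0" if "h \<in> set hs" for h
    using G'[OF that y(1)] H(3)[OF y(2)] that px by blast
  ultimately show ?thesis by blast
qed

section \<open>Binary forms\<close>

text \<open>Pairs that are not zero are homogeneous coordinates of points of the projective line,
  and \<open>peq\<close> is equality of such points.\<close>

definition nz :: "'k::field \<times> 'k \<Rightarrow> bool" where "nz s \<longleftrightarrow> s \<noteq> (0, 0)"

definition peq :: "'k::field \<times> 'k \<Rightarrow> 'k \<times> 'k \<Rightarrow> bool" where
  "peq s t \<longleftrightarrow> fst s * snd t = snd s * fst t"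

lemma peq_refl [simp]: "peq s s" by (simp add: peq_def mult.commute)

lemma peq_sym: "peq s t \<Longrightarrow> peq t s" by (auto simp: peq_def mult.commute)

lemma peq_scale: 
  assumes "peq s t" "nz s" "nz t"
  shows "\<exists>c. c \<noteq> 0 \<and> t = (c * fst s, c * snd s)"
proof (cases "fst s = 0")
  case True
  then have "snd s \<noteq> 0" "fst t = 0" using assms by (auto simp: nz_def peq_def prod_eq_iff)
  then show ?thesis using assms True
    by (intro exI[of _ "snd t / snd s"]) (auto simp: nz_def prod_eq_iff)
next
  case False
  then have "fst t \<noteq> 0" using assms by (auto simp: nz_def peq_def prod_eq_iff)
  then show ?thesis using assms False
    by (intro exI[of _ "fst t / fst s"]) (auto simp: peq_def prod_eq_iff field_simps)
qed

text \<open>Transitivity needs only the middle pair to be nonzero. The zero pair is proportional to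
  everything, so that local equations may vanish without spoiling the relation.\<close>

lemma peq_trans: 
  assumes "peq s t" "peq t u" "nz t"
  shows "peq s u"
proof -
  obtain a b c d e f where st: "s = (a, b)" "t = (c, d)" "u = (e, f)" by (cases s, cases t, cases u)
  have e: "a * d = b * c" "c * f = d * e" using assms(1,2) by (auto simp: st peq_def)
  have "(a * f) * c = a * (c * f)" by (simp only: mult_ac)
  also have "\<dots> = (a * d) * e" unfolding e(2) by (simp only: mult_ac)
  also have "\<dots> = (b * e) * c" unfolding e(1) by (simp only: mult_ac)
  finally have 1: "(a * f) * c = (b * e) * c" .
  have "(a * f) * d = (a * d) * f" by (simp only: mult_ac)
  also have "\<dots> = b * (c * f)" unfolding e(1) by (simp only: mult_ac)
  also have "\<dots> = (b * e) * d" unfolding e(2) by (simp only: mult_ac)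
  finally have 2: "(a * f) * d = (b * e) * d" .
  have "a * f = b * e" using assms(3) 1 2 unfolding st nz_def by auto
  then show ?thesis by (simp add: st peq_def)
qed

text \<open>The homogenization of degree \<open>d\<close> of a polynomial in one variable, as a function of the
  two homogeneous coordinates. The degree is explicit because it may exceed that of \<open>p\<close>, and then
  \<open>(1, 0)\<close> is a zero.\<close>

definition hom_eval :: "nat \<Rightarrow> 'k::field poly \<Rightarrow> 'k \<times> 'k \<Rightarrow> 'k" where
  "hom_eval d p s = (\<Sum>i\<le>d. coeff p i * fst s ^ i * snd s ^ (d - i))"

lemma hom_eval_0 [simp]: "hom_eval d 0 s = 0" by (simp add: hom_eval_def)

lemma hom_eval_add: "hom_eval d (p + q) s = hom_eval d p s + hom_eval d q s"
  by (simp add: hom_eval_def sum.distrib algebra_simps)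

lemma hom_eval_smult: "hom_eval d (smult c p) s = c * hom_eval d p s"
  by (simp add: hom_eval_def sum_distrib_left algebra_simps)

lemma hom_eval_sum: "hom_eval d (sum f A) s = (\<Sum>i\<in>A. hom_eval d (f i) s)"
  by (induction A rule: infinite_finite_induct) (auto simp: hom_eval_add)

lemma hom_eval_scale: "hom_eval d p (c * a, c * b) = c ^ d * hom_eval d p (a, b)"
proof -
  have "c ^ i * c ^ (d - i) = c ^ d" if "i \<le> d" for i using that by (simp add: power_add[symmetric])
  then show ?thesis
    unfolding hom_eval_def sum_distrib_left
    by (intro sum.cong) (auto simp: power_mult_distrib algebra_simps)
qed

lemma hom_eval_affine: 
  assumes "degree p \<le> d" shows "hom_eval d p (x, 1) = poly p x"
proof -
  have "poly p x = (\<Sum>i\<le>degree p. coeff p i * x ^ i)" by (rule poly_altdef)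
  also have "\<dots> = (\<Sum>i\<le>d. coeff p i * x ^ i)"
    by (rule sum.mono_neutral_left) (use assms in \<open>auto simp: coeff_eq_0\<close>)
  finally show ?thesis by (simp add: hom_eval_def)
qed

lemma hom_eval_infinity: "hom_eval d p (a, 0) = coeff p d * a ^ d"
proof -
  have "hom_eval d p (a, 0) = (\<Sum>i\<le>d. if i = d then coeff p i * a ^ i else 0)"
    unfolding hom_eval_def by (rule sum.cong) auto
  then show ?thesis by simp
qed

lemma hom_eval_finite:
  assumes "degree p \<le> d" "snd s \<noteq> 0"
  shows "hom_eval d p s = snd s ^ d * poly p (fst s / snd s)"
  using hom_eval_scale[of d p "snd s" "fst s / snd s" 1] hom_eval_affine[OF assms(1)] assms(2) by simp

lemma coeff_mult_bounds:
  fixes p q :: "'a::idom poly"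
  assumes "degree p \<le> d" "degree q \<le> e"
  shows "coeff (p * q) (d + e) = coeff p d * coeff q e"
proof (cases "degree p = d \<and> degree q = e")
  case True
  then show ?thesis using coeff_mult_degree_sum[of p q] by simp
next
  case False
  then have "degree (p * q) < d + e" using degree_mult_le[of p q] assms by linarith
  moreover have "coeff p d = 0 \<or> coeff q e = 0" using False assms by (auto simp: coeff_eq_0)
  ultimately show ?thesis by (auto simp: coeff_eq_0)
qed

text \<open>At finite points this is multiplicativity of evaluation, and at infinity
  multiplicativity of leading coefficients.\<close>

lemma hom_eval_mult:
  assumes "degree p \<le> d" "degree q \<le> e"
  shows "hom_eval (d + e) (p * q) s = hom_eval d p s * hom_eval e q s"
proof -
  have pq: "degree (p * q) \<le> d + e" using degree_mult_le[of p q] assms by linarith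
  show ?thesis
  proof (cases "snd s = 0")
    case True
    then have s: "s = (fst s, 0)" by (simp add: prod_eq_iff)
    show ?thesis
      by (subst (1 2 3) s) (simp add: hom_eval_infinity coeff_mult_bounds[OF assms] power_add del: prod.collapse)
  next
    case False
    show ?thesis
      unfolding hom_eval_finite[OF pq False] hom_eval_finite[OF assms(1) False] hom_eval_finite[OF assms(2) False]
      by (simp add: power_add)
  qed
qed

lemma hom_eval_root:
  assumes "degree p \<le> d" "p \<noteq> 0" "nz s" "hom_eval d p s = 0"
  shows "\<exists>q. p = [:- fst s, snd s:] * q \<and> degree q < d"
proof (cases "snd s = 0")
  case True
  then have s: "s = (fst s, 0)" "fst s \<noteq> 0" using assms(3) by (auto simp: prod_eq_iff nz_def)
  have c0: "coeff p d = 0" using assms(4) hom_eval_infinity[of d p "fst s"] s by auto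
  have "degree p \<noteq> d" using c0 assms(2) by auto
  then have "degree p < d" using assms(1) by simp
  then show ?thesis using s True by (intro exI[of _ "smult (- 1 / fst s) p"]) auto
next
  case False
  then have "poly p (fst s / snd s) = 0" using hom_eval_finite[OF assms(1) False] assms(4) False by simp
  then obtain r where r: "p = [:- (fst s / snd s), 1:] * r" unfolding poly_eq_0_iff_dvd by (elim dvdE)
  have "r \<noteq> 0" using assms(2) r by auto
  then have "degree p = Suc (degree r)" unfolding r by (subst degree_mult_eq) auto
  moreover have "[:- (fst s / snd s), 1:] = smult (1 / snd s) [:- fst s, snd s:]" using False by simp
  then have "p = [:- fst s, snd s:] * smult (1 / snd s) r"
    unfolding r by (simp only: mult_smult_left mult_smult_right)
  ultimately show ?thesis using assms(1) by (intro exI[of _ "smult (1 / snd s) r"]) auto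
qed

lemma hom_eval_has_zero:
  fixes p :: "'k::alg_closed_field poly"
  assumes "degree p \<le> d" "d > 0"
  shows "\<exists>s. nz s \<and> hom_eval d p s = 0"
proof (cases "coeff p d = 0")
  case True
  then show ?thesis using hom_eval_infinity[of d p 1] by (intro exI[of _ "(1, 0)"]) (auto simp: nz_def)
next
  case False
  then have "degree p = d" using assms(1) by (metis coeff_eq_0 le_neq_implies_less)
  then obtain x where "poly p x = 0" using assms(2) alg_closed_imp_poly_has_root by blast
  then show ?thesis using hom_eval_affine[OF assms(1)] by (intro exI[of _ "(x, 1)"]) (auto simp: nz_def)
qed

lemma hom_eval_finite_zeros:
  assumes "degree p \<le> d" "p \<noteq> 0"
  shows "\<exists>R. finite R \<and> (\<forall>r\<in>R. nz r) \<and> (\<forall>t. nz t \<longrightarrow> hom_eval d p t = 0 \<longrightarrow> (\<exists>r\<in>R. peq t r))"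
proof (intro exI conjI allI impI)
  let ?R = "insert (1, 0) ((\<lambda>x. (x, 1)) ` {x. poly p x = 0})"
  show "finite ?R" using poly_roots_finite[OF assms(2)] by simp
  show "\<forall>r\<in>?R. nz r" by (auto simp: nz_def)
  fix t assume t: "nz t" "hom_eval d p t = 0"
  show "\<exists>r\<in>?R. peq t r"
  proof (cases "snd t = 0")
    case True
    then show ?thesis by (auto simp: peq_def)
  next
    case False
    then have "poly p (fst t / snd t) = 0" using t hom_eval_finite[OF assms(1) False] by simp
    moreover have "peq t (fst t / snd t, 1)" using False by (simp add: peq_def)
    ultimately show ?thesis by blast
  qed
qed

definition bin_form :: "nat \<Rightarrow> ('k::field \<times> 'k \<Rightarrow> 'k) set" where
  "bin_form d = {hom_eval d p | p. degree p \<le> d}"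

lemma bin_formI: "degree p \<le> d \<Longrightarrow> hom_eval d p \<in> bin_form d" by (auto simp: bin_form_def)

lemma bin_form_add: 
  assumes "f \<in> bin_form d" "g \<in> bin_form d" shows "(\<lambda>s. f s + g s) \<in> bin_form d"
proof -
  obtain p q where pq: "f = hom_eval d p" "degree p \<le> d" "g = hom_eval d q" "degree q \<le> d" using assms by (auto simp: bin_form_def)
  have "(\<lambda>s. f s + g s) = hom_eval d (p + q)" by (auto simp: pq hom_eval_add)
  then show ?thesis using pq by (simp add: bin_formI degree_add_le)
qed

lemma bin_form_scale: 
  assumes "f \<in> bin_form d" shows "(\<lambda>s. c * f s) \<in> bin_form d"
proof -
  obtain p where pq: "f = hom_eval d p" "degree p \<le> d" using assms by (auto simp: bin_form_def)
  have "(\<lambda>s. c * f s) = hom_eval d (smult c p)" by (auto simp: pq hom_eval_smult)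
  then show ?thesis using pq by (simp add: bin_formI order_trans[OF degree_smult_le])
qed

lemma bin_form_zero: "(\<lambda>s. 0) \<in> bin_form d"
  using bin_formI[of 0 d] by (simp add: hom_eval_0[abs_def])

lemma bin_form_const: "(\<lambda>s. c) \<in> bin_form 0"
  using bin_formI[of "[:c:]" 0] by (simp add: hom_eval_def[abs_def])

lemma bin_form_sum: "(\<And>i. i \<in> A \<Longrightarrow> f i \<in> bin_form d) \<Longrightarrow> (\<lambda>s. \<Sum>i\<in>A. f i s) \<in> bin_form d"
  by (induction A rule: infinite_finite_induct) (auto intro: bin_form_add bin_form_zero)

lemma bin_form_mult: 
  assumes "f \<in> bin_form d" "g \<in> bin_form e" shows "(\<lambda>s. f s * g s) \<in> bin_form (d + e)"
proof -
  obtain p q where pq: "f = hom_eval d p" "degree p \<le> d" "g = hom_eval e q" "degree q \<le> e" using assms by (auto simp: bin_form_def)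
  have "(\<lambda>s. f s * g s) = hom_eval (d + e) (p * q)" by (auto simp: pq hom_eval_mult)
  moreover have "degree (p * q) \<le> d + e" using degree_mult_le[of p q] pq by linarith
  ultimately show ?thesis by (simp add: bin_formI)
qed

lemma bin_form_power: "f \<in> bin_form d \<Longrightarrow> (\<lambda>s. f s ^ n) \<in> bin_form (n * d)"
  by (induction n) (auto intro: bin_form_const bin_form_mult)

lemma bin_form_has_zero:
  fixes f :: "'k::alg_closed_field \<times> 'k \<Rightarrow> 'k"
  shows "f \<in> bin_form d \<Longrightarrow> d > 0 \<Longrightarrow> \<exists>s. nz s \<and> f s = 0"
  using hom_eval_has_zero by (auto simp: bin_form_def)

lemma bin_form_compose:
  assumes "x \<in> bin_form N" "y \<in> bin_form N"
  shows "(\<lambda>s. hom_eval d p (x s, y s)) \<in> bin_form (d * N)"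
proof -
  have "(\<lambda>s. coeff p i * x s ^ i * y s ^ (d - i)) \<in> bin_form (d * N)" if "i \<le> d" for i
  proof -
    have "(\<lambda>s. (coeff p i * x s ^ i) * y s ^ (d - i)) \<in> bin_form (i * N + (d - i) * N)"
      by (intro bin_form_mult bin_form_scale bin_form_power assms)
    moreover have "i * N + (d - i) * N = d * N" using that by (metis distrib_right le_add_diff_inverse)
    ultimately show ?thesis by simp
  qed
  then show ?thesis unfolding hom_eval_def fst_conv snd_conv by (intro bin_form_sum) auto
qed

section \<open>Bihomogeneous forms\<close>

text \<open>The homogenization of bidegree \<open>(d, e)\<close> of a polynomial in two variables. The
  coefficients, polynomials in the first variable, are homogenized before the polynomial itself.\<close>

definition bihom_eval :: "nat \<Rightarrow> nat \<Rightarrow> 'k::field poly poly \<Rightarrow> 'k \<times> 'k \<Rightarrow> 'k \<times> 'k \<Rightarrow> 'k" where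
  "bihom_eval d e a s t = hom_eval e (map_poly (\<lambda>p. hom_eval d p s) a) t"

definition bideg :: "nat \<Rightarrow> nat \<Rightarrow> 'k::field poly poly \<Rightarrow> bool" where
  "bideg d e a \<longleftrightarrow> degree a \<le> e \<and> (\<forall>j. degree (coeff a j) \<le> d)"

lemma coeff_hom_eval_map: "coeff (map_poly (\<lambda>p. hom_eval d p s) a) j = hom_eval d (coeff a j) s"
  by (simp add: coeff_map_poly)

lemma bihom_eval_alt: "bihom_eval d e a s t = (\<Sum>j\<le>e. hom_eval d (coeff a j) s * fst t ^ j * snd t ^ (e - j))"
  unfolding bihom_eval_def hom_eval_def[of e] coeff_hom_eval_map ..

lemma bihom_eval_add: "bihom_eval d e (a + b) s t = bihom_eval d e a s t + bihom_eval d e b s t"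
  by (simp add: bihom_eval_alt hom_eval_add sum.distrib algebra_simps)

lemma bihom_eval_zero: "bihom_eval d e 0 s t = 0" by (simp add: bihom_eval_def)

lemma bihom_eval_sum: "bihom_eval d e (sum f A) s t = (\<Sum>i\<in>A. bihom_eval d e (f i) s t)"
  by (induction A rule: infinite_finite_induct) (simp_all add: bihom_eval_add bihom_eval_zero)

lemma degree_hom_eval_map: "bideg d e a \<Longrightarrow> degree (map_poly (\<lambda>p. hom_eval d p s) a) \<le> e"
  using map_poly_degree_leq[of "\<lambda>p. hom_eval d p s" a] by (auto simp: bideg_def)

lemma bihom_eval_mult:
  assumes a: "bideg d e a" and b: "bideg d' e' b"
  shows "bihom_eval (d + d') (e + e') (a * b) s t = bihom_eval d e a s t * bihom_eval d' e' b s t"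
proof -
  have "map_poly (\<lambda>p. hom_eval (d + d') p s) (a * b) =
    map_poly (\<lambda>p. hom_eval d p s) a * map_poly (\<lambda>p. hom_eval d' p s) b"
  proof (rule poly_eqI)
    fix n
    have "hom_eval (d + d') (coeff a i * coeff b (n - i)) s = hom_eval d (coeff a i) s * hom_eval d' (coeff b (n - i)) s" for i
      by (rule hom_eval_mult) (use a b in \<open>auto simp: bideg_def\<close>)
    then show "coeff (map_poly (\<lambda>p. hom_eval (d + d') p s) (a * b)) n =
        coeff (map_poly (\<lambda>p. hom_eval d p s) a * map_poly (\<lambda>p. hom_eval d' p s) b) n"
      by (simp add: coeff_hom_eval_map coeff_mult hom_eval_sum)
  qed
  then show ?thesis
    unfolding bihom_eval_def using hom_eval_mult[OF degree_hom_eval_map[OF a] degree_hom_eval_map[OF b]] by simp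
qed

lemma bihom_eval_scale1: "bihom_eval d e a (c * x, c * y) t = c ^ d * bihom_eval d e a (x, y) t"
  unfolding bihom_eval_alt hom_eval_scale sum_distrib_left by (simp add: mult_ac)

lemma bihom_eval_scale2: "bihom_eval d e a s (c * x, c * y) = c ^ e * bihom_eval d e a s (x, y)"
  unfolding bihom_eval_def by (rule hom_eval_scale)

definition eval2 :: "'k::field poly poly \<Rightarrow> 'k \<Rightarrow> 'k \<Rightarrow> 'k" where
  "eval2 a x y = poly (map_poly (\<lambda>p. poly p x) a) y"

lemma bihom_eval_affine: 
  assumes "bideg d e a" shows "bihom_eval d e a (x, 1) (y, 1) = eval2 a x y"
proof -
  have "map_poly (\<lambda>p. hom_eval d p (x, 1)) a = map_poly (\<lambda>p. poly p x) a"
    by (rule poly_eqI) (use assms in \<open>auto simp: coeff_map_poly bideg_def hom_eval_affine\<close>)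
  then show ?thesis
    unfolding bihom_eval_def eval2_def using hom_eval_affine[OF degree_hom_eval_map[OF assms]] by metis
qed

lemma eval2_eq_0:
  fixes a :: "'k::field_char_0 poly poly"
  assumes "\<And>x y. eval2 a x y = 0"
  shows "a = 0"
proof (rule poly_eqI)
  fix j
  have "map_poly (\<lambda>p. poly p x) a = 0" for x
    using assms[of x] unfolding eval2_def by (metis poly_all_0_iff_0)
  then have "poly (coeff a j) x = 0" for x
    by (metis (no_types, lifting) coeff_0 coeff_map_poly poly_0)
  then show "coeff a j = coeff 0 j" by (metis coeff_0 poly_all_0_iff_0)
qed

lemma eval2_hom: "eval2 (a + b) x y = eval2 a x y + eval2 b x y"
  "eval2 (a - b) x y = eval2 a x y - eval2 b x y"
  "eval2 (a * b) x y = eval2 a x y * eval2 b x y"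
proof -
  have "map_poly (\<lambda>p. poly p x) (a + b) = map_poly (\<lambda>p. poly p x) a + map_poly (\<lambda>p. poly p x) b"
    by (rule poly_eqI) (simp add: coeff_map_poly)
  then show "eval2 (a + b) x y = eval2 a x y + eval2 b x y" by (simp add: eval2_def)
  have "map_poly (\<lambda>p. poly p x) (a - b) = map_poly (\<lambda>p. poly p x) a - map_poly (\<lambda>p. poly p x) b"
    by (rule poly_eqI) (simp add: coeff_map_poly)
  then show "eval2 (a - b) x y = eval2 a x y - eval2 b x y" by (simp add: eval2_def)
  have "map_poly (\<lambda>p. poly p x) (a * b) = map_poly (\<lambda>p. poly p x) a * map_poly (\<lambda>p. poly p x) b"
    by (rule poly_eqI) (simp add: coeff_map_poly coeff_mult poly_sum)
  then show "eval2 (a * b) x y = eval2 a x y * eval2 b x y" by (simp add: eval2_def)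
qed

lemma bihom_eval_bin_form1: 
  assumes "bideg d e a" shows "(\<lambda>s. bihom_eval d e a s t) \<in> bin_form d"
proof -
  have "(\<lambda>s. fst t ^ j * snd t ^ (e - j) * hom_eval d (coeff a j) s) \<in> bin_form d" for j
    by (intro bin_form_scale bin_formI) (use assms in \<open>simp add: bideg_def\<close>)
  from bin_form_sum[OF this, where A = "{..e}"] show ?thesis unfolding bihom_eval_alt by (simp add: mult_ac)
qed

lemma bihom_eval_bin_form2: "bideg d e a \<Longrightarrow> (\<lambda>t. bihom_eval d e a s t) \<in> bin_form e"
  unfolding bihom_eval_def using bin_formI[OF degree_hom_eval_map] by metis

lemma bihom_eval_compose:
  assumes "x \<in> bin_form N" "x' \<in> bin_form N" "y \<in> bin_form M" "y' \<in> bin_form M"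
  shows "(\<lambda>s. bihom_eval d e a (x s, x' s) (y s, y' s)) \<in> bin_form (d * N + e * M)"
proof -
  have "(\<lambda>s. (hom_eval d (coeff a j) (x s, x' s)) * (y s ^ j * y' s ^ (e - j))) \<in> bin_form (d * N + e * M)"
    if "j \<le> e" for j
  proof -
    have "(\<lambda>s. (hom_eval d (coeff a j) (x s, x' s)) * (y s ^ j * y' s ^ (e - j))) \<in> bin_form (d * N + (j * M + (e - j) * M))"
      by (intro bin_form_mult bin_form_compose bin_form_power assms)
    moreover have "j * M + (e - j) * M = e * M" using that by (metis distrib_right le_add_diff_inverse)
    ultimately show ?thesis by simp
  qed
  then have *: "(\<lambda>s. \<Sum>j\<le>e. (hom_eval d (coeff a j) (x s, x' s)) * (y s ^ j * y' s ^ (e - j))) \<in> bin_form (d * N + e * M)"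
    by (intro bin_form_sum) simp
  show ?thesis using * unfolding bihom_eval_alt fst_conv snd_conv mult.assoc .
qed

lemma bideg_exists: "\<exists>d. bideg d (degree a) a"
proof -
  have "degree (coeff a j) \<le> (\<Sum>i\<le>degree a. degree (coeff a i))" for j
  proof (cases "j \<le> degree a")
    case True
    then show ?thesis by (intro member_le_sum) auto
  next
    case False
    then show ?thesis by (simp add: coeff_eq_0)
  qed
  then show ?thesis unfolding bideg_def by blast
qed

lemma bideg_mono: "bideg d e a \<Longrightarrow> d \<le> d' \<Longrightarrow> e \<le> e' \<Longrightarrow> bideg d' e' a"
  unfolding bideg_def by (meson order_trans)

section \<open>Global equations of morphisms to the line\<close>

text \<open>Two fractions that equal the same fraction \<open>A0 / B0\<close> are equal, also for zero
  denominators.\<close>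

lemma cross_trans:
  fixes a :: "'a::idom"
  assumes "a * B0 = b * A0" "A * B0 = B * A0" "A0 \<noteq> 0 \<or> B0 \<noteq> 0"
  shows "a * B = b * A"
proof (cases "B0 = 0")
  case False
  have "(a * B) * B0 = (a * B0) * B" by (simp only: mult_ac)
  also have "\<dots> = b * (B * A0)" unfolding assms(1) by (simp only: mult_ac)
  also have "\<dots> = (b * A) * B0" unfolding assms(2)[symmetric] by (simp only: mult_ac)
  finally show ?thesis using False by simp
next
  case True
  then have "A0 \<noteq> 0" using assms(3) by simp
  have "(a * B) * A0 = a * (B * A0)" by (simp only: mult_ac)
  also have "\<dots> = (a * B0) * A" unfolding assms(2)[symmetric] by (simp only: mult_ac)
  also have "\<dots> = (b * A) * A0" unfolding assms(1) by (simp only: mult_ac)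
  finally show ?thesis using \<open>A0 \<noteq> 0\<close> by simp
qed

lemma peq_common: 
  assumes "peq u w" "peq v w" "nz w" shows "fst u * snd v = snd u * fst v"
  using peq_trans[OF assms(1) peq_sym[OF assms(2)] assms(3)] by (simp add: peq_def)

text \<open>A morphism from the projective line to itself in homogeneous coordinates. The relation
  \<open>peq\<close> holds everywhere, while the two forms need to be nonzero only at the given point.\<close>

definition line_mor :: "('k::field \<times> 'k \<Rightarrow> 'k \<times> 'k) \<Rightarrow> bool" where
  "line_mor f \<longleftrightarrow> (\<forall>s. nz s \<longrightarrow> nz (f s)) \<and>
     (\<forall>s. nz s \<longrightarrow> (\<exists>d p q. degree p \<le> d \<and> degree q \<le> d \<and> nz (hom_eval d p s, hom_eval d q s) \<and>
        (\<forall>s'. nz s' \<longrightarrow> peq (hom_eval d p s', hom_eval d q s') (f s'))))"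

lemma hom_eval_nonzeroD: "nz (hom_eval d p s, hom_eval d q s) \<Longrightarrow> p \<noteq> 0 \<or> q \<noteq> 0"
  by (auto simp: nz_def)

lemma nz_affine [simp]: "nz (x, 1)" "nz (1, x)" by (auto simp: nz_def)

lemma poly_eqI': 
  fixes p :: "'k::field_char_0 poly" shows "(\<And>x. poly p x = poly q x) \<Longrightarrow> p = q"
  using poly_eq_poly_eq_iff by blast

text \<open>Among the pairs of polynomials that have the same quotient as the given morphism,
  a pair of least degree has no common zero: a common linear factor could be cancelled. It therefore
  describes the morphism everywhere.\<close>

lemma line_mor_global:
  fixes f :: "'k::field_char_0 \<times> 'k \<Rightarrow> 'k \<times> 'k"
  assumes f: "line_mor f"
  shows "\<exists>N. \<exists>x\<in>bin_form N. \<exists>y\<in>bin_form N. \<forall>s. nz s \<longrightarrow> nz (x s, y s) \<and> peq (x s, y s) (f s)"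
proof -
  have nzf: "nz (f s)" if "nz s" for s using f that unfolding line_mor_def by blast
  have loc: "\<exists>d p q. degree p \<le> d \<and> degree q \<le> d \<and> nz (hom_eval d p s, hom_eval d q s) \<and>
        (\<forall>s'. nz s' \<longrightarrow> peq (hom_eval d p s', hom_eval d q s') (f s'))" if "nz s" for s
    using f that unfolding line_mor_def by blast
  from loc[OF nz_affine(1)[of 0]] obtain D P0 Q0 where 0: "degree P0 \<le> D" "degree Q0 \<le> D"
    "nz (hom_eval D P0 (0, 1), hom_eval D Q0 (0, 1))"
    "\<And>s'. nz s' \<Longrightarrow> peq (hom_eval D P0 s', hom_eval D Q0 s') (f s')" by blast
  have 00: "P0 \<noteq> 0 \<or> Q0 \<noteq> 0" using hom_eval_nonzeroD[OF 0(3)] .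
  define good where "good N p q \<longleftrightarrow> degree p \<le> N \<and> degree q \<le> N \<and> (p \<noteq> 0 \<or> q \<noteq> 0) \<and> p * Q0 = q * P0" for N p q
  have "good D P0 Q0" using 0 00 by (simp add: good_def mult.commute)
  then have ex: "\<exists>N p q. good N p q" by blast
  define N where "N = (LEAST N. \<exists>p q. good N p q)"
  from LeastI_ex[OF ex] obtain p q where pq: "good N p q" unfolding N_def by blast
  have min: "N \<le> M" if "good M p' q'" for M p' q' unfolding N_def by (rule Least_le) (use that in blast)
  have p: "degree p \<le> N" and q: "degree q \<le> N" using pq by (auto simp: good_def)
  have nzero: "nz (hom_eval N p s, hom_eval N q s)" if s: "nz s" for s
  proof (rule ccontr)
    assume "\<not> ?thesis"
    then have z: "hom_eval N p s = 0" "hom_eval N q s = 0" by (auto simp: nz_def)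
    have "\<exists>q. r = [:- fst s, snd s:] * q \<and> (r \<noteq> 0 \<longrightarrow> degree q < N) \<and> (r = 0 \<longrightarrow> q = 0)"
      if "degree r \<le> N" "hom_eval N r s = 0" for r
    proof (cases "r = 0")
      case False
      then show ?thesis using hom_eval_root[OF that(1) False s that(2)] by auto
    qed (auto intro: exI[of _ 0])
    note dv = this
    obtain p' where p': "p = [:- fst s, snd s:] * p' \<and> (p \<noteq> 0 \<longrightarrow> degree p' < N) \<and> (p = 0 \<longrightarrow> p' = 0)"
      using dv[OF p z(1)] by (elim exE)
    obtain q' where q': "q = [:- fst s, snd s:] * q' \<and> (q \<noteq> 0 \<longrightarrow> degree q' < N) \<and> (q = 0 \<longrightarrow> q' = 0)"
      using dv[OF q z(2)] by (elim exE)
    note e = p'[THEN conjunct1] p'[THEN conjunct2, THEN conjunct1, rule_format]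
      p'[THEN conjunct2, THEN conjunct2, rule_format] q'[THEN conjunct1]
      q'[THEN conjunct2, THEN conjunct1, rule_format] q'[THEN conjunct2, THEN conjunct2, rule_format]
    have "p \<noteq> 0 \<or> q \<noteq> 0" using pq by (simp add: good_def)
    then have N0: "N > 0" using e(2) e(5) by (metis gr_zeroI not_less_zero)
    have l0: "[:- fst s, snd s:] \<noteq> 0" using s by (auto simp: nz_def prod_eq_iff)
    have "[:- fst s, snd s:] * (p' * Q0) = [:- fst s, snd s:] * (q' * P0)"
      using pq unfolding good_def e(1) e(4) by (simp only: mult.assoc)
    then have "p' * Q0 = q' * P0" using l0 mult_left_cancel by blast
    moreover have "degree p' \<le> N - 1" using e(2,3) N0 by (cases "p = 0") auto
    moreover have "degree q' \<le> N - 1" using e(5,6) N0 by (cases "q = 0") auto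
    moreover have "p' \<noteq> 0 \<or> q' \<noteq> 0" using \<open>p \<noteq> 0 \<or> q \<noteq> 0\<close> e(1) e(4) mult_zero_right by metis
    ultimately have "good (N - 1) p' q'" by (simp add: good_def)
    from min[OF this] N0 show False by simp
  qed
  have "peq (hom_eval N p s, hom_eval N q s) (f s)" if s: "nz s" for s
  proof -
    from loc[OF s] obtain d P Q where 1: "degree P \<le> d" "degree Q \<le> d"
      "nz (hom_eval d P s, hom_eval d Q s)" "\<And>s'. nz s' \<Longrightarrow> peq (hom_eval d P s', hom_eval d Q s') (f s')" by blast
    have "P * Q0 = Q * P0"
    proof (rule poly_eqI')
      fix x
      from peq_common[OF 1(4) 0(4) nzf, of "(x, 1)"]
      show "poly (P * Q0) x = poly (Q * P0) x"
        using hom_eval_affine[OF 1(1)] hom_eval_affine[OF 1(2)] hom_eval_affine[OF 0(1)] hom_eval_affine[OF 0(2)] by simp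
    qed
    with pq 00 have "p * Q = q * P" using cross_trans[of p Q0 q P0 P Q] by (simp add: good_def)
    then have "hom_eval (N + d) (p * Q) s = hom_eval (N + d) (q * P) s" by simp
    then have "peq (hom_eval N p s, hom_eval N q s) (hom_eval d P s, hom_eval d Q s)"
      by (simp add: peq_def hom_eval_mult p q 1)
    from peq_trans[OF this 1(4)[OF s] 1(3)] show ?thesis .
  qed
  then show ?thesis using nzero bin_formI[OF p] bin_formI[OF q] by blast
qed

text \<open>A morphism from the product of two lines to the line in homogeneous coordinates.\<close>

definition bi_mor :: "('k::field \<times> 'k \<Rightarrow> 'k \<times> 'k \<Rightarrow> 'k \<times> 'k) \<Rightarrow> bool" where
  "bi_mor g \<longleftrightarrow> (\<forall>s t. nz s \<longrightarrow> nz t \<longrightarrow> nz (g s t)) \<and>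
     (\<forall>s t. nz s \<longrightarrow> nz t \<longrightarrow> (\<exists>d a b. bideg d d a \<and> bideg d d b \<and> nz (bihom_eval d d a s t, bihom_eval d d b s t) \<and>
        (\<forall>s' t'. nz s' \<longrightarrow> nz t' \<longrightarrow> peq (bihom_eval d d a s' t', bihom_eval d d b s' t') (g s' t'))))"

lemma bi_mor_nz: "bi_mor g \<Longrightarrow> nz s \<Longrightarrow> nz t \<Longrightarrow> nz (g s t)" unfolding bi_mor_def by blast

lemma bi_mor_local:
  assumes "bi_mor g" "nz s" "nz t"
  obtains d a b where "bideg d d a" "bideg d d b" "nz (bihom_eval d d a s t, bihom_eval d d b s t)"
    "\<And>s' t'. nz s' \<Longrightarrow> nz t' \<Longrightarrow> peq (bihom_eval d d a s' t', bihom_eval d d b s' t') (g s' t')"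
  using assms unfolding bi_mor_def by blast

lemma bi_mor_inv:
  assumes g: "bi_mor g" and n: "nz s" "nz t" "nz s'" "nz t'" and e: "peq s s'" "peq t t'"
  shows "peq (g s t) (g s' t')"
proof -
  obtain d a b where l: "bideg d d a" "bideg d d b" "nz (bihom_eval d d a s t, bihom_eval d d b s t)"
    "\<And>s' t'. nz s' \<Longrightarrow> nz t' \<Longrightarrow> peq (bihom_eval d d a s' t', bihom_eval d d b s' t') (g s' t')"
    by (rule bi_mor_local[OF g n(1,2)]) blast
  obtain c where c: "c \<noteq> 0" "s' = (c * fst s, c * snd s)" using peq_scale[OF e(1) n(1,3)] by blast
  obtain c' where c': "c' \<noteq> 0" "t' = (c' * fst t, c' * snd t)" using peq_scale[OF e(2) n(2,4)] by blast
  have sc: "bihom_eval d d a s' t' = c ^ d * (c' ^ d * bihom_eval d d a s t)" for a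
    by (simp add: c(2) c'(2) bihom_eval_scale1 bihom_eval_scale2)
  let ?k = "c ^ d * c' ^ d"
  have k: "?k \<noteq> 0" using c c' by simp
  have "peq (bihom_eval d d a s' t', bihom_eval d d b s' t') (g s' t')" by (rule l(4)[OF n(3,4)])
  then have "?k * (bihom_eval d d a s t * snd (g s' t')) = ?k * (bihom_eval d d b s t * fst (g s' t'))"
    unfolding peq_def sc fst_conv snd_conv by (simp only: mult_ac)
  then have "peq (bihom_eval d d a s t, bihom_eval d d b s t) (g s' t')"
    using mult_left_cancel[OF k] unfolding peq_def fst_conv snd_conv by blast
  with peq_sym[OF l(4)[OF n(1,2)]] l(3) show ?thesis using peq_trans by blast
qed

lemma bi_mor_slot2: 
  fixes g :: "'k::field \<times> 'k \<Rightarrow> 'k \<times> 'k \<Rightarrow> 'k \<times> 'k"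
  assumes g: "bi_mor g" and s: "nz s" shows "line_mor (\<lambda>t. g s t)"
  unfolding line_mor_def
proof (intro conjI allI impI)
  fix t :: "'k \<times> 'k" assume t: "nz t"
  show "nz (g s t)" using bi_mor_nz[OF g s t] .
  obtain d a b where l: "bideg d d a" "bideg d d b" "nz (bihom_eval d d a s t, bihom_eval d d b s t)"
    "\<And>s' t'. nz s' \<Longrightarrow> nz t' \<Longrightarrow> peq (bihom_eval d d a s' t', bihom_eval d d b s' t') (g s' t')"
    by (rule bi_mor_local[OF g s t]) blast
  show "\<exists>d p q. degree p \<le> d \<and> degree q \<le> d \<and> nz (hom_eval d p t, hom_eval d q t) \<and>
            (\<forall>s'. nz s' \<longrightarrow> peq (hom_eval d p s', hom_eval d q s') (g s s'))"
    using l degree_hom_eval_map[OF l(1), of s] degree_hom_eval_map[OF l(2), of s] s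
    unfolding bihom_eval_def by blast
qed

lemma bi_mor_slot1: 
  fixes g :: "'k::field \<times> 'k \<Rightarrow> 'k \<times> 'k \<Rightarrow> 'k \<times> 'k"
  assumes g: "bi_mor g" and t: "nz t" shows "line_mor (\<lambda>s. g s t)"
  unfolding line_mor_def
proof (intro conjI allI impI)
  fix s :: "'k \<times> 'k" assume s: "nz s"
  show "nz (g s t)" using bi_mor_nz[OF g s t] .
  obtain d a b where l: "bideg d d a" "bideg d d b" "nz (bihom_eval d d a s t, bihom_eval d d b s t)"
    "\<And>s' t'. nz s' \<Longrightarrow> nz t' \<Longrightarrow> peq (bihom_eval d d a s' t', bihom_eval d d b s' t') (g s' t')"
    by (rule bi_mor_local[OF g s t]) blast
  obtain p where p: "degree p \<le> d" "\<And>s. bihom_eval d d a s t = hom_eval d p s"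
    using bihom_eval_bin_form1[OF l(1), of t] unfolding bin_form_def by (auto dest: fun_cong)
  obtain q where q: "degree q \<le> d" "\<And>s. bihom_eval d d b s t = hom_eval d q s"
    using bihom_eval_bin_form1[OF l(2), of t] unfolding bin_form_def by (auto dest: fun_cong)
  show "\<exists>d p q. degree p \<le> d \<and> degree q \<le> d \<and> nz (hom_eval d p s, hom_eval d q s) \<and>
            (\<forall>s'. nz s' \<longrightarrow> peq (hom_eval d p s', hom_eval d q s') (g s' t))"
    using p q l(3) l(4)[OF _ t] by (intro exI[of _ d] exI[of _ p] exI[of _ q]) auto
qed

text \<open>An element \<open>h\<close> of least degree in the second variable in the ideal of \<open>a\<close> and \<open>b\<close>
  divides both up to factors in the first variable, by pseudo-division. The quotients have the same
  ratio as \<open>a\<close> and \<open>b\<close>, so minimality forces \<open>h\<close> to be free of the second variable. Then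
  \<open>h\<close> vanishes at the first coordinate of each common zero.\<close>

lemma minimal_pair_bezout:
  fixes a b A0 B0 :: "'k::field_char_0 poly poly"
  assumes ab: "a \<noteq> 0 \<or> b \<noteq> 0" "a * B0 = b * A0"
    and min: "\<And>a' b'. a' \<noteq> 0 \<or> b' \<noteq> 0 \<Longrightarrow> a' * B0 = b' * A0 \<Longrightarrow> max (degree a) (degree b) \<le> max (degree a') (degree b')"
  shows "\<exists>c. c \<noteq> 0 \<and> (\<forall>x y. eval2 a x y = 0 \<longrightarrow> eval2 b x y = 0 \<longrightarrow> poly c x = 0)"
proof -
  define I where "I h \<longleftrightarrow> (\<exists>u v. h = u * a + v * b)" for h
  have Ia: "I a" unfolding I_def by (rule exI[of _ 1], rule exI[of _ 0]) simp
  have Ib: "I b" unfolding I_def by (rule exI[of _ 0], rule exI[of _ 1]) simp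
  have Ilin: "I (k * h - q * h')" if hh: "I h" "I h'" for h h' k q
  proof -
    obtain u v u' v' where "h = u * a + v * b" "h' = u' * a + v' * b" using hh unfolding I_def by blast
    then have "k * h - q * h' = (k * u - q * u') * a + (k * v - q * v') * b" by (simp add: algebra_simps)
    then show ?thesis unfolding I_def by blast
  qed
  have "\<exists>n h. I h \<and> h \<noteq> 0 \<and> degree h = n" using Ia Ib ab(1) by blast
  from LeastI_ex[OF this] obtain h where h: "I h" "h \<noteq> 0"
    "degree h = (LEAST n. \<exists>h. I h \<and> h \<noteq> 0 \<and> degree h = n)" by blast
  have hmin: "degree h \<le> degree h'" if "I h'" "h' \<noteq> 0" for h'
    unfolding h(3) by (rule Least_le) (use that in blast)
  have div: "\<exists>c q. c \<noteq> 0 \<and> smult c f = h * q" if f: "I f" for f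
  proof -
    obtain q r where qr: "pseudo_divmod f h = (q, r)" by (cases "pseudo_divmod f h")
    define c where "c = coeff h (degree h) ^ (Suc (degree f) - degree h)"
    from pseudo_divmod[OF h(2) qr] have e: "smult c f = h * q + r" "r = 0 \<or> degree r < degree h"
      by (auto simp: c_def)
    have "r = [:c:] * f - q * h" using e(1) by (simp add: algebra_simps)
    then have "I r" using Ilin[OF f h(1)] by metis
    then have "r = 0" using e(2) hmin[of r] by fastforce
    moreover have "c \<noteq> 0" using h(2) by (simp add: c_def)
    ultimately show ?thesis using e(1) by auto
  qed
  obtain c q where cq: "c \<noteq> 0" "smult c a = h * q" using div[OF Ia] by blast
  obtain c' q' where cq': "c' \<noteq> 0" "smult c' b = h * q'" using div[OF Ib] by blast
  define a' where "a' = smult c' q"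
  define b' where "b' = smult c q'"
  have "h * a' = smult c' (smult c a)" unfolding cq(2) by (simp add: a'_def)
  then have ha: "h * a' = smult (c * c') a" by (simp add: mult.commute)
  have "h * b' = smult c (smult c' b)" unfolding cq'(2) by (simp add: b'_def)
  then have hb: "h * b' = smult (c * c') b" by simp
  have cc: "c * c' \<noteq> 0" using cq cq' by simp
  have nz': "a' \<noteq> 0 \<or> b' \<noteq> 0" using ha hb cc ab(1) by auto
  have "h * (a' * B0) = h * (b' * A0)"
    using ha hb ab(2) by (metis mult.assoc mult_smult_left)
  then have "a' * B0 = b' * A0" using h(2) by simp
  from min[OF nz' this] have mm: "max (degree a) (degree b) \<le> max (degree a') (degree b')" .
  have da: "degree a' + degree h = degree a" if "a' \<noteq> 0"
    using degree_mult_eq[OF h(2) that] ha cc by simp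
  have db: "degree b' + degree h = degree b" if "b' \<noteq> 0"
    using degree_mult_eq[OF h(2) that] hb cc by simp
  have a0: "a' = 0 \<longleftrightarrow> a = 0" and b0: "b' = 0 \<longleftrightarrow> b = 0" using ha hb cc h(2) by auto
  have "degree h = 0"
  proof (rule ccontr)
    assume "degree h \<noteq> 0"
    then show False using mm da db nz' a0 b0 by (cases "a' = 0"; cases "b' = 0") (auto simp: max_def split: if_splits)
  qed
  then obtain c0 where c0: "h = [:c0:]" by (rule degree_eq_zeroE)
  then have "c0 \<noteq> 0" using h(2) by auto
  moreover have "poly c0 x = 0" if "eval2 a x y = 0" "eval2 b x y = 0" for x y
  proof -
    obtain u v where "h = u * a + v * b" using h(1) unfolding I_def by blast
    then have "eval2 h x y = 0" using that by (simp add: eval2_hom)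
    then show ?thesis by (simp add: c0 eval2_def map_poly_pCons)
  qed
  ultimately show ?thesis by blast
qed

text \<open>The pair \<open>a\<close>, \<open>b\<close> is minimal first in \<open>e\<close> and then in \<open>d\<close>. Minimality of \<open>e\<close> confines
  the common zeros to finitely many lines of the first ruling (\<open>minimal_pair_bezout\<close>, and the
  leading coefficients at infinity). Minimality of \<open>d\<close> means that the forms do not both vanish on
  such a line, since the equation of the line could be cancelled; so each contains finitely many.
  Common zeros cannot be excluded altogether by this argument, but finiteness is enough.\<close>

lemma bi_mor_min:
  fixes g :: "'k::field_char_0 \<times> 'k \<Rightarrow> 'k \<times> 'k \<Rightarrow> 'k \<times> 'k"
  assumes g: "bi_mor g"
  shows "\<exists>d e a b Z. bideg d e a \<and> bideg d e b \<and>
    (\<forall>s t. nz s \<longrightarrow> nz t \<longrightarrow> peq (bihom_eval d e a s t, bihom_eval d e b s t) (g s t)) \<and>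
    finite Z \<and> (\<forall>s t. nz s \<longrightarrow> nz t \<longrightarrow> bihom_eval d e a s t = 0 \<longrightarrow> bihom_eval d e b s t = 0 \<longrightarrow>
       (\<exists>(s', t')\<in>Z. nz s' \<and> nz t' \<and> peq s s' \<and> peq t t'))"
proof -
  obtain D A0 B0 where 0: "bideg D D A0" "bideg D D B0"
    "nz (bihom_eval D D A0 (0, 1) (0, 1), bihom_eval D D B0 (0, 1) (0, 1))"
    "\<And>s' t'. nz s' \<Longrightarrow> nz t' \<Longrightarrow> peq (bihom_eval D D A0 s' t', bihom_eval D D B0 s' t') (g s' t')"
    by (rule bi_mor_local[OF g nz_affine(1)[of 0] nz_affine(1)[of 0]]) blast
  have 00: "A0 \<noteq> 0 \<or> B0 \<noteq> 0" using 0(3) by (auto simp: nz_def bihom_eval_zero)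
  define good where "good d e a b \<longleftrightarrow> bideg d e a \<and> bideg d e b \<and> (a \<noteq> 0 \<or> b \<noteq> 0) \<and> a * B0 = b * A0" for d e a b
  have "good D D A0 B0" using 0 00 by (simp add: good_def mult.commute)
  then have ex: "\<exists>e d a b. good d e a b" by blast
  define e where "e = (LEAST e. \<exists>d a b. good d e a b)"
  have ex2: "\<exists>d a b. good d e a b" using LeastI_ex[OF ex] unfolding e_def .
  define d where "d = (LEAST d. \<exists>a b. good d e a b)"
  have "\<exists>a b. good d e a b" using LeastI_ex[OF ex2] unfolding d_def .
  then obtain a b where ab: "good d e a b" by blast
  have emin: "e \<le> e'" if "good d' e' a' b'" for d' e' a' b'
    unfolding e_def by (rule Least_le) (use that in blast)
  have dmin: "d \<le> d'" if "good d' e a' b'" for d' a' b'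
    unfolding d_def by (rule Least_le) (use that in blast)
  have a: "bideg d e a" and b: "bideg d e b" and nab: "a \<noteq> 0 \<or> b \<noteq> 0" and rel: "a * B0 = b * A0"
    using ab by (auto simp: good_def)
  have tmin: "e \<le> max (degree a') (degree b')" if "a' \<noteq> 0 \<or> b' \<noteq> 0" "a' * B0 = b' * A0" for a' b'
  proof -
    obtain d1 d2 where "bideg d1 (degree a') a'" "bideg d2 (degree b') b'" using bideg_exists by metis
    then have "good (max d1 d2) (max (degree a') (degree b')) a' b'"
      using that unfolding good_def by (auto intro: bideg_mono)
    then show ?thesis by (rule emin)
  qed
  have "max (degree a) (degree b) \<le> e" using a b by (simp add: bideg_def)
  with tmin have "\<exists>c. c \<noteq> 0 \<and> (\<forall>x y. eval2 a x y = 0 \<longrightarrow> eval2 b x y = 0 \<longrightarrow> poly c x = 0)"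
    by (intro minimal_pair_bezout[OF nab rel]) (meson order_trans)
  then obtain c where c: "c \<noteq> 0" "\<And>x y. eval2 a x y = 0 \<Longrightarrow> eval2 b x y = 0 \<Longrightarrow> poly c x = 0" by blast
  have maxe: "max (degree a) (degree b) = e"
    using tmin[OF nab rel] \<open>max (degree a) (degree b) \<le> e\<close> by simp
  have top: "coeff a e \<noteq> 0 \<or> coeff b e \<noteq> 0"
  proof (cases "degree a = e")
    case True
    show ?thesis
    proof (cases "a = 0")
      case True
      then have "b \<noteq> 0" "degree b = e" using nab \<open>degree a = e\<close> maxe by auto
      then show ?thesis by (metis leading_coeff_0_iff)
    next
      case False
      then show ?thesis using True by (metis leading_coeff_0_iff)
    qed
  next
    case False
    then have "degree b = e" "degree b > degree a" using maxe by (auto simp: max_def split: if_splits)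
    then have "b \<noteq> 0" by auto
    then show ?thesis using \<open>degree b = e\<close> by (metis leading_coeff_0_iff)
  qed
  define sa where "sa s = map_poly (\<lambda>p. hom_eval d p s) a" for s
  define sb where "sb s = map_poly (\<lambda>p. hom_eval d p s) b" for s
  have dsa: "degree (sa s) \<le> e" and dsb: "degree (sb s) \<le> e" for s
    unfolding sa_def sb_def by (rule degree_hom_eval_map[OF a], rule degree_hom_eval_map[OF b])
  have ha: "bihom_eval d e a s t = hom_eval e (sa s) t" and hb: "bihom_eval d e b s t = hom_eval e (sb s) t" for s t
    by (simp_all add: bihom_eval_def sa_def sb_def)
  have line: "sa s \<noteq> 0 \<or> sb s \<noteq> 0" if s: "nz s" for s
  proof (rule ccontr)
    assume "\<not> ?thesis"
    then have z: "hom_eval d (coeff a j) s = 0" "hom_eval d (coeff b j) s = 0" for j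
      unfolding sa_def sb_def using coeff_hom_eval_map by (metis coeff_0)+
    let ?l = "[:- fst s, snd s:]"
    have l0: "?l \<noteq> 0" using s by (auto simp: nz_def prod_eq_iff)
    have dv: "\<exists>f'. f = smult ?l f' \<and> (f \<noteq> 0 \<longrightarrow> d > 0 \<and> bideg (d - 1) e f')"
      if f: "bideg d e f" "\<And>j. hom_eval d (coeff f j) s = 0" for f
    proof -
      have "\<exists>q. coeff f j = ?l * q \<and> (coeff f j \<noteq> 0 \<longrightarrow> degree q < d) \<and> (coeff f j = 0 \<longrightarrow> q = 0)" for j
      proof (cases "coeff f j = 0")
        case False
        have "degree (coeff f j) \<le> d" using f(1) by (simp add: bideg_def)
        from hom_eval_root[OF this False s f(2)] show ?thesis using False by auto
      qed (auto intro: exI[of _ 0])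
      then obtain Q where Q: "\<And>j. coeff f j = ?l * Q j" "\<And>j. coeff f j \<noteq> 0 \<Longrightarrow> degree (Q j) < d"
        "\<And>j. coeff f j = 0 \<Longrightarrow> Q j = 0" by metis
      define f' where "f' = Abs_poly Q"
      have cf': "coeff f' j = Q j" for j
        unfolding f'_def
        by (subst coeff_Abs_poly[where n = "degree f"]) (use Q(3) coeff_eq_0 in auto)
      have "f = smult ?l f'" by (rule poly_eqI) (simp only: coeff_smult cf' Q(1))
      moreover have "d > 0 \<and> bideg (d - 1) e f'" if "f \<noteq> 0"
      proof -
        have dp: "d > 0" using Q(2)[of "degree f"] that by auto
        have "degree f' \<le> e"
        proof (rule degree_le, intro allI impI)
          fix j assume "e < j"
          then have "coeff f j = 0" using f(1) by (intro coeff_eq_0) (simp add: bideg_def)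
          then show "coeff f' j = 0" using Q(3) cf' by simp
        qed
        moreover have "degree (coeff f' j) \<le> d - 1" for j
          using Q(2)[of j] Q(3)[of j] dp by (cases "coeff f j = 0") (auto simp: cf')
        ultimately show ?thesis using dp by (simp add: bideg_def)
      qed
      ultimately show ?thesis by blast
    qed
    from dv[OF a z(1)] dv[OF b z(2)] obtain a' b' where
      e: "a = smult ?l a'" "a \<noteq> 0 \<Longrightarrow> d > 0 \<and> bideg (d - 1) e a'"
         "b = smult ?l b'" "b \<noteq> 0 \<Longrightarrow> d > 0 \<and> bideg (d - 1) e b'" by metis
    have dp: "d > 0" using e nab by blast
    have z': "bideg (d - 1) e 0" by (simp add: bideg_def)
    have "a' = 0 \<longleftrightarrow> a = 0" "b' = 0 \<longleftrightarrow> b = 0" using e(1,3) l0 smult_eq_0_iff by metis+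
    then have n': "a' \<noteq> 0 \<or> b' \<noteq> 0" "bideg (d - 1) e a'" "bideg (d - 1) e b'" using nab e(2,4) z' by blast+
    have "smult ?l (a' * B0) = smult ?l (b' * A0)" using rel unfolding e(1) e(3) by (simp only: mult_smult_left)
    then have "smult ?l (a' * B0 - b' * A0) = 0" by (simp only: smult_diff_right diff_self)
    then have "a' * B0 - b' * A0 = 0" using l0 smult_eq_0_iff by blast
    then have "a' * B0 = b' * A0" by simp
    then have "good (d - 1) e a' b'" using n' by (simp add: good_def)
    from dmin[OF this] dp show False by simp
  qed
  have peqg: "peq (bihom_eval d e a s t, bihom_eval d e b s t) (g s t)" if st: "nz s" "nz t" for s t
  proof -
    obtain D' A B where 1: "bideg D' D' A" "bideg D' D' B" "nz (bihom_eval D' D' A s t, bihom_eval D' D' B s t)"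
      "\<And>s' t'. nz s' \<Longrightarrow> nz t' \<Longrightarrow> peq (bihom_eval D' D' A s' t', bihom_eval D' D' B s' t') (g s' t')"
      by (rule bi_mor_local[OF g st]) blast
    have "A * B0 - B * A0 = 0"
    proof (rule eval2_eq_0)
      fix x y
      from peq_common[OF 1(4) 0(4) bi_mor_nz[OF g], of "(x, 1)" "(y, 1)"]
      show "eval2 (A * B0 - B * A0) x y = 0"
        by (simp add: eval2_hom bihom_eval_affine[OF 1(1)] bihom_eval_affine[OF 1(2)] bihom_eval_affine[OF 0(1)] bihom_eval_affine[OF 0(2)])
    qed
    then have "A * B0 = B * A0" by simp
    with rel 00 have "a * B = b * A" using cross_trans[of a B0 b A0 A B] by blast
    then have "bihom_eval (d + D') (e + D') (a * B) s t = bihom_eval (d + D') (e + D') (b * A) s t" by simp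
    then have "peq (bihom_eval d e a s t, bihom_eval d e b s t) (bihom_eval D' D' A s t, bihom_eval D' D' B s t)"
      by (simp add: peq_def bihom_eval_mult a b 1)
    from peq_trans[OF this 1(4)[OF st] 1(3)] show ?thesis .
  qed
  define S0 where "S0 = {x. poly c x = 0} \<union> {x. poly (coeff a e) x = 0 \<and> poly (coeff b e) x = 0}"
  have finS0: "finite S0"
    using poly_roots_finite[OF c(1)] top poly_roots_finite[of "coeff a e"] poly_roots_finite[of "coeff b e"]
    unfolding S0_def by (auto intro: finite_subset)
  define S :: "('k \<times> 'k) set" where "S = insert (1, 0) ((\<lambda>x. (x, 1)) ` S0)"
  have finS: "finite S" and nzS: "\<And>s. s \<in> S \<Longrightarrow> nz s" using finS0 by (auto simp: S_def nz_def)
  have "\<exists>R. finite R \<and> (\<forall>r\<in>R. nz r) \<and>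
      (\<forall>t. nz t \<longrightarrow> bihom_eval d e a s t = 0 \<longrightarrow> bihom_eval d e b s t = 0 \<longrightarrow> (\<exists>r\<in>R. peq t r))" if "nz s" for s
    using line[OF that] hom_eval_finite_zeros[OF dsa[of s]] hom_eval_finite_zeros[OF dsb[of s]] unfolding ha hb by metis
  then obtain R where R: "\<And>s. nz s \<Longrightarrow> finite (R s)" "\<And>s r. nz s \<Longrightarrow> r \<in> R s \<Longrightarrow> nz r"
      "\<And>s t. nz s \<Longrightarrow> nz t \<Longrightarrow> bihom_eval d e a s t = 0 \<Longrightarrow> bihom_eval d e b s t = 0 \<Longrightarrow> \<exists>r\<in>R s. peq t r"
    by metis
  define Z where "Z = (\<Union>s\<in>S. {s} \<times> R s)"
  have "finite Z" unfolding Z_def using finS nzS R(1) by auto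
  moreover have "\<exists>(s', t')\<in>Z. nz s' \<and> nz t' \<and> peq s s' \<and> peq t t'"
    if st: "nz s" "nz t" and z: "bihom_eval d e a s t = 0" "bihom_eval d e b s t = 0" for s t
  proof -
    have "\<exists>s'\<in>S. peq s s'"
    proof (cases "snd s = 0")
      case True
      then show ?thesis by (auto simp: S_def peq_def)
    next
      case False
      define x where "x = fst s / snd s"
      have ps: "peq s (x, 1)" using False by (simp add: x_def peq_def)
      obtain k where k: "k \<noteq> 0" "s = (k * x, k)" using False by (intro that[of "snd s"]) (auto simp: x_def prod_eq_iff)
      have zx: "bihom_eval d e a (x, 1) t = 0" "bihom_eval d e b (x, 1) t = 0"
        using z k bihom_eval_scale1[of d e _ k x 1 t] by auto
      have "x \<in> S0"
      proof (cases "snd t = 0")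
        case True
        then have t: "t = (fst t, 0)" "fst t \<noteq> 0" using st(2) by (auto simp: nz_def prod_eq_iff)
        have "hom_eval d (coeff a e) (x, 1) = 0" "hom_eval d (coeff b e) (x, 1) = 0"
          using zx hom_eval_infinity[of e _ "fst t"] t unfolding bihom_eval_def by (auto simp: coeff_hom_eval_map)
        then show ?thesis using a b by (simp add: S0_def bideg_def hom_eval_affine)
      next
        case False
        obtain m y where m: "m \<noteq> 0" "t = (m * y, m)" using False
          by (intro that[of "snd t" "fst t / snd t"]) (auto simp: prod_eq_iff)
        have "bihom_eval d e a (x, 1) (y, 1) = 0" "bihom_eval d e b (x, 1) (y, 1) = 0"
          using zx m bihom_eval_scale2[of d e _ "(x, 1)" m y 1] by auto
        then show ?thesis using c(2) by (simp add: S0_def bihom_eval_affine[OF a] bihom_eval_affine[OF b])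
      qed
      then show ?thesis using ps by (auto simp: S_def)
    qed
    then obtain s' where s': "s' \<in> S" "peq s s'" by blast
    obtain k where k: "k \<noteq> 0" "s' = (k * fst s, k * snd s)" using peq_scale[OF s'(2) st(1) nzS[OF s'(1)]] by blast
    have "bihom_eval d e a s' t = 0" "bihom_eval d e b s' t = 0" using z by (simp_all add: k bihom_eval_scale1)
    from R(3)[OF nzS[OF s'(1)] st(2) this] obtain r where r: "r \<in> R s'" "peq t r" by blast
    then have "(s', r) \<in> Z" using s' by (auto simp: Z_def)
    then show ?thesis using s' r nzS R(2) by blast
  qed
  ultimately show ?thesis using a b peqg by blast
qed

section \<open>Automorphisms of the product of two lines\<close>

lemma bin_form_0_const: "f \<in> bin_form 0 \<Longrightarrow> f s = f t"
  by (auto simp: bin_form_def hom_eval_def)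

lemma finite_affine_classes:
  fixes Z :: "('a \<times> 'k::field \<times> 'k) set"
  assumes "finite Z"
  shows "finite {c. \<exists>z\<in>Z. nz (snd z) \<and> peq (snd z) (c, 1)}"
proof (rule finite_subset)
  show "{c. \<exists>z\<in>Z. nz (snd z) \<and> peq (snd z) (c, 1)} \<subseteq> (\<lambda>z. fst (snd z) / snd (snd z)) ` Z"
  proof clarify
    fix c i u v assume z: "(i, u, v) \<in> Z" "nz (snd (i, u, v))" "peq (snd (i, u, v)) (c, 1)"
    then have "v \<noteq> 0" "c = u / v" by (auto simp: peq_def nz_def field_simps)
    then show "c \<in> (\<lambda>z. fst (snd z) / snd (snd z)) ` Z" using z(1) by force
  qed
qed (use assms in simp)

lemma ex_not_in_finite: "finite A \<Longrightarrow> \<exists>c::'k::field_char_0. c \<notin> A"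
  using infinite_UNIV_char_0 ex_new_if_finite by blast

text \<open>The maps \<open>x\<close> and \<open>y\<close> are the coordinates of the inverse of \<open>(g, h)\<close>, so that
  \<open>\<tau> \<mapsto> (x c \<tau>, y c \<tau>)\<close> parametrizes the fibre of \<open>g\<close> over \<open>c\<close>. If both \<open>d\<close> and \<open>e\<close> were positive, the
  degree on each fibre would be positive, as \<open>h\<close> separates the points of the fibre, and each fibre
  would contain one of the finitely many common zeros.\<close>

theorem bi_mor_one_variable:
  fixes g h x y :: "'k::{alg_closed_field, field_char_0} \<times> 'k \<Rightarrow> 'k \<times> 'k \<Rightarrow> 'k \<times> 'k"
  assumes g: "bi_mor g" and h: "bi_mor h"
    and x: "\<And>c. nz c \<Longrightarrow> line_mor (x c)" and y: "\<And>c. nz c \<Longrightarrow> line_mor (y c)"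
    and gxy: "\<And>c \<tau>. nz c \<Longrightarrow> nz \<tau> \<Longrightarrow> peq (g (x c \<tau>) (y c \<tau>)) c"
    and hxy: "\<And>c \<tau>. nz c \<Longrightarrow> nz \<tau> \<Longrightarrow> peq (h (x c \<tau>) (y c \<tau>)) \<tau>"
  shows "(\<forall>s t t'. nz s \<longrightarrow> nz t \<longrightarrow> nz t' \<longrightarrow> peq (g s t) (g s t')) \<or>
    (\<forall>s s' t. nz s \<longrightarrow> nz s' \<longrightarrow> nz t \<longrightarrow> peq (g s t) (g s' t))"
proof -
  obtain d e a b Z where all: "bideg d e a \<and> bideg d e b \<and>
    (\<forall>s t. nz s \<longrightarrow> nz t \<longrightarrow> peq (bihom_eval d e a s t, bihom_eval d e b s t) (g s t)) \<and>
    finite Z \<and> (\<forall>s t. nz s \<longrightarrow> nz t \<longrightarrow> bihom_eval d e a s t = 0 \<longrightarrow> bihom_eval d e b s t = 0 \<longrightarrow>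
       (\<exists>(s', t')\<in>Z. nz s' \<and> nz t' \<and> peq s s' \<and> peq t t'))"
    using bi_mor_min[OF g] by (elim exE)
  note a = all[THEN conjunct1] and b = all[THEN conjunct2, THEN conjunct1]
    and ab = all[THEN conjunct2, THEN conjunct2, THEN conjunct1, rule_format]
    and Z = all[THEN conjunct2, THEN conjunct2, THEN conjunct2, THEN conjunct1]
      all[THEN conjunct2, THEN conjunct2, THEN conjunct2, THEN conjunct2, rule_format]
  have nzx: "nz (x c \<tau>)" "nz (y c \<tau>)" if "nz c" "nz \<tau>" for c \<tau>
    using x[OF that(1)] y[OF that(1)] that(2) unfolding line_mor_def by blast+
  have curve: "(\<exists>(s', t')\<in>Z. nz s' \<and> nz t' \<and> peq (g s' t') c) \<or> d = 0 \<or> e = 0" if c: "nz c" for c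
  proof -
    obtain N x0 x1 where xs: "x0 \<in> bin_form N" "x1 \<in> bin_form N"
      "\<And>s. nz s \<Longrightarrow> nz (x0 s, x1 s) \<and> peq (x0 s, x1 s) (x c s)" using line_mor_global[OF x[OF c]] by blast
    obtain M y0 y1 where ys: "y0 \<in> bin_form M" "y1 \<in> bin_form M"
      "\<And>s. nz s \<Longrightarrow> nz (y0 s, y1 s) \<and> peq (y0 s, y1 s) (y c s)" using line_mor_global[OF y[OF c]] by blast
    show ?thesis
    proof (cases "d * N + e * M = 0")
      case False
      then have pos: "d * N + e * M > 0" by simp
      obtain \<tau> where \<tau>: "nz \<tau>" "bihom_eval d e b (x0 \<tau>, x1 \<tau>) (y0 \<tau>, y1 \<tau>) = 0"
        using bin_form_has_zero[OF bihom_eval_compose[OF xs(1,2) ys(1,2)] pos] by blast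
      have "\<exists>\<tau>. nz \<tau> \<and> bihom_eval d e a (x0 \<tau>, x1 \<tau>) (y0 \<tau>, y1 \<tau>) = 0 \<and> bihom_eval d e b (x0 \<tau>, x1 \<tau>) (y0 \<tau>, y1 \<tau>) = 0"
      proof -
        have pr: "bihom_eval d e a (x0 \<tau>, x1 \<tau>) (y0 \<tau>, y1 \<tau>) * snd c = bihom_eval d e b (x0 \<tau>, x1 \<tau>) (y0 \<tau>, y1 \<tau>) * fst c"
          if t: "nz \<tau>" for \<tau>
        proof -
          have n: "nz (x0 \<tau>, x1 \<tau>)" "nz (y0 \<tau>, y1 \<tau>)" using xs(3) ys(3) t by blast+
          have "peq (g (x0 \<tau>, x1 \<tau>) (y0 \<tau>, y1 \<tau>)) (g (x c \<tau>) (y c \<tau>))"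
            by (rule bi_mor_inv[OF g n nzx[OF c t]]) (use xs(3) ys(3) t in blast)+
          from peq_trans[OF this gxy[OF c t] bi_mor_nz[OF g nzx[OF c t]]]
          have "peq (g (x0 \<tau>, x1 \<tau>) (y0 \<tau>, y1 \<tau>)) c" .
          from peq_trans[OF ab[OF n] this bi_mor_nz[OF g n]] show ?thesis by (simp add: peq_def)
        qed
        show ?thesis
        proof (cases "snd c = 0")
          case False
          have "bihom_eval d e a (x0 \<tau>, x1 \<tau>) (y0 \<tau>, y1 \<tau>) = 0" using pr[OF \<tau>(1)] \<tau>(2) False by simp
          then show ?thesis using \<tau> by blast
        next
          case True
          obtain \<tau>' where \<tau>': "nz \<tau>'" "bihom_eval d e a (x0 \<tau>', x1 \<tau>') (y0 \<tau>', y1 \<tau>') = 0"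
            using bin_form_has_zero[OF bihom_eval_compose[OF xs(1,2) ys(1,2)] pos] by blast
          have "fst c \<noteq> 0" using True c by (auto simp: nz_def prod_eq_iff)
          then have "bihom_eval d e b (x0 \<tau>', x1 \<tau>') (y0 \<tau>', y1 \<tau>') = 0" using pr[OF \<tau>'(1)] \<tau>'(2) True by simp
          then show ?thesis using \<tau>' by blast
        qed
      qed
      then obtain \<tau> where t: "nz \<tau>" "bihom_eval d e a (x0 \<tau>, x1 \<tau>) (y0 \<tau>, y1 \<tau>) = 0"
        "bihom_eval d e b (x0 \<tau>, x1 \<tau>) (y0 \<tau>, y1 \<tau>) = 0" by blast
      have n: "nz (x0 \<tau>, x1 \<tau>)" "nz (y0 \<tau>, y1 \<tau>)" using xs(3) ys(3) t(1) by blast+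
      from Z(2)[OF n t(2,3)] obtain s' t' where z: "(s', t') \<in> Z" "nz s'" "nz t'"
        "peq (x0 \<tau>, x1 \<tau>) s'" "peq (y0 \<tau>, y1 \<tau>) t'" by blast
      have 1: "peq s' (x c \<tau>)" "peq t' (y c \<tau>)"
        using peq_trans[OF peq_sym[OF z(4)] _ n(1)] peq_trans[OF peq_sym[OF z(5)] _ n(2)] xs(3) ys(3) t(1) by blast+
      have "peq (g s' t') (g (x c \<tau>) (y c \<tau>))" by (rule bi_mor_inv[OF g z(2,3) nzx[OF c t(1)] 1])
      from peq_trans[OF this gxy[OF c t(1)] bi_mor_nz[OF g nzx[OF c t(1)]]]
      have "peq (g s' t') c" .
      then show ?thesis using z by blast
    next
      case True
      have "d = 0 \<or> e = 0"
      proof (rule ccontr)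
        assume "\<not> ?thesis"
        then have "N = 0" "M = 0" using True by auto
        let ?o = "(0, 1) :: 'k \<times> 'k" and ?i = "(1, 0) :: 'k \<times> 'k"
        have eq: "(x0 ?o, x1 ?o) = (x0 ?i, x1 ?i)" "(y0 ?o, y1 ?o) = (y0 ?i, y1 ?i)"
          using xs(1,2) ys(1,2) bin_form_0_const \<open>N = 0\<close> \<open>M = 0\<close> by blast+
        have n: "nz ?o" "nz ?i" by auto
        have "peq (x c ?o) (x c ?i)" "peq (y c ?o) (y c ?i)"
          using xs(3)[OF n(1)] xs(3)[OF n(2)] ys(3)[OF n(1)] ys(3)[OF n(2)] eq peq_trans peq_sym by metis+
        then have "peq (h (x c ?o) (y c ?o)) (h (x c ?i) (y c ?i))"
          by (intro bi_mor_inv[OF h] nzx c n)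
        from peq_trans[OF this hxy[OF c n(2)] bi_mor_nz[OF h nzx[OF c n(2)]]]
        have "peq (h (x c ?o) (y c ?o)) ?i" .
        from peq_trans[OF peq_sym[OF hxy[OF c n(1)]] this bi_mor_nz[OF h nzx[OF c n(1)]]]
        show False by (simp add: peq_def)
      qed
      then show ?thesis by blast
    qed
  qed
  have de: "d = 0 \<or> e = 0"
  proof -
    define Z' where "Z' = (\<lambda>(s, t). ((s, t), g s t)) ` (Z \<inter> {(s, t). nz s \<and> nz t})"
    have "finite Z'" using Z(1) by (simp add: Z'_def)
    from ex_not_in_finite[OF finite_affine_classes[OF this]]
    obtain c where c: "\<not> (\<exists>z\<in>Z'. nz (snd z) \<and> peq (snd z) (c, 1))" by blast
    have "\<not> (\<exists>(s', t')\<in>Z. nz s' \<and> nz t' \<and> peq (g s' t') (c, 1))"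
    proof
      assume "\<exists>(s', t')\<in>Z. nz s' \<and> nz t' \<and> peq (g s' t') (c, 1)"
      then obtain s' t' where z: "(s', t') \<in> Z" "nz s'" "nz t'" "peq (g s' t') (c, 1)" by blast
      then have "((s', t'), g s' t') \<in> Z'" by (force simp: Z'_def)
      then show False using c z bi_mor_nz[OF g z(2,3)] by force
    qed
    with curve[of "(c, 1)"] show ?thesis by simp
  qed
  have vn: "nz (bihom_eval d e a s t, bihom_eval d e b s t)" if const: "e = 0" "nz s" "nz t" for s t
  proof (rule ccontr)
    assume z: "\<not> ?thesis"
    have eq: "bihom_eval d e f s t' = bihom_eval d e f s t" if "bideg d e f" for f t'
      using bin_form_0_const[of "\<lambda>t. bihom_eval d e f s t" t' t] bihom_eval_bin_form2[OF that, of s] const(1) by simp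
    from ex_not_in_finite[OF finite_affine_classes[OF Z(1)]]
    obtain c where c: "\<not> (\<exists>z\<in>Z. nz (snd z) \<and> peq (snd z) (c, 1))" by blast
    from Z(2)[OF const(2) nz_affine(1)[of c]] z obtain s' t' where w: "(s', t') \<in> Z" "nz t'" "peq (c, 1) t'"
      using eq[OF a] eq[OF b] by (auto simp: nz_def)
    then have "\<exists>z\<in>Z. nz (snd z) \<and> peq (snd z) (c, 1)"
      by (intro bexI[OF _ w(1)]) (simp add: peq_sym)
    then show False using c by blast
  qed
  have vn': "nz (bihom_eval d e a s t, bihom_eval d e b s t)" if const: "d = 0" "nz s" "nz t" for s t
  proof (rule ccontr)
    assume z: "\<not> ?thesis"
    have eq: "bihom_eval d e f s' t = bihom_eval d e f s t" if "bideg d e f" for f s'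
      using bin_form_0_const[of "\<lambda>s. bihom_eval d e f s t" s' s] bihom_eval_bin_form1[OF that, of t] const(1) by simp
    have "finite ((\<lambda>(s, t). (t, s)) ` Z)" using Z(1) by simp
    from ex_not_in_finite[OF finite_affine_classes[OF this]]
    obtain c where c: "\<not> (\<exists>z\<in>(\<lambda>(s, t). (t, s)) ` Z. nz (snd z) \<and> peq (snd z) (c, 1))" by blast
    from Z(2)[OF nz_affine(1)[of c] const(3)] z obtain s' t' where w: "(s', t') \<in> Z" "nz s'" "peq (c, 1) s'"
      using eq[OF a] eq[OF b] by (auto simp: nz_def)
    then have "(t', s') \<in> (\<lambda>(s, t). (t, s)) ` Z" by force
    then have "\<exists>z\<in>(\<lambda>(s, t). (t, s)) ` Z. nz (snd z) \<and> peq (snd z) (c, 1)"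
      by (rule bexI[rotated]) (use w in \<open>simp add: peq_sym\<close>)
    then show False using c by blast
  qed
  from de show ?thesis
  proof
    assume e0: "e = 0"
    have "peq (g s t) (g s t')" if n: "nz s" "nz t" "nz t'" for s t t'
    proof -
      have eq: "bihom_eval d e f s t' = bihom_eval d e f s t" if "bideg d e f" for f
        using bin_form_0_const[of "\<lambda>t. bihom_eval d e f s t" t' t] bihom_eval_bin_form2[OF that, of s] e0 by simp
      from peq_trans[OF peq_sym[OF ab[OF n(1,2)]] _ vn[OF e0 n(1,2)]] ab[OF n(1,3)] show ?thesis
        by (simp add: eq[OF a] eq[OF b])
    qed
    then show ?thesis by blast
  next
    assume d0: "d = 0"
    have "peq (g s t) (g s' t)" if n: "nz s" "nz s'" "nz t" for s s' t
    proof -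
      have eq: "bihom_eval d e f s' t = bihom_eval d e f s t" if "bideg d e f" for f
        using bin_form_0_const[of "\<lambda>s. bihom_eval d e f s t" s' s] bihom_eval_bin_form1[OF that, of t] d0 by simp
      from peq_trans[OF peq_sym[OF ab[OF n(1,3)]] _ vn'[OF d0 n(1,3)]] ab[OF n(2,3)] show ?thesis
        by (simp add: eq[OF a] eq[OF b])
    qed
    then show ?thesis by blast
  qed
qed

lemma hom_eval_1: "hom_eval (Suc 0) p s = coeff p 0 * snd s + coeff p 1 * fst s"
  by (simp add: hom_eval_def)

text \<open>Degrees multiply under composition and the identity has degree one, so a morphism with a
  right inverse is linear. Fixing three points makes it the identity.\<close>

lemma line_mor_moebius:
  fixes f f' :: "'k::{alg_closed_field, field_char_0} \<times> 'k \<Rightarrow> 'k \<times> 'k"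
  assumes f: "line_mor f" and f': "line_mor f'"
    and ff': "\<And>s. nz s \<Longrightarrow> peq (f (f' s)) s"
    and fix0: "peq (f (0, 1)) (0, 1)" and fixi: "peq (f (1, 0)) (1, 0)" and fix1: "peq (f (1, 1)) (1, 1)"
    and s: "nz s"
  shows "peq (f s) s"
proof -
  have nzf: "nz (f s)" if "nz s" for s using f that unfolding line_mor_def by blast
  have nzf': "nz (f' s)" if "nz s" for s using f' that unfolding line_mor_def by blast
  obtain N p q where p: "degree p \<le> N" and q: "degree q \<le> N"
    and pq: "\<And>s. nz s \<Longrightarrow> nz (hom_eval N p s, hom_eval N q s) \<and> peq (hom_eval N p s, hom_eval N q s) (f s)"
    using line_mor_global[OF f] unfolding bin_form_def by blast
  obtain N' x y where x: "x \<in> bin_form N'" and y: "y \<in> bin_form N'"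
    and xy: "\<And>s. nz s \<Longrightarrow> nz (x s, y s) \<and> peq (x s, y s) (f' s)"
    using line_mor_global[OF f'] by blast
  define M where "M = N * N'"
  obtain P where P: "degree P \<le> M" "\<And>s. hom_eval N p (x s, y s) = hom_eval M P s"
    using bin_form_compose[OF x y, of N p] unfolding bin_form_def M_def by (auto dest: fun_cong)
  obtain Q where Q: "degree Q \<le> M" "\<And>s. hom_eval N q (x s, y s) = hom_eval M Q s"
    using bin_form_compose[OF x y, of N q] unfolding bin_form_def M_def by (auto dest: fun_cong)
  have nPQ: "nz (hom_eval M P s, hom_eval M Q s)" and ePQ: "hom_eval M P s * snd s = hom_eval M Q s * fst s" if s: "nz s" for s
  proof -
    have u: "nz (x s, y s)" "peq (x s, y s) (f' s)" using xy s by blast+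
    show n: "nz (hom_eval M P s, hom_eval M Q s)" using pq[OF u(1)] P(2) Q(2) by simp
    obtain k where k: "k \<noteq> 0" "f' s = (k * x s, k * y s)" using peq_scale[OF u(2,1) nzf'[OF s]] by auto
    have "peq (hom_eval N p (f' s), hom_eval N q (f' s)) (f (f' s))" using pq nzf'[OF s] by blast
    then have "peq (hom_eval N p (f' s), hom_eval N q (f' s)) s"
      using peq_trans ff'[OF s] nzf[OF nzf'[OF s]] by blast
    then have "k ^ N * (hom_eval M P s * snd s) = k ^ N * (hom_eval M Q s * fst s)"
      by (simp add: peq_def k(2) hom_eval_scale P(2) Q(2) mult.assoc)
    then show "hom_eval M P s * snd s = hom_eval M Q s * fst s" using k(1) by simp
  qed
  have PQ: "P = [:0, 1:] * Q"
  proof (rule poly_eqI')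
    fix z show "poly P z = poly ([:0, 1:] * Q) z"
      using ePQ[of "(z, 1)"] hom_eval_affine[OF P(1), of z] hom_eval_affine[OF Q(1), of z] by simp
  qed
  \<comment> \<open>The value at infinity: one degree is lost, and a zero of what remains is a common zero of the pair.\<close>
  have cQ: "coeff Q M = 0" using ePQ[of "(1, 0)"] hom_eval_infinity[of M Q 1] by simp
  have "M = 1"
  proof (rule ccontr)
    assume "M \<noteq> 1"
    have M0: "M \<noteq> 0"
    proof
      assume "M = 0"
      then have "Q = 0" using cQ Q(1) by (metis le_zero_eq leading_coeff_0_iff)
      then show False using nPQ[of "(0, 1)"] PQ by (simp add: nz_def)
    qed
    have dQ: "degree Q \<le> M - 1"
    proof (cases "Q = 0")
      case False
      then have "degree Q \<noteq> M" using cQ by auto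
      then show ?thesis using Q(1) by simp
    qed simp
    obtain t where t: "nz t" "hom_eval (M - 1) Q t = 0" using hom_eval_has_zero[OF dQ] M0 \<open>M \<noteq> 1\<close> by auto
    have M1: "1 + (M - 1) = M" using M0 by simp
    have "hom_eval M Q t = 0"
      using hom_eval_mult[of 1 1 Q "M - 1" t] dQ t(2) unfolding M1 by simp
    moreover have "hom_eval M P t = 0"
      using hom_eval_mult[of "[:0, 1:]" 1 Q "M - 1" t] dQ t(2) unfolding M1 PQ by simp
    ultimately show False using nPQ[OF t(1)] by (simp add: nz_def)
  qed
  then have N: "N = Suc 0" by (simp add: M_def)
  have "coeff p 0 = 0"
  proof -
    have "peq (hom_eval N p (0, 1), hom_eval N q (0, 1)) (0, 1)"
      using peq_trans[OF _ fix0 nzf] pq[of "(0, 1)"] by simp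
    then show ?thesis by (simp add: peq_def N hom_eval_1)
  qed
  moreover have "coeff q 1 = 0"
  proof -
    have "peq (hom_eval N p (1, 0), hom_eval N q (1, 0)) (1, 0)"
      using peq_trans[OF _ fixi nzf] pq[of "(1, 0)"] by simp
    then show ?thesis by (simp add: peq_def N hom_eval_1)
  qed
  moreover have "coeff p 0 + coeff p 1 = coeff q 0 + coeff q 1"
  proof -
    have "peq (hom_eval N p (1, 1), hom_eval N q (1, 1)) (1, 1)"
      using peq_trans[OF _ fix1 nzf] pq[of "(1, 1)"] by simp
    then show ?thesis by (simp add: peq_def N hom_eval_1)
  qed
  ultimately have "hom_eval N p s = coeff p 1 * fst s" "hom_eval N q s = coeff p 1 * snd s"
    by (simp_all add: N hom_eval_1)
  then have v: "peq (hom_eval N p s, hom_eval N q s) s" by (simp add: peq_def mult_ac)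
  from peq_trans[OF peq_sym[OF conjunct2[OF pq[OF s]]] this conjunct1[OF pq[OF s]]] show ?thesis .
qed

text \<open>Each of \<open>g\<close> and \<open>h\<close> depends on one variable only and then equals that variable by
  \<open>line_mor_moebius\<close>. They cannot be the same variable, as \<open>(g, h)\<close> is surjective.\<close>

theorem automorphism_fixing_three_points:
  fixes g h x y :: "'k::{alg_closed_field, field_char_0} \<times> 'k \<Rightarrow> 'k \<times> 'k \<Rightarrow> 'k \<times> 'k"
  assumes g: "bi_mor g" and h: "bi_mor h" and x: "bi_mor x" and y: "bi_mor y"
    and gxy: "\<And>c \<tau>. nz c \<Longrightarrow> nz \<tau> \<Longrightarrow> peq (g (x c \<tau>) (y c \<tau>)) c"
    and hxy: "\<And>c \<tau>. nz c \<Longrightarrow> nz \<tau> \<Longrightarrow> peq (h (x c \<tau>) (y c \<tau>)) \<tau>"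
    and fixg: "\<And>r. r \<in> {(0, 1), (1, 0), (1, 1)} \<Longrightarrow> peq (g r r) r"
    and fixh: "\<And>r. r \<in> {(0, 1), (1, 0), (1, 1)} \<Longrightarrow> peq (h r r) r"
  shows "(\<forall>s t. nz s \<longrightarrow> nz t \<longrightarrow> peq (g s t) s \<and> peq (h s t) t) \<or>
    (\<forall>s t. nz s \<longrightarrow> nz t \<longrightarrow> peq (g s t) t \<and> peq (h s t) s)"
proof -
  let ?o = "(0, 1) :: 'k \<times> 'k"
  have o: "nz ?o" by simp
  have nx: "nz (x c \<tau>)" "nz (y c \<tau>)" if "nz c" "nz \<tau>" for c \<tau>
    using bi_mor_nz[OF x that] bi_mor_nz[OF y that] .
  \<comment> \<open>Freezing the irrelevant variable gives a self-map of the line with a right inverse. The inverse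
    may freeze the fibre coordinate differently for each \<open>c\<close>, hence the existential quantifier.\<close>
  have dep1: "peq (k s t) s"
    if k: "bi_mor k" and d: "\<And>s t t'. nz s \<Longrightarrow> nz t \<Longrightarrow> nz t' \<Longrightarrow> peq (k s t) (k s t')"
      and m: "line_mor f'" and inv: "\<And>c. nz c \<Longrightarrow> \<exists>t. nz t \<and> peq (k (f' c) t) c"
      and fk: "\<And>r. r \<in> {(0, 1), (1, 0), (1, 1)} \<Longrightarrow> peq (k r r) r" and st: "nz s" "nz t"
    for k :: "'k \<times> 'k \<Rightarrow> 'k \<times> 'k \<Rightarrow> 'k \<times> 'k" and f' :: "'k \<times> 'k \<Rightarrow> 'k \<times> 'k" and s t
  proof -
    have nf': "nz (f' c)" if "nz c" for c using m that unfolding line_mor_def by blast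
    have fr: "peq (k r ?o) r" if r: "r \<in> {(0, 1), (1, 0), (1, 1)}" for r
    proof -
      have "nz r" using r by (auto simp: nz_def)
      then show ?thesis using peq_trans[OF d[of r ?o r] fk[OF r] bi_mor_nz[OF k]] by simp
    qed
    have "peq (k s ?o) s"
    proof (rule line_mor_moebius[OF bi_mor_slot1[OF k o] m])
      fix c :: "'k \<times> 'k" assume c: "nz c"
      obtain t where t: "nz t" "peq (k (f' c) t) c" using inv[OF c] by blast
      show "peq (k (f' c) ?o) c"
        using peq_trans[OF d[OF nf'[OF c] o t(1)] t(2) bi_mor_nz[OF k nf'[OF c] t(1)]] .
    qed (use fr st in auto)
    then show ?thesis using peq_trans[OF d[OF st(1,2) o] _ bi_mor_nz[OF k st(1) o]] by blast
  qed
  have dep2: "peq (k s t) t"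
    if k: "bi_mor k" and d: "\<And>s s' t. nz s \<Longrightarrow> nz s' \<Longrightarrow> nz t \<Longrightarrow> peq (k s t) (k s' t)"
      and m: "line_mor f'" and inv: "\<And>c. nz c \<Longrightarrow> \<exists>s. nz s \<and> peq (k s (f' c)) c"
      and fk: "\<And>r. r \<in> {(0, 1), (1, 0), (1, 1)} \<Longrightarrow> peq (k r r) r" and st: "nz s" "nz t"
    for k :: "'k \<times> 'k \<Rightarrow> 'k \<times> 'k \<Rightarrow> 'k \<times> 'k" and f' :: "'k \<times> 'k \<Rightarrow> 'k \<times> 'k" and s t
  proof -
    have nf': "nz (f' c)" if "nz c" for c using m that unfolding line_mor_def by blast
    have fr: "peq (k ?o r) r" if r: "r \<in> {(0, 1), (1, 0), (1, 1)}" for r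
    proof -
      have "nz r" using r by (auto simp: nz_def)
      then show ?thesis using peq_trans[OF d[of ?o r r] fk[OF r] bi_mor_nz[OF k]] by simp
    qed
    have "peq (k ?o t) t"
    proof (rule line_mor_moebius[OF bi_mor_slot2[OF k o] m])
      fix c :: "'k \<times> 'k" assume c: "nz c"
      obtain s where s: "nz s" "peq (k s (f' c)) c" using inv[OF c] by blast
      show "peq (k ?o (f' c)) c"
        using peq_trans[OF d[OF o s(1) nf'[OF c]] s(2) bi_mor_nz[OF k s(1) nf'[OF c]]] .
    qed (use fr st in auto)
    then show ?thesis using peq_trans[OF d[OF st(1) o st(2)] _ bi_mor_nz[OF k o st(2)]] by blast
  qed
  let ?D1 = "\<lambda>k. (\<forall>s t t'. nz s \<longrightarrow> nz t \<longrightarrow> nz t' \<longrightarrow> peq (k s t) (k s t'))"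
  let ?D2 = "\<lambda>k. (\<forall>s s' t. nz s \<longrightarrow> nz s' \<longrightarrow> nz t \<longrightarrow> peq (k s t) (k s' t))"
  have G: "?D1 g \<or> ?D2 g"
    by (rule bi_mor_one_variable[OF g h bi_mor_slot2[OF x] bi_mor_slot2[OF y] gxy hxy])
  have H: "?D1 h \<or> ?D2 h"
    by (rule bi_mor_one_variable[OF h g bi_mor_slot1[OF x] bi_mor_slot1[OF y] hxy gxy])
  have g1: "peq (g s t) s" if D: "?D1 g" and st: "nz s" "nz t" for s t
  proof (rule dep1[OF g D[rule_format] bi_mor_slot1[OF x o] _ fixg st])
    fix c :: "'k \<times> 'k" assume c: "nz c"
    show "\<exists>t. nz t \<and> peq (g (x c ?o) t) c" using gxy[OF c o] nx(2)[OF c o] by blast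
  qed
  have g2: "peq (g s t) t" if D: "?D2 g" and st: "nz s" "nz t" for s t
  proof (rule dep2[OF g D[rule_format] bi_mor_slot1[OF y o] _ fixg st])
    fix c :: "'k \<times> 'k" assume c: "nz c"
    show "\<exists>s. nz s \<and> peq (g s (y c ?o)) c" using gxy[OF c o] nx(1)[OF c o] by blast
  qed
  have h1: "peq (h s t) s" if D: "?D1 h" and st: "nz s" "nz t" for s t
  proof (rule dep1[OF h D[rule_format] bi_mor_slot2[OF x o] _ fixh st])
    fix c :: "'k \<times> 'k" assume c: "nz c"
    show "\<exists>t. nz t \<and> peq (h (x ?o c) t) c" using hxy[OF o c] nx(2)[OF o c] by blast
  qed
  have h2: "peq (h s t) t" if D: "?D2 h" and st: "nz s" "nz t" for s t
  proof (rule dep2[OF h D[rule_format] bi_mor_slot2[OF y o] _ fixh st])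
    fix c :: "'k \<times> 'k" assume c: "nz c"
    show "\<exists>s. nz s \<and> peq (h s (y ?o c)) c" using hxy[OF o c] nx(1)[OF o c] by blast
  qed
  let ?i = "(1, 0) :: 'k \<times> 'k"
  have i: "nz ?i" by simp
  have ne: "\<not> peq ?o ?i" by (simp add: peq_def)
  have n: "nz (x ?o ?i)" "nz (y ?o ?i)" using nx[OF o i] .
  have e: "peq ?o (g (x ?o ?i) (y ?o ?i))" "peq (h (x ?o ?i) (y ?o ?i)) ?i"
    using peq_sym[OF gxy[OF o i]] hxy[OF o i] by blast+
  have nn: "nz (g (x ?o ?i) (y ?o ?i))" "nz (h (x ?o ?i) (y ?o ?i))" using bi_mor_nz g h n by blast+
  have n1: "\<not> (?D1 g \<and> ?D1 h)"
  proof
    assume "?D1 g \<and> ?D1 h"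
    then have d: "?D1 g" "?D1 h" by (rule conjunct1, rule conjunct2)
    from peq_trans[OF peq_trans[OF peq_trans[OF e(1) g1[OF d(1) n] nn(1)] peq_sym[OF h1[OF d(2) n]] n(1)] e(2) nn(2)]
    have "peq ?o ?i" .
    then show False using ne by blast
  qed
  have n2: "\<not> (?D2 g \<and> ?D2 h)"
  proof
    assume "?D2 g \<and> ?D2 h"
    then have d: "?D2 g" "?D2 h" by (rule conjunct1, rule conjunct2)
    from peq_trans[OF peq_trans[OF peq_trans[OF e(1) g2[OF d(1) n] nn(1)] peq_sym[OF h2[OF d(2) n]] n(2)] e(2) nn(2)]
    have "peq ?o ?i" .
    then show False using ne by blast
  qed
  have taut: "(A \<and> D) \<or> (B \<and> C)" if "A \<or> B" "C \<or> D" "\<not> (A \<and> C)" "\<not> (B \<and> D)" for A B C D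
    using that by blast
  from taut[OF G H n1 n2] show ?thesis
  proof
    assume d: "?D1 g \<and> ?D2 h"
    have "peq (g s t) s \<and> peq (h s t) t" if "nz s" "nz t" for s t
      using g1[OF conjunct1[OF d] that] h2[OF conjunct2[OF d] that] by (rule conjI)
    then show ?thesis by simp
  next
    assume d: "?D2 g \<and> ?D1 h"
    have "peq (g s t) t \<and> peq (h s t) s" if "nz s" "nz t" for s t
      using g2[OF conjunct1[OF d] that] h1[OF conjunct2[OF d] that] by (rule conjI)
    then show ?thesis by simp
  qed
qed

section \<open>Segre coordinates\<close>

definition segre_vec :: "'k::field \<times> 'k \<Rightarrow> 'k \<times> 'k \<Rightarrow> nat \<Rightarrow> 'k" where
  "segre_vec s t = (\<lambda>l. if l \<le> 3 then (if l div 2 = 0 then fst s else snd s) * (if l mod 2 = 0 then fst t else snd t) else 0)"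

definition segre :: "'k::field \<times> 'k \<Rightarrow> 'k \<times> 'k \<Rightarrow> (nat \<Rightarrow> 'k) set" where
  "segre s t = pt (segre_vec s t)"

lemma segre_vec_simps [simp]:
  "segre_vec s t 0 = fst s * fst t" "segre_vec s t (Suc 0) = fst s * snd t"
  "segre_vec s t 2 = snd s * fst t" "segre_vec s t 3 = snd s * snd t" "l > 3 \<Longrightarrow> segre_vec s t l = 0"
  by (simp_all add: segre_vec_def)

lemma le3_cases: "l \<le> 3 \<Longrightarrow> l = 0 \<or> l = Suc 0 \<or> l = 2 \<or> l = (3::nat)" by auto

lemma segre_vec_nonzero:
  assumes "nz s" "nz t" shows "\<exists>l\<le>3. segre_vec s t l \<noteq> 0"
proof -
  have "(fst s \<noteq> 0 \<or> snd s \<noteq> 0) \<and> (fst t \<noteq> 0 \<or> snd t \<noteq> 0)"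
    using assms by (auto simp: nz_def prod_eq_iff)
  then have "segre_vec s t 0 \<noteq> 0 \<or> segre_vec s t (Suc 0) \<noteq> 0 \<or> segre_vec s t 2 \<noteq> 0 \<or> segre_vec s t 3 \<noteq> 0" by auto
  then show ?thesis
  proof (elim disjE)
    assume "segre_vec s t 0 \<noteq> 0" then show ?thesis by (intro exI[of _ 0] conjI) simp_all
  next
    assume "segre_vec s t (Suc 0) \<noteq> 0" then show ?thesis by (intro exI[of _ "Suc 0"] conjI) simp_all
  next
    assume "segre_vec s t 2 \<noteq> 0" then show ?thesis by (intro exI[of _ 2] conjI) simp_all
  next
    assume "segre_vec s t 3 \<noteq> 0" then show ?thesis by (intro exI[of _ 3] conjI) simp_all
  qed
qed

lemma segre_vec_coord_vecs: "nz s \<Longrightarrow> nz t \<Longrightarrow> segre_vec s t \<in> coord_vecs 3"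
  using segre_vec_nonzero[of s t] by (auto simp: coord_vecs_def)

lemma segre_in: "nz s \<Longrightarrow> nz t \<Longrightarrow> segre s t \<in> P1xP1"
proof -
  assume n: "nz s" "nz t"
  define cv where "cv p = (\<lambda>i::nat. if i = 0 then fst p else if i = 1 then snd p else 0)" for p :: "'a \<times> 'a"
  have "cv p \<in> coord_vecs 1" if "nz p" for p
    using that by (auto simp: coord_vecs_def cv_def nz_def prod_eq_iff intro: exI[of _ 0] exI[of _ 1])
  moreover have "segre_vec s t = (\<lambda>l. if l \<le> 3 then cv s (l div 2) * cv t (l mod 2) else 0)"
  proof
    fix l show "segre_vec s t l = (if l \<le> 3 then cv s (l div 2) * cv t (l mod 2) else 0)"
      by (cases "l \<le> 3") (auto simp: segre_vec_def cv_def)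
  qed
  ultimately show ?thesis unfolding P1xP1_def segre_def
    by (intro CollectI exI[of _ "cv s"] exI[of _ "cv t"]) (use n in simp)
qed

lemma P1xP1_segre:
  assumes "P \<in> P1xP1"
  shows "\<exists>s t. nz s \<and> nz t \<and> P = segre s t"
proof -
  obtain s t where st: "s \<in> coord_vecs 1" "t \<in> coord_vecs 1"
    "P = pt (\<lambda>l. if l \<le> 3 then s (l div 2) * t (l mod 2) else 0)" using assms unfolding P1xP1_def by blast
  have nzc: "nz (x 0, x 1)" if xc: "x \<in> coord_vecs 1" for x :: "nat \<Rightarrow> 'a"
  proof -
    obtain i where "i \<le> 1" "x i \<noteq> 0" 
      using xc[unfolded coord_vecs_def, THEN CollectD, THEN conjunct2] by (elim exE conjE)
    then have "i = 0 \<or> i = 1" by auto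
    then show ?thesis using \<open>x i \<noteq> 0\<close> by (auto simp: nz_def)
  qed
  have "(\<lambda>l. if l \<le> 3 then s (l div 2) * t (l mod 2) else 0) = segre_vec (s 0, s 1) (t 0, t 1)"
  proof
    fix l :: nat
    show "(if l \<le> 3 then s (l div 2) * t (l mod 2) else 0) = segre_vec (s 0, s 1) (t 0, t 1) l"
    proof (cases "l \<le> 3")
      case True
      have "l div 2 = 0 \<or> l div 2 = 1" using True by arith
      moreover have "l mod 2 = 0 \<or> l mod 2 = 1" by arith
      ultimately show ?thesis using True by (auto simp: segre_vec_def)
    qed simp
  qed
  then have "P = segre (s 0, s 1) (t 0, t 1)" using st(3) by (simp only: segre_def)
  then show ?thesis using st(1,2) nzc by blast
qed

lemma P1xP1_subset: "P1xP1 \<subseteq> proj_space 3"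
  using P1xP1_segre segre_vec_coord_vecs pt_in_proj_space unfolding segre_def by blast

lemma segre_eq_iff:
  assumes n: "nz s" "nz t" "nz s'" "nz t'"
  shows "segre s t = segre s' t' \<longleftrightarrow> peq s s' \<and> peq t t'"
proof
  assume "segre s t = segre s' t'"
  then obtain c where c: "c \<noteq> 0" "segre_vec s' t' = (\<lambda>i. c * segre_vec s t i)" unfolding segre_def pt_eq_iff by blast
  obtain a0 a1 b0 b1 p0 p1 q0 q1 where st: "s = (a0, a1)" "t = (b0, b1)" "s' = (p0, p1)" "t' = (q0, q1)"
    by (cases s, cases t, cases s', cases t')
  have e: "p0 * q0 = c * (a0 * b0)" "p0 * q1 = c * (a0 * b1)" "p1 * q0 = c * (a1 * b0)" "p1 * q1 = c * (a1 * b1)"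
    using fun_cong[OF c(2), of 0] fun_cong[OF c(2), of "Suc 0"] fun_cong[OF c(2), of 2] fun_cong[OF c(2), of 3]
    by (simp_all add: st)
  have "(a0 * p1) * q0 = (a1 * p0) * q0" "(a0 * p1) * q1 = (a1 * p0) * q1"
    using e by (simp_all add: mult.assoc mult.left_commute)
  then have 1: "a0 * p1 = a1 * p0" using n(4) by (auto simp: st nz_def)
  have "(b0 * q1) * p0 = (b1 * q0) * p0" "(b0 * q1) * p1 = (b1 * q0) * p1"
    using e by (simp_all add: mult.assoc mult.commute mult.left_commute)
  then have 2: "b0 * q1 = b1 * q0" using n(3) by (auto simp: st nz_def)
  show "peq s s' \<and> peq t t'" using 1 2 by (simp add: st peq_def)
next
  assume a: "peq s s' \<and> peq t t'"
  obtain c where c: "c \<noteq> 0" "s' = (c * fst s, c * snd s)" using peq_scale[OF _ n(1,3)] a by blast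
  obtain d where d: "d \<noteq> 0" "t' = (d * fst t, d * snd t)" using peq_scale[OF _ n(2,4)] a by blast
  have "segre_vec s' t' = (\<lambda>i. (c * d) * segre_vec s t i)" by (auto simp: segre_vec_def c d mult_ac)
  then show "segre s t = segre s' t'" unfolding segre_def pt_eq_iff using c(1) d(1)
    by (intro exI[of _ "c * d"]) simp
qed

lemma hom_eval_monom: "i \<le> d \<Longrightarrow> hom_eval d (monom c i) s = c * fst s ^ i * snd s ^ (d - i)"
proof -
  assume i: "i \<le> d"
  have "hom_eval d (monom c i) s = (\<Sum>j\<le>d. if j = i then c * fst s ^ j * snd s ^ (d - j) else 0)"
    unfolding hom_eval_def by (rule sum.cong) auto
  then show ?thesis using i by simp
qed

lemma bihom_eval_monom:
  assumes "i \<le> d" "j \<le> e"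
  shows "bihom_eval d e (monom (monom c i) j) s t = c * (fst s ^ i * snd s ^ (d - i)) * (fst t ^ j * snd t ^ (e - j))"
proof -
  have "map_poly (\<lambda>p. hom_eval d p s) (monom (monom c i) j) = monom (hom_eval d (monom c i) s) j"
    by (rule map_poly_monom) simp
  then show ?thesis unfolding bihom_eval_def using assms by (simp add: hom_eval_monom mult_ac)
qed

text \<open>A form of degree \<open>D\<close> in the four Segre coordinates has bidegree \<open>(D, D)\<close> in the two pairs
  of coordinates.\<close>

lemma FF_segre:
  assumes "f \<in> FF 3 D"
  shows "\<exists>a. bideg D D a \<and> (\<forall>s t. f (segre_vec s t) = bihom_eval D D a s t)"
proof -
  obtain c where c: "f = (\<lambda>x. \<Sum>m\<in>expons 3 D. c m * mono_eval 3 m x)" using assms by (auto simp: formfun_def)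
  let ?L = Poly_Mapping.lookup
  define i where "i m = ?L m 0 + ?L m (Suc 0)" for m :: "nat \<Rightarrow>\<^sub>0 nat"
  define j where "j m = ?L m 0 + ?L m 2" for m :: "nat \<Rightarrow>\<^sub>0 nat"
  define a where "a = (\<Sum>m\<in>expons 3 D. monom (monom (c m) (i m)) (j m))"
  have at3: "{..3::nat} = {0, Suc 0, 2, 3}" by auto
  have tot: "?L m 0 + ?L m (Suc 0) + ?L m 2 + ?L m 3 = D" if "m \<in> expons 3 D" for m
    using that by (simp add: expons_def at3)
  have ij: "i m \<le> D" "j m \<le> D" "D - i m = ?L m 2 + ?L m 3" "D - j m = ?L m (Suc 0) + ?L m 3" if "m \<in> expons 3 D" for m
    using tot[OF that] by (auto simp: i_def j_def)
  have "mono_eval 3 m (segre_vec s t) = (fst s ^ i m * snd s ^ (D - i m)) * (fst t ^ j m * snd t ^ (D - j m))"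
    if "m \<in> expons 3 D" for m s t
    unfolding ij(3,4)[OF that] by (simp add: mono_eval_def at3 i_def j_def power_add power_mult_distrib mult_ac)
  note me = this
  have "f (segre_vec s t) = bihom_eval D D a s t" for s t
    unfolding c a_def bihom_eval_sum by (rule sum.cong[OF refl]) (simp add: bihom_eval_monom ij(1,2) me mult.assoc)
  moreover have "bideg D D a"
    unfolding bideg_def
  proof (intro conjI allI)
    show "degree a \<le> D" unfolding a_def
      by (intro degree_sum_le) (auto intro: finite_expons order_trans[OF degree_monom_le] ij)
    fix k
    have "degree (coeff (monom (monom (c m) (i m)) (j m)) k) \<le> D" if "m \<in> expons 3 D" for m
      using order_trans[OF degree_monom_le ij(1)[OF that]] by auto
    then show "degree (coeff a k) \<le> D" unfolding a_def coeff_sum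
      by (intro degree_sum_le) (auto intro: finite_expons)
  qed
  ultimately show ?thesis by blast
qed

text \<open>The Segre coordinates of a point are the products \<open>s i * t j\<close>. Hence \<open>s\<close> is proportional
  to the coordinates 0 and 2 and to the coordinates 1 and 3, and \<open>t\<close> to 0 and 1 and to 2 and 3. In
  each case one of the two pairs is nonzero.\<close>

lemma segre_morphism_coordinates:
  fixes \<alpha> :: "(nat \<Rightarrow> 'k::field) set \<Rightarrow> (nat \<Rightarrow> 'k) set"
  assumes \<alpha>: "is_morphism UNIV 3 P1xP1 3 P1xP1 \<alpha>"
  shows "\<exists>g h. bi_mor g \<and> bi_mor h \<and> (\<forall>s t. nz s \<longrightarrow> nz t \<longrightarrow> \<alpha> (segre s t) = segre (g s t) (h s t))"
proof -
  have "\<exists>u v. nz s \<longrightarrow> nz t \<longrightarrow> nz u \<and> nz v \<and> \<alpha> (segre s t) = segre u v" for s t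
  proof (cases "nz s \<and> nz t")
    case True
    then have "\<alpha> (segre s t) \<in> P1xP1" by (intro morphism_maps[OF \<alpha>] segre_in) auto
    from P1xP1_segre[OF this] show ?thesis by blast
  qed auto
  then obtain g h where gh: "\<And>s t. nz s \<Longrightarrow> nz t \<Longrightarrow> nz (g s t) \<and> nz (h s t) \<and> \<alpha> (segre s t) = segre (g s t) (h s t)"
    by metis
  have loc: "\<exists>D a. (\<forall>l\<le>3. bideg D D (a l)) \<and> (\<exists>l\<le>3. bihom_eval D D (a l) s t \<noteq> 0) \<and>
      (\<forall>s' t'. nz s' \<longrightarrow> nz t' \<longrightarrow> (\<exists>\<kappa>. \<forall>l\<le>3. bihom_eval D D (a l) s' t' = \<kappa> * segre_vec (g s' t') (h s' t') l))"
    if st: "nz s" "nz t" for s t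
  proof -
    obtain D f where f: "\<And>i. i \<le> 3 \<Longrightarrow> f i \<in> FF 3 D" "\<exists>i\<le>3. f i (segre_vec s t) \<noteq> 0"
      "\<And>y. pt y \<in> P1xP1 \<Longrightarrow> (\<exists>i\<le>3. f i y \<noteq> 0) \<Longrightarrow> \<alpha> (pt y) = pt (trunc 3 (\<lambda>i. f i y))"
      by (rule morphism_local[OF \<alpha> P1xP1_subset UNIV_I segre_in[OF st, unfolded segre_def]], rule that)
    have "\<forall>i. \<exists>a. i \<le> 3 \<longrightarrow> bideg D D a \<and> (\<forall>s t. f i (segre_vec s t) = bihom_eval D D a s t)"
      using FF_segre[OF f(1)] by blast
    then obtain a where a: "\<And>i. i \<le> 3 \<Longrightarrow> bideg D D (a i) \<and> (\<forall>s t. f i (segre_vec s t) = bihom_eval D D (a i) s t)"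
      by metis
    have "\<exists>\<kappa>. \<forall>l\<le>3. bihom_eval D D (a l) s' t' = \<kappa> * segre_vec (g s' t') (h s' t') l" if n: "nz s'" "nz t'" for s' t'
    proof (cases "\<exists>i\<le>3. f i (segre_vec s' t') \<noteq> 0")
      case True
      from f(3)[OF segre_in[OF n, unfolded segre_def] True]
      have "pt (segre_vec (g s' t') (h s' t')) = pt (trunc 3 (\<lambda>i. f i (segre_vec s' t')))"
        using gh[OF n] unfolding segre_def by simp
      then obtain c where c: "trunc 3 (\<lambda>i. f i (segre_vec s' t')) = (\<lambda>i. c * segre_vec (g s' t') (h s' t') i)"
        unfolding pt_eq_iff by blast
      have "bihom_eval D D (a l) s' t' = c * segre_vec (g s' t') (h s' t') l" if "l \<le> 3" for l
        using fun_cong[OF c, of l] a[OF that] that by (simp add: trunc_def)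
      then show ?thesis by blast
    next
      case False
      then have "bihom_eval D D (a l) s' t' = 0 * segre_vec (g s' t') (h s' t') l" if "l \<le> 3" for l
        using a[OF that, THEN conjunct2, rule_format, of s' t'] that by simp
      then show ?thesis by blast
    qed
    moreover have "\<exists>l\<le>3. bihom_eval D D (a l) s t \<noteq> 0" using a f(2) by metis
    ultimately show ?thesis using a by blast
  qed
  have rep: "\<exists>d a b. bideg d d a \<and> bideg d d b \<and> nz (bihom_eval d d a s t, bihom_eval d d b s t) \<and>
        (\<forall>s' t'. nz s' \<longrightarrow> nz t' \<longrightarrow> peq (bihom_eval d d a s' t', bihom_eval d d b s' t') (k s' t'))"
    if st: "nz s" "nz t" and le: "p \<le> 3" "q \<le> 3" "p' \<le> 3" "q' \<le> 3"
      and cov: "\<And>a. (\<exists>l\<le>3. a l \<noteq> (0::'k)) \<Longrightarrow> a p \<noteq> 0 \<or> a q \<noteq> 0 \<or> a p' \<noteq> 0 \<or> a q' \<noteq> 0"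
      and e: "\<And>s t. segre_vec (g s t) (h s t) p * snd (k s t) = segre_vec (g s t) (h s t) q * fst (k s t)"
        "\<And>s t. segre_vec (g s t) (h s t) p' * snd (k s t) = segre_vec (g s t) (h s t) q' * fst (k s t)"
    for s t p q p' q' and k :: "'k \<times> 'k \<Rightarrow> 'k \<times> 'k \<Rightarrow> 'k \<times> 'k"
  proof -
    obtain D a where Da: "(\<forall>l\<le>3. bideg D D (a l)) \<and> (\<exists>l\<le>3. bihom_eval D D (a l) s t \<noteq> 0) \<and>
      (\<forall>s' t'. nz s' \<longrightarrow> nz t' \<longrightarrow> (\<exists>\<kappa>. \<forall>l\<le>3. bihom_eval D D (a l) s' t' = \<kappa> * segre_vec (g s' t') (h s' t') l))"
      using loc[OF st] by (elim exE)
    note bd = conjunct1[OF Da, rule_format] and ex = conjunct1[OF conjunct2[OF Da]]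
      and kap = conjunct2[OF conjunct2[OF Da], rule_format]
    have P: "peq (bihom_eval D D (a p) s' t', bihom_eval D D (a q) s' t') (k s' t')"
      "peq (bihom_eval D D (a p') s' t', bihom_eval D D (a q') s' t') (k s' t')" if n: "nz s'" "nz t'" for s' t'
    proof -
      obtain \<kappa> where "\<forall>l\<le>3. bihom_eval D D (a l) s' t' = \<kappa> * segre_vec (g s' t') (h s' t') l" using kap[OF n] by blast
      then show "peq (bihom_eval D D (a p) s' t', bihom_eval D D (a q) s' t') (k s' t')"
        "peq (bihom_eval D D (a p') s' t', bihom_eval D D (a q') s' t') (k s' t')"
        using e[of s' t'] le by (simp_all add: peq_def mult.assoc)
    qed
    have "nz (bihom_eval D D (a p) s t, bihom_eval D D (a q) s t) \<or> nz (bihom_eval D D (a p') s t, bihom_eval D D (a q') s t)"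
      using cov[OF ex] by (auto simp: nz_def)
    then show ?thesis
    proof
      assume "nz (bihom_eval D D (a p) s t, bihom_eval D D (a q) s t)"
      then show ?thesis using bd[OF le(1)] bd[OF le(2)] P(1)
        by (intro exI[of _ D] exI[of _ "a p"] exI[of _ "a q"] conjI allI impI) simp_all
    next
      assume "nz (bihom_eval D D (a p') s t, bihom_eval D D (a q') s t)"
      then show ?thesis using bd[OF le(3)] bd[OF le(4)] P(2)
        by (intro exI[of _ D] exI[of _ "a p'"] exI[of _ "a q'"] conjI allI impI) simp_all
    qed
  qed
  have cov: "(\<exists>l\<le>3. a l \<noteq> 0) \<Longrightarrow> a 0 \<noteq> 0 \<or> a (Suc 0) \<noteq> 0 \<or> a 2 \<noteq> 0 \<or> a 3 \<noteq> 0" for a :: "nat \<Rightarrow> 'k"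
    using le3_cases by metis
  have "bi_mor g" unfolding bi_mor_def
  proof (intro conjI allI impI)
    fix s t :: "'k \<times> 'k" assume n: "nz s" "nz t"
    show "nz (g s t)" using gh[OF n] by blast
    show "\<exists>d a b. bideg d d a \<and> bideg d d b \<and> nz (bihom_eval d d a s t, bihom_eval d d b s t) \<and>
        (\<forall>s' t'. nz s' \<longrightarrow> nz t' \<longrightarrow> peq (bihom_eval d d a s' t', bihom_eval d d b s' t') (g s' t'))"
      by (rule rep[OF n, of 0 2 "Suc 0" 3]) (use cov in auto)
  qed
  moreover have "bi_mor h" unfolding bi_mor_def
  proof (intro conjI allI impI)
    fix s t :: "'k \<times> 'k" assume n: "nz s" "nz t"
    show "nz (h s t)" using gh[OF n] by blast
    show "\<exists>d a b. bideg d d a \<and> bideg d d b \<and> nz (bihom_eval d d a s t, bihom_eval d d b s t) \<and>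
        (\<forall>s' t'. nz s' \<longrightarrow> nz t' \<longrightarrow> peq (bihom_eval d d a s' t', bihom_eval d d b s' t') (h s' t'))"
      by (rule rep[OF n, of 0 "Suc 0" 2 3]) (use cov in auto)
  qed
  ultimately show ?thesis using gh by blast
qed

theorem P1xP1_automorphism:
  fixes \<alpha> \<beta> :: "(nat \<Rightarrow> 'k::{alg_closed_field, field_char_0}) set \<Rightarrow> (nat \<Rightarrow> 'k) set"
  assumes \<alpha>: "is_morphism UNIV 3 P1xP1 3 P1xP1 \<alpha>" and \<beta>: "is_morphism UNIV 3 P1xP1 3 P1xP1 \<beta>"
    and inv: "\<And>P. P \<in> P1xP1 \<Longrightarrow> \<alpha> (\<beta> P) = P"
    and fx: "\<And>r. r \<in> {(0, 1), (1, 0), (1, 1)} \<Longrightarrow> \<alpha> (segre r r) = segre r r"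
  shows "(\<forall>s t. nz s \<longrightarrow> nz t \<longrightarrow> \<alpha> (segre s t) = segre s t) \<or>
    (\<forall>s t. nz s \<longrightarrow> nz t \<longrightarrow> \<alpha> (segre s t) = segre t s)"
proof -
  obtain g h where g: "bi_mor g" and h: "bi_mor h"
    and gh: "\<And>s t. nz s \<Longrightarrow> nz t \<Longrightarrow> \<alpha> (segre s t) = segre (g s t) (h s t)"
    using segre_morphism_coordinates[OF \<alpha>] by blast
  obtain x y where x: "bi_mor x" and y: "bi_mor y"
    and xy: "\<And>s t. nz s \<Longrightarrow> nz t \<Longrightarrow> \<beta> (segre s t) = segre (x s t) (y s t)"
    using segre_morphism_coordinates[OF \<beta>] by blast
  have ab: "peq (g (x c \<tau>) (y c \<tau>)) c \<and> peq (h (x c \<tau>) (y c \<tau>)) \<tau>" if n: "nz c" "nz \<tau>" for c \<tau>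
  proof -
    have m: "nz (x c \<tau>)" "nz (y c \<tau>)" using bi_mor_nz[OF x n] bi_mor_nz[OF y n] .
    have "segre (g (x c \<tau>) (y c \<tau>)) (h (x c \<tau>) (y c \<tau>)) = segre c \<tau>"
      using inv[OF segre_in[OF n]] xy[OF n] gh[OF m] by simp
    then show ?thesis using segre_eq_iff[OF bi_mor_nz[OF g m] bi_mor_nz[OF h m] n] by blast
  qed
  have fr: "peq (g r r) r \<and> peq (h r r) r" if r: "r \<in> {(0, 1), (1, 0), (1, 1)}" for r
  proof -
    have n: "nz r" using r by (auto simp: nz_def)
    have "segre (g r r) (h r r) = segre r r" using fx[OF r] gh[OF n n] by simp
    then show ?thesis using segre_eq_iff[OF bi_mor_nz[OF g n n] bi_mor_nz[OF h n n] n n] by blast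
  qed
  have "(\<forall>s t. nz s \<longrightarrow> nz t \<longrightarrow> peq (g s t) s \<and> peq (h s t) t) \<or>
    (\<forall>s t. nz s \<longrightarrow> nz t \<longrightarrow> peq (g s t) t \<and> peq (h s t) s)"
    by (rule automorphism_fixing_three_points[OF g h x y conjunct1[OF ab] conjunct2[OF ab] conjunct1[OF fr] conjunct2[OF fr]])
  then show ?thesis
  proof
    assume a: "\<forall>s t. nz s \<longrightarrow> nz t \<longrightarrow> peq (g s t) s \<and> peq (h s t) t"
    have "\<alpha> (segre s t) = segre s t" if n: "nz s" "nz t" for s t
      using gh[OF n] segre_eq_iff[OF bi_mor_nz[OF g n] bi_mor_nz[OF h n] n] a n by simp
    then show ?thesis by blast
  next
    assume a: "\<forall>s t. nz s \<longrightarrow> nz t \<longrightarrow> peq (g s t) t \<and> peq (h s t) s"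
    have "\<alpha> (segre s t) = segre t s" if n: "nz s" "nz t" for s t
      using gh[OF n] segre_eq_iff[OF bi_mor_nz[OF g n] bi_mor_nz[OF h n] n(2,1)] a n by simp
    then show ?thesis by blast
  qed
qed

lemma morphism_from_forms:
  assumes V: "V \<subseteq> proj_space n" and f: "\<And>i. i \<le> m \<Longrightarrow> f i \<in> FF n d"
    and Y: "\<And>x. pt x \<in> V \<Longrightarrow> (\<exists>i\<le>m. f i x \<noteq> 0) \<and> pt (trunc m (\<lambda>i. f i x)) \<in> Y"
  shows "\<exists>\<mu>. is_morphism UNIV n V m Y \<mu> \<and> (\<forall>x. pt x \<in> V \<longrightarrow> \<mu> (pt x) = pt (trunc m (\<lambda>i. f i x)))"
proof -
  define \<mu> where "\<mu> P = pt (trunc m (\<lambda>i. f i (SOME x. x \<in> P)))" for P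
  have \<mu>: "\<mu> (pt x) = pt (trunc m (\<lambda>i. f i x))" if x: "pt x \<in> V" for x
  proof -
    have "(SOME y. y \<in> pt x) \<in> pt x" by (rule someI[of _ x]) (rule mem_pt)
    then obtain c where c: "c \<noteq> 0" "(SOME y. y \<in> pt x) = (\<lambda>i. c * x i)" using mem_ptE by blast
    have "trunc m (\<lambda>i. f i (SOME y. y \<in> pt x)) = (\<lambda>i. c ^ d * trunc m (\<lambda>i. f i x) i)"
      unfolding c(2) using formfun_homog[OF f] by (auto simp: trunc_def)
    then show ?thesis unfolding \<mu>_def using pt_scale[of "c ^ d"] c(1) by simp
  qed
  have "is_morphism UNIV n V m Y \<mu>"
    unfolding is_morphism_iff[OF V UNIV_I]
  proof (intro allI impI)
    fix x assume x: "pt x \<in> V"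
    have "\<exists>d f. (\<forall>i\<le>m. f i \<in> FF n d) \<and> (\<exists>i\<le>m. f i x \<noteq> 0) \<and>
       (\<forall>y. pt y \<in> V \<longrightarrow> (\<exists>i\<le>m. f i y \<noteq> 0) \<longrightarrow> \<mu> (pt y) = pt (trunc m (\<lambda>i. f i y)))"
      by (rule exI[of _ d], rule exI[of _ f]) (use f Y[OF x] \<mu> in auto)
    then show "\<mu> (pt x) \<in> Y \<and> (\<exists>d f. (\<forall>i\<le>m. f i \<in> FF n d) \<and> (\<exists>i\<le>m. f i x \<noteq> 0) \<and>
       (\<forall>y. pt y \<in> V \<longrightarrow> (\<exists>i\<le>m. f i y \<noteq> 0) \<longrightarrow> \<mu> (pt y) = pt (trunc m (\<lambda>i. f i y))))"
      using Y[OF x] \<mu>[OF x] by simp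
  qed
  then show ?thesis using \<mu> by blast
qed

definition lin2 :: "'k::field \<times> 'k \<times> 'k \<times> 'k \<Rightarrow> 'k \<times> 'k \<Rightarrow> 'k \<times> 'k" where
  "lin2 A s = (case A of (a, b, c, d) \<Rightarrow> (a * fst s + b * snd s, c * fst s + d * snd s))"

definition det2 :: "'k::field \<times> 'k \<times> 'k \<times> 'k \<Rightarrow> 'k" where
  "det2 A = (case A of (a, b, c, d) \<Rightarrow> a * d - b * c)"

definition adj2 :: "'k::field \<times> 'k \<times> 'k \<times> 'k \<Rightarrow> 'k \<times> 'k \<times> 'k \<times> 'k" where
  "adj2 A = (case A of (a, b, c, d) \<Rightarrow> (d, - b, - c, a))"

lemma adj2_lin2: "lin2 (adj2 A) (lin2 A s) = (det2 A * fst s, det2 A * snd s)"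
  "lin2 A (lin2 (adj2 A) s) = (det2 A * fst s, det2 A * snd s)"
  by (cases A; simp add: lin2_def adj2_def det2_def algebra_simps)+

lemma det2_adj2: "det2 (adj2 A) = det2 A"
  by (cases A) (simp add: det2_def adj2_def algebra_simps)

lemma lin2_nz: "det2 A \<noteq> 0 \<Longrightarrow> nz s \<Longrightarrow> nz (lin2 A s)"
proof (rule ccontr)
  assume a: "det2 A \<noteq> 0" "nz s" "\<not> nz (lin2 A s)"
  then have "lin2 (adj2 A) (lin2 A s) = (0, 0)" by (cases A) (auto simp: nz_def lin2_def adj2_def)
  then show False using a adj2_lin2(1)[of A s] by (auto simp: nz_def prod_eq_iff)
qed

lemma lin2_morphism:
  assumes A: "det2 A \<noteq> 0" and B: "det2 B \<noteq> 0"
  shows "\<exists>\<mu>. is_morphism UNIV 3 P1xP1 3 P1xP1 \<mu> \<and>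
    (\<forall>s t. nz s \<longrightarrow> nz t \<longrightarrow> \<mu> (segre s t) = segre (lin2 A s) (lin2 B t))"
proof -
  obtain a b c d where Ad: "A = (a, b, c, d)" by (cases A)
  obtain a' b' c' d' where Bd: "B = (a', b', c', d')" by (cases B)
  define ra rb where "ra i = (if i div 2 = 0 then a else c)" and "rb i = (if i div 2 = 0 then b else d)" for i :: nat
  define rc rd where "rc i = (if i mod 2 = 0 then a' else c')" and "rd i = (if i mod 2 = 0 then b' else d')" for i :: nat
  define f where "f i = (\<lambda>z. ra i * rc i * z 0 + ra i * rd i * z (Suc 0) + rb i * rc i * z 2 + rb i * rd i * z (3::nat))" for i
  have v: "(\<lambda>z. z 0) \<in> FF 3 1" "(\<lambda>z. z (Suc 0)) \<in> FF 3 1" "(\<lambda>z. z 2) \<in> FF 3 1" "(\<lambda>z. z 3) \<in> FF 3 1"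
    by (rule FF_var; simp)+
  have fF: "f i \<in> FF 3 1" for i
    unfolding f_def by (intro FF_add FF_scale v)
  have fs: "trunc 3 (\<lambda>i. f i (\<lambda>i. k * segre_vec s t i)) = (\<lambda>i. k * segre_vec (lin2 A s) (lin2 B t) i)" for s t k
  proof
    fix l
    show "trunc 3 (\<lambda>i. f i (\<lambda>i. k * segre_vec s t i)) l = k * segre_vec (lin2 A s) (lin2 B t) l"
    proof (cases "l \<le> 3")
      case True
      from le3_cases[OF True] show ?thesis
        by (elim disjE; simp add: trunc_def f_def ra_def rb_def rc_def rd_def Ad Bd lin2_def algebra_simps)
    qed (simp add: trunc_def)
  qed
  have P: "(\<exists>i\<le>3. f i z \<noteq> 0) \<and> pt (trunc 3 (\<lambda>i. f i z)) \<in> P1xP1 \<and>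
      (\<forall>s t. nz s \<longrightarrow> nz t \<longrightarrow> pt z = segre s t \<longrightarrow> pt (trunc 3 (\<lambda>i. f i z)) = segre (lin2 A s) (lin2 B t))"
    if z: "pt z \<in> P1xP1" for z
  proof -
    have r: "pt (trunc 3 (\<lambda>i. f i z)) = segre (lin2 A s) (lin2 B t) \<and> (\<exists>i\<le>3. f i z \<noteq> 0)"
      if n: "nz s" "nz t" "segre s t = pt z" for s t
    proof -
      obtain k where k: "k \<noteq> 0" "z = (\<lambda>i. k * segre_vec s t i)"
        using n(3) unfolding segre_def pt_eq_iff by blast
      have e: "trunc 3 (\<lambda>i. f i z) = (\<lambda>i. k * segre_vec (lin2 A s) (lin2 B t) i)" unfolding k(2) by (rule fs)
      obtain i where i: "i \<le> 3" "segre_vec (lin2 A s) (lin2 B t) i \<noteq> 0"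
        using segre_vec_nonzero lin2_nz A B n by metis
      then have "f i z \<noteq> 0" using fun_cong[OF e, of i] k(1) by (simp add: trunc_def)
      then show ?thesis using i(1) e pt_scale[OF k(1)] unfolding segre_def by auto
    qed
    obtain s t where st: "nz s" "nz t" "segre s t = pt z" using P1xP1_segre[OF z] by metis
    have "segre (lin2 A s) (lin2 B t) \<in> P1xP1" using segre_in lin2_nz A B st by blast
    then show ?thesis using r[OF st] r by metis
  qed
  have "\<exists>\<mu>. is_morphism UNIV 3 P1xP1 3 P1xP1 \<mu> \<and> (\<forall>x. pt x \<in> P1xP1 \<longrightarrow> \<mu> (pt x) = pt (trunc 3 (\<lambda>i. f i x)))"
    by (rule morphism_from_forms[OF P1xP1_subset fF]) (use P in simp)
  then obtain \<mu> where \<mu>: "is_morphism UNIV 3 P1xP1 3 P1xP1 \<mu>"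
    "\<forall>x. pt x \<in> P1xP1 \<longrightarrow> \<mu> (pt x) = pt (trunc 3 (\<lambda>i. f i x))" by (elim exE conjE)
  have "\<mu> (segre s t) = segre (lin2 A s) (lin2 B t)" if n: "nz s" "nz t" for s t
  proof -
    have i: "pt (segre_vec s t) \<in> P1xP1" using segre_in[OF n] by (simp add: segre_def)
    have "\<mu> (segre s t) = pt (trunc 3 (\<lambda>i. f i (segre_vec s t)))" using \<mu>(2) i unfolding segre_def by blast
    then show ?thesis using P[OF i] n unfolding segre_def by metis
  qed
  then show ?thesis using \<mu>(1) by blast
qed

text \<open>The two rows of the matrix are the forms that vanish at \<open>s1\<close> and at \<open>s2\<close>, scaled to take
  the same value at \<open>s3\<close>.\<close>

lemma moebius_three_points:
  assumes n: "\<not> peq s1 s2" "\<not> peq s1 s3" "\<not> peq s2 s3"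
  shows "\<exists>A. det2 A \<noteq> 0 \<and> peq (lin2 A s1) (0, 1) \<and> peq (lin2 A s2) (1, 0) \<and> peq (lin2 A s3) (1, 1)"
proof -
  obtain a0 a1 b0 b1 c0 c1 where st: "s1 = (a0, a1)" "s2 = (b0, b1)" "s3 = (c0, c1)"
    by (cases s1, cases s2, cases s3)
  define p where "p = c0 * b1 - c1 * b0"
  define q where "q = c0 * a1 - c1 * a0"
  have pq: "p \<noteq> 0" "q \<noteq> 0" using n(2,3) by (auto simp: st peq_def p_def q_def mult.commute)
  have r: "a0 * b1 - a1 * b0 \<noteq> 0" using n(1) by (auto simp: st peq_def)
  define A where "A = (p * a1, - p * a0, q * b1, - q * b0)"
  have "det2 A = p * q * (a0 * b1 - a1 * b0)" by (simp add: det2_def A_def algebra_simps)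
  then have "det2 A \<noteq> 0" using pq r by simp
  moreover have "peq (lin2 A s1) (0, 1)" "peq (lin2 A s2) (1, 0)"
    by (simp_all add: lin2_def A_def st peq_def algebra_simps)
  moreover have "lin2 A s3 = (p * q, q * p)" by (simp add: lin2_def A_def st p_def q_def algebra_simps)
  then have "peq (lin2 A s3) (1, 1)" by (simp add: peq_def)
  ultimately show ?thesis by blast
qed

section \<open>Normalising the isomorphism\<close>

abbreviation gal_pair :: "('k \<Rightarrow> 'k) \<Rightarrow> 'k \<times> 'k \<Rightarrow> 'k \<times> 'k" where "gal_pair s \<equiv> map_prod s s"

lemma gal_pair_nz: "s \<in> gal \<Longrightarrow> nz (gal_pair s p) \<longleftrightarrow> nz p"
  by (cases p) (auto simp: nz_def gal_simps)

lemma gact_segre: 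
  assumes s: "s \<in> gal" shows "gact s (segre p q) = segre (gal_pair s p) (gal_pair s q)"
proof -
  have "s \<circ> segre_vec p q = segre_vec (gal_pair s p) (gal_pair s q)"
    by (cases p, cases q) (auto simp: fun_eq_iff segre_vec_def galD[OF s] gal_simps[OF s])
  then show ?thesis unfolding segre_def gact_pt[OF s] by simp
qed

lemma P1xP1_gal_stable: "gal_stable P1xP1"
  unfolding gal_stable_def
proof (intro ballI)
  fix s :: "'a alg_closure \<Rightarrow> 'a alg_closure" and P :: "(nat \<Rightarrow> 'a alg_closure) set"
  assume s: "s \<in> gal" and P: "P \<in> P1xP1"
  obtain p q where "nz p" "nz q" "P = segre p q" using P1xP1_segre[OF P] by blast
  then show "gact s P \<in> P1xP1" using gact_segre[OF s] segre_in[of "gal_pair s p" "gal_pair s q"] gal_pair_nz[OF s] by simp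
qed

lemma segre_fixed_by_gal:
  assumes s: "s \<in> gal" and "p \<in> {(0, 1), (1, 0), (1, 1)}" "q \<in> {(0, 1), (1, 0), (1, 1)}"
  shows "gact s (segre p q) = segre p q"
  using assms(2,3) by (auto simp: gact_segre[OF s] gal_simps[OF s])

text \<open>Local equations of \<open>\<phi>\<close> in Segre coordinates, with the factor of proportionality made
  explicit; only at \<open>x0\<close> is it known to be nonzero.\<close>

lemma local_segre_form:
  assumes V: "V \<subseteq> proj_space n" and \<phi>: "is_morphism UNIV n V 3 P1xP1 \<phi>" and x0: "pt x0 \<in> V"
  obtains d f where "\<And>l. l \<le> 3 \<Longrightarrow> f l \<in> FF n d"
    "\<And>x s t. pt x \<in> V \<Longrightarrow> \<phi> (pt x) = segre s t \<Longrightarrow> \<exists>\<kappa>. \<forall>l\<le>3. f l x = \<kappa> * segre_vec s t l"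
    "\<And>s t. \<phi> (pt x0) = segre s t \<Longrightarrow> \<exists>\<kappa>. \<kappa> \<noteq> 0 \<and> (\<forall>l\<le>3. f l x0 = \<kappa> * segre_vec s t l)"
proof -
  obtain d f where f: "\<And>i. i \<le> 3 \<Longrightarrow> f i \<in> FF n d" "\<exists>i\<le>3. f i x0 \<noteq> 0"
    "\<And>y. pt y \<in> V \<Longrightarrow> (\<exists>i\<le>3. f i y \<noteq> 0) \<Longrightarrow> \<phi> (pt y) = pt (trunc 3 (\<lambda>i. f i y))"
    by (rule morphism_local[OF \<phi> V UNIV_I x0], rule that)
  have nonz: "\<exists>\<kappa>. \<kappa> \<noteq> 0 \<and> (\<forall>l\<le>3. f l x = \<kappa> * segre_vec s t l)"
    if h: "pt x \<in> V" "\<phi> (pt x) = segre s t" "\<exists>i\<le>3. f i x \<noteq> 0" for x s t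
  proof -
    have "pt (segre_vec s t) = pt (trunc 3 (\<lambda>i. f i x))" using f(3)[OF h(1,3)] h(2) by (simp add: segre_def)
    then obtain c where c: "c \<noteq> 0" "trunc 3 (\<lambda>i. f i x) = (\<lambda>i. c * segre_vec s t i)" unfolding pt_eq_iff by blast
    have "f l x = c * segre_vec s t l" if "l \<le> 3" for l using fun_cong[OF c(2), of l] that by (simp add: trunc_def)
    then show ?thesis using c(1) by blast
  qed
  have "\<exists>\<kappa>. \<forall>l\<le>3. f l x = \<kappa> * segre_vec s t l" if h: "pt x \<in> V" "\<phi> (pt x) = segre s t" for x s t
  proof (cases "\<exists>i\<le>3. f i x \<noteq> 0")
    case True
    then show ?thesis using nonz[OF h] by blast
  next
    case False
    then show ?thesis by (intro exI[of _ 0]) simp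
  qed
  from that[OF f(1) this nonz[OF x0 _ f(2)]] show thesis .
qed

lemma exists_other_point:
  fixes c :: "'k::field \<times> 'k"
  assumes "nz c" shows "\<exists>s. nz s \<and> \<not> peq s c"
proof (cases "fst c = 0")
  case True
  then have "\<not> peq (1, 0) c" using assms by (auto simp: nz_def peq_def prod_eq_iff)
  then show ?thesis using nz_affine(2) by blast
next
  case False
  then have "\<not> peq (0, 1) c" by (simp add: peq_def)
  then show ?thesis using nz_affine(1) by blast
qed

text \<open>The points of \<open>V\<close> where a chosen coordinate of \<open>\<phi>\<close> differs from \<open>c\<close> contain the nonzero
  locus of a form: with local equations \<open>f\<close>, cross-multiplying \<open>(f 0, f 2)\<close> or \<open>(f 0, f 1)\<close> with \<open>c\<close>.
  The form does not vanish identically because the other coordinate may be taken to be \<open>(1, 1)\<close>.\<close>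

lemma avoid_coordinate:
  fixes V :: "(nat \<Rightarrow> 'k::field) set set"
  assumes V: "V \<subseteq> proj_space n" and \<phi>: "is_morphism UNIV n V 3 P1xP1 \<phi>"
    and surj: "\<And>Q. Q \<in> P1xP1 \<Longrightarrow> \<exists>P\<in>V. \<phi> P = Q" and c: "nz c"
  shows "\<exists>h. (\<exists>d. h \<in> FF n d) \<and> (\<exists>x. pt x \<in> V \<and> h x \<noteq> 0) \<and>
      (\<forall>x s t. pt x \<in> V \<longrightarrow> h x \<noteq> 0 \<longrightarrow> \<phi> (pt x) = segre s t \<longrightarrow> \<not> peq (if first then s else t) c)"
proof -
  obtain s0 where s0: "nz s0" "\<not> peq s0 c" using exists_other_point[OF c] by blast
  define p q where "p = (if first then s0 else (1, 1))" and "q = (if first then (1, 1) else s0)"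
  define l where "l = (if first then 2 else Suc 0)"
  have segl: "segre_vec s t 0 * snd c - segre_vec s t l * fst c =
      fst (if first then t else s) * (fst (if first then s else t) * snd c - snd (if first then s else t) * fst c)" for s t
    by (simp add: l_def algebra_simps)
  have "segre p q \<in> P1xP1" using s0(1) by (intro segre_in) (auto simp: p_def q_def)
  then obtain P where P: "P \<in> V" "\<phi> P = segre p q" using surj by blast
  moreover obtain x0 where "P = pt x0" using proj_space_ne P(1) V by blast
  ultimately have x0: "pt x0 \<in> V" "\<phi> (pt x0) = segre p q" by auto
  obtain d f where f: "\<And>l. l \<le> 3 \<Longrightarrow> f l \<in> FF n d"
    "\<And>x s t. pt x \<in> V \<Longrightarrow> \<phi> (pt x) = segre s t \<Longrightarrow> \<exists>\<kappa>. \<forall>l\<le>3. f l x = \<kappa> * segre_vec s t l"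
    "\<And>s t. \<phi> (pt x0) = segre s t \<Longrightarrow> \<exists>\<kappa>. \<kappa> \<noteq> 0 \<and> (\<forall>l\<le>3. f l x0 = \<kappa> * segre_vec s t l)"
    by (rule local_segre_form[OF V \<phi> x0(1)], rule that)
  define h where "h x = snd c * f 0 x - fst c * f l x" for x
  have l3: "l \<le> 3" by (simp add: l_def)
  have hval: "h x = \<kappa> * (segre_vec s t 0 * snd c - segre_vec s t l * fst c)"
    if "\<forall>l\<le>3. f l x = \<kappa> * segre_vec s t l" for x \<kappa> s t
    using that[rule_format, of 0] that[rule_format, OF l3] by (simp only: h_def le0 algebra_simps)
  have "h \<in> FF n d" unfolding h_def[abs_def] by (intro FF_diff FF_scale f(1) l3) simp
  moreover have "h x0 \<noteq> 0"
  proof -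
    obtain \<kappa> where k: "\<kappa> \<noteq> 0" "\<forall>l\<le>3. f l x0 = \<kappa> * segre_vec p q l" using f(3)[OF x0(2)] by blast
    show ?thesis unfolding hval[OF k(2)] segl using k(1) s0(2) by (auto simp: peq_def p_def q_def)
  qed
  moreover have "\<not> peq (if first then s else t) c"
    if hx: "pt x \<in> V" "h x \<noteq> 0" "\<phi> (pt x) = segre s t" for x s t
  proof
    assume e: "peq (if first then s else t) c"
    obtain \<kappa> where k: "\<forall>l\<le>3. f l x = \<kappa> * segre_vec s t l" using f(2)[OF hx(1,3)] by blast
    show False using hx(2) e unfolding hval[OF k] segl peq_def by simp
  qed
  ultimately show ?thesis using x0(1) by blast
qed

lemma peq_lin2_back:
  assumes "det2 A \<noteq> 0" "nz s" shows "peq (lin2 (adj2 A) (lin2 A s)) s" "peq (lin2 A (lin2 (adj2 A) s)) s"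
  unfolding adj2_lin2 by (simp_all add: peq_def)

text \<open>The three rational points are found one after the other, each outside the closed sets
  where one of its coordinates agrees with that of an earlier point.\<close>

theorem normalized_isomorphism:
  fixes V :: "(nat \<Rightarrow> 'f::field_char_0 alg_closure) set set"
  assumes V: "V \<subseteq> proj_space n" and par: "has_parametrization (range to_ac) n V"
    and iso: "isomorphic_over UNIV n V 3 P1xP1"
  shows "\<exists>\<phi> \<psi>. is_morphism UNIV n V 3 P1xP1 \<phi> \<and> is_morphism UNIV 3 P1xP1 n V \<psi> \<and>
    (\<forall>P\<in>V. \<psi> (\<phi> P) = P) \<and> (\<forall>Q\<in>P1xP1. \<phi> (\<psi> Q) = Q) \<and>
    (\<forall>r\<in>{(0, 1), (1, 0), (1, 1)}. \<exists>P\<in>V. (\<forall>s\<in>gal. gact s P = P) \<and> \<phi> P = segre r r)"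
proof -
  obtain \<phi> \<psi> where \<phi>: "is_morphism UNIV n V 3 P1xP1 \<phi>" and \<psi>: "is_morphism UNIV 3 P1xP1 n V \<psi>"
    and \<psi>\<phi>: "\<forall>P\<in>V. \<psi> (\<phi> P) = P" and \<phi>\<psi>: "\<forall>Q\<in>P1xP1. \<phi> (\<psi> Q) = Q"
    using iso unfolding isomorphic_over_def by (elim exE conjE)
  have surj: "\<exists>P\<in>V. \<phi> P = Q" if "Q \<in> P1xP1" for Q
    using morphism_maps[OF \<psi> that] \<phi>\<psi> that by blast
  define good where "good hs \<longleftrightarrow> (\<forall>h\<in>set hs. (\<exists>d. h \<in> FF n d) \<and> (\<exists>x. pt x \<in> V \<and> h x \<noteq> 0))"
    for hs :: "((nat \<Rightarrow> 'f alg_closure) \<Rightarrow> 'f alg_closure) list"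
  have pick: "\<exists>P x s t. P \<in> V \<and> (\<forall>g\<in>gal. gact g P = P) \<and> P = pt x \<and> (\<forall>h\<in>set hs. h x \<noteq> 0) \<and>
      nz s \<and> nz t \<and> \<phi> P = segre s t" if hs: "good hs" for hs
  proof -
    have "\<exists>x. pt x \<in> V \<and> (\<forall>i. x i \<in> range to_ac) \<and> (\<forall>h\<in>set hs. h x \<noteq> 0)"
      by (rule rational_points_dense[OF V par]) (use hs in \<open>simp add: good_def\<close>)
    then obtain x where x: "pt x \<in> V" "\<And>i. x i \<in> range to_ac" "\<forall>h\<in>set hs. h x \<noteq> 0" by blast
    have "gact g (pt x) = pt x" if g: "g \<in> gal" for g
    proof -
      have "g \<circ> x = x"
      proof
        fix i show "(g \<circ> x) i = x i" using x(2)[of i] galD(4)[OF g] by auto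
      qed
      then show ?thesis by (simp add: gact_pt[OF g])
    qed
    moreover obtain s t where "nz s" "nz t" "\<phi> (pt x) = segre s t"
      using P1xP1_segre[OF morphism_maps[OF \<phi> x(1)]] by blast
    ultimately show ?thesis using x by blast
  qed
  define away1 where "away1 c h \<longleftrightarrow> good [h] \<and> (\<forall>x s t. pt x \<in> V \<longrightarrow> h x \<noteq> 0 \<longrightarrow> \<phi> (pt x) = segre s t \<longrightarrow> \<not> peq s c)" for c h
  define away2 where "away2 c h \<longleftrightarrow> good [h] \<and> (\<forall>x s t. pt x \<in> V \<longrightarrow> h x \<noteq> 0 \<longrightarrow> \<phi> (pt x) = segre s t \<longrightarrow> \<not> peq t c)" for c h
  have away1D: "\<not> peq s c" if "away1 c h" "P \<in> V" "P = pt x" "h x \<noteq> 0" "\<phi> P = segre s t" for c h P x s t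
    using that unfolding away1_def by blast
  have away2D: "\<not> peq t c" if "away2 c h" "P \<in> V" "P = pt x" "h x \<noteq> 0" "\<phi> P = segre s t" for c h P x s t
    using that unfolding away2_def by blast
  have ex1: "\<exists>h. away1 c h" if "nz c" for c
    using avoid_coordinate[OF V \<phi> surj that, of True] unfolding away1_def good_def by simp
  have ex2: "\<exists>h. away2 c h" if "nz c" for c
    using avoid_coordinate[OF V \<phi> surj that, of False] unfolding away2_def good_def by simp
  have "good []" by (simp add: good_def)
  from pick[OF this] obtain P1 x1 s1 t1 where 1: "P1 \<in> V" "\<forall>g\<in>gal. gact g P1 = P1" "P1 = pt x1"
    "nz s1" "nz t1" "\<phi> P1 = segre s1 t1" by blast
  obtain h1 where h1: "away1 s1 h1" using ex1[OF 1(4)] by blast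
  obtain k1 where k1: "away2 t1 k1" using ex2[OF 1(5)] by blast
  have "good [h1, k1]" using h1 k1 by (simp add: good_def away1_def away2_def)
  from pick[OF this] obtain P2 x2 s2 t2 where 2: "P2 \<in> V" "\<forall>g\<in>gal. gact g P2 = P2" "P2 = pt x2"
    "\<forall>h\<in>set [h1, k1]. h x2 \<noteq> 0" "nz s2" "nz t2" "\<phi> P2 = segre s2 t2" by blast
  have n21: "\<not> peq s2 s1" "\<not> peq t2 t1"
    using away1D[OF h1 2(1,3) _ 2(7)] away2D[OF k1 2(1,3) _ 2(7)] 2(4) by simp_all
  obtain h2 where h2: "away1 s2 h2" using ex1[OF 2(5)] by blast
  obtain k2 where k2: "away2 t2 k2" using ex2[OF 2(6)] by blast
  have "good [h1, k1, h2, k2]" using h1 k1 h2 k2 by (simp add: good_def away1_def away2_def)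
  from pick[OF this] obtain P3 x3 s3 t3 where 3: "P3 \<in> V" "\<forall>g\<in>gal. gact g P3 = P3" "P3 = pt x3"
    "\<forall>h\<in>set [h1, k1, h2, k2]. h x3 \<noteq> 0" "nz s3" "nz t3" "\<phi> P3 = segre s3 t3" by blast
  have n3: "\<not> peq s3 s1" "\<not> peq t3 t1" "\<not> peq s3 s2" "\<not> peq t3 t2"
    using away1D[OF h1 3(1,3) _ 3(7)] away2D[OF k1 3(1,3) _ 3(7)]
      away1D[OF h2 3(1,3) _ 3(7)] away2D[OF k2 3(1,3) _ 3(7)] 3(4) by simp_all
  obtain A where A: "det2 A \<noteq> 0" "peq (lin2 A s1) (0, 1)" "peq (lin2 A s2) (1, 0)" "peq (lin2 A s3) (1, 1)"
    using moebius_three_points[of s1 s2 s3] n21 n3 peq_sym by blast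
  obtain B where B: "det2 B \<noteq> 0" "peq (lin2 B t1) (0, 1)" "peq (lin2 B t2) (1, 0)" "peq (lin2 B t3) (1, 1)"
    using moebius_three_points[of t1 t2 t3] n21 n3 peq_sym by blast
  have A': "det2 (adj2 A) \<noteq> 0" and B': "det2 (adj2 B) \<noteq> 0" using A(1) B(1) by (simp_all add: det2_adj2)
  obtain \<mu> where \<mu>: "is_morphism UNIV 3 P1xP1 3 P1xP1 \<mu>"
    "\<And>s t. nz s \<Longrightarrow> nz t \<Longrightarrow> \<mu> (segre s t) = segre (lin2 A s) (lin2 B t)"
    using lin2_morphism[OF A(1) B(1)] by blast
  obtain \<nu> where \<nu>: "is_morphism UNIV 3 P1xP1 3 P1xP1 \<nu>"
    "\<And>s t. nz s \<Longrightarrow> nz t \<Longrightarrow> \<nu> (segre s t) = segre (lin2 (adj2 A) s) (lin2 (adj2 B) t)"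
    using lin2_morphism[OF A' B'] by blast
  have \<mu>\<nu>: "\<mu> (\<nu> Q) = Q \<and> \<nu> (\<mu> Q) = Q" if Q: "Q \<in> P1xP1" for Q
  proof -
    obtain s t where st: "nz s" "nz t" "Q = segre s t" using P1xP1_segre[OF Q] by blast
    note n = lin2_nz[OF A(1) st(1)] lin2_nz[OF B(1) st(2)] lin2_nz[OF A' st(1)] lin2_nz[OF B' st(2)]
    have "\<mu> (\<nu> Q) = segre (lin2 A (lin2 (adj2 A) s)) (lin2 B (lin2 (adj2 B) t))"
      "\<nu> (\<mu> Q) = segre (lin2 (adj2 A) (lin2 A s)) (lin2 (adj2 B) (lin2 B t))"
      by (simp_all add: st n \<mu>(2) \<nu>(2))
    then show ?thesis
      using segre_eq_iff[OF lin2_nz[OF A(1) n(3)] lin2_nz[OF B(1) n(4)] st(1,2)]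
        segre_eq_iff[OF lin2_nz[OF A' n(1)] lin2_nz[OF B' n(2)] st(1,2)]
        peq_lin2_back[OF A(1) st(1)] peq_lin2_back[OF B(1) st(2)] st(3) by simp
  qed
  have r: "\<mu> (\<phi> P) = segre r r"
    if "\<phi> P = segre s t" "nz s" "nz t" "peq (lin2 A s) r" "peq (lin2 B t) r" "nz r" for P r s t
    using that \<mu>(2) segre_eq_iff[OF lin2_nz[OF A(1)] lin2_nz[OF B(1)]] by metis
  show ?thesis
  proof (intro exI conjI)
    show "is_morphism UNIV n V 3 P1xP1 (\<lambda>P. \<mu> (\<phi> P))" by (rule is_morphism_comp[OF V P1xP1_subset \<phi> \<mu>(1)])
    show "is_morphism UNIV 3 P1xP1 n V (\<lambda>P. \<psi> (\<nu> P))" by (rule is_morphism_comp[OF P1xP1_subset P1xP1_subset \<nu>(1) \<psi>])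
    show "\<forall>P\<in>V. \<psi> (\<nu> (\<mu> (\<phi> P))) = P" using \<mu>\<nu> morphism_maps[OF \<phi>] \<psi>\<phi> by simp
    show "\<forall>Q\<in>P1xP1. \<mu> (\<phi> (\<psi> (\<nu> Q))) = Q" using \<mu>\<nu> morphism_maps[OF \<nu>(1)] \<phi>\<psi> by simp
    show "\<forall>r\<in>{(0, 1), (1, 0), (1, 1)}. \<exists>P\<in>V. (\<forall>s\<in>gal. gact s P = P) \<and> \<mu> (\<phi> P) = segre r r"
      using 1(1,2) 2(1,2) 3(1,2) r[OF 1(6,4,5) A(2) B(2)] r[OF 2(7,5,6) A(3) B(3)] r[OF 3(7,5,6) A(4) B(4)]
      by auto
  qed
qed

section \<open>The sphere\<close>

text \<open>The coordinates with respect to \<open>fixed_basis a\<close>, where \<open>\<delta>\<close> is \<open>sqrt_ac a\<close>, of the 3 by 3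
  matrix with entries \<open>s\<^sup>i t\<^sup>j\<close> homogenized. The entries are quadratic in the Segre coordinates \<open>z\<close>, and
  the basis splits the matrix into its symmetric and skew parts.\<close>

definition sphere_vec :: "'k::field_char_0 \<Rightarrow> (nat \<Rightarrow> 'k) \<Rightarrow> nat \<Rightarrow> 'k" where
  "sphere_vec \<delta> z k =
    (if k = 0 then z 3 * z 3 else if k = Suc 0 then z 0 * z 3 else if k = 2 then z 0 * z 0
     else if k = 3 then (1 / 2) * (z 2 * z 3 + z (Suc 0) * z 3)
     else if k = 4 then (1 / 2) * (z 2 * z 2 + z (Suc 0) * z (Suc 0))
     else if k = 5 then (1 / 2) * (z 0 * z 2 + z 0 * z (Suc 0))
     else if k = 6 then (1 / (2 * \<delta>)) * (z 2 * z 3 - z (Suc 0) * z 3)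
     else if k = 7 then (1 / (2 * \<delta>)) * (z 2 * z 2 - z (Suc 0) * z (Suc 0))
     else if k = 8 then (1 / (2 * \<delta>)) * (z 0 * z 2 - z 0 * z (Suc 0))
     else 0)"

lemma sphere_vec_simps:
  "sphere_vec \<delta> z 0 = z 3 * z 3" "sphere_vec \<delta> z (Suc 0) = z 0 * z 3" "sphere_vec \<delta> z 2 = z 0 * z 0"
  "sphere_vec \<delta> z 3 = (1 / 2) * (z 2 * z 3 + z (Suc 0) * z 3)"
  "sphere_vec \<delta> z 4 = (1 / 2) * (z 2 * z 2 + z (Suc 0) * z (Suc 0))"
  "sphere_vec \<delta> z 5 = (1 / 2) * (z 0 * z 2 + z 0 * z (Suc 0))"
  "sphere_vec \<delta> z 6 = (1 / (2 * \<delta>)) * (z 2 * z 3 - z (Suc 0) * z 3)"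
  "sphere_vec \<delta> z 7 = (1 / (2 * \<delta>)) * (z 2 * z 2 - z (Suc 0) * z (Suc 0))"
  "sphere_vec \<delta> z 8 = (1 / (2 * \<delta>)) * (z 0 * z 2 - z 0 * z (Suc 0))"
  by (simp_all add: sphere_vec_def)

lemma le8_cases: "k \<le> 8 \<Longrightarrow> k = 0 \<or> k = Suc 0 \<or> k = 2 \<or> k = 3 \<or> k = 4 \<or> k = 5 \<or> k = 6 \<or> k = 7 \<or> k = (8::nat)"
  by auto

lemma sphere_vec_beyond: "k > 8 \<Longrightarrow> sphere_vec \<delta> z k = 0"
  by (simp add: sphere_vec_def)

lemma sphere_vec_FF: "(\<lambda>z. sphere_vec \<delta> z k) \<in> FF 3 2"
proof -
  have q: "(\<lambda>z. z i * z j) \<in> FF 3 2" if "i \<le> 3" "j \<le> 3" for i j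
    using FF_mult[OF FF_var[OF that(1)] FF_var[OF that(2)]] by (simp add: numeral_2_eq_2)
  show ?thesis
  proof (cases "k \<le> 8")
    case True
    from le8_cases[OF True] show ?thesis
      by (elim disjE; simp only: sphere_vec_simps; intro FF_scale FF_add FF_diff q; simp)
  next
    case False
    then show ?thesis using FF_zero by (simp add: sphere_vec_beyond)
  qed
qed

text \<open>The matrix entries, written back from the coordinates \<open>y\<close> and arranged such that row \<open>j\<close>
  is \<open>z j\<close> times the vector \<open>z\<close> (\<open>sphere_chart_sphere_vec\<close>). Hence each nonzero row gives the inverse of
  the embedding.\<close>

definition sphere_chart :: "'k::field \<Rightarrow> nat \<Rightarrow> nat \<Rightarrow> (nat \<Rightarrow> 'k) \<Rightarrow> 'k" where
  "sphere_chart \<delta> j l y =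
    (if j = 0 then
       (if l = 0 then y 2 else if l = Suc 0 then y 5 - \<delta> * y 8 else if l = 2 then y 5 + \<delta> * y 8 else y (Suc 0))
     else if j = Suc 0 then
       (if l = 0 then y 5 - \<delta> * y 8 else if l = Suc 0 then y 4 - \<delta> * y 7 else if l = 2 then y (Suc 0) else y 3 - \<delta> * y 6)
     else if j = 2 then
       (if l = 0 then y 5 + \<delta> * y 8 else if l = Suc 0 then y (Suc 0) else if l = 2 then y 4 + \<delta> * y 7 else y 3 + \<delta> * y 6)
     else
       (if l = 0 then y (Suc 0) else if l = Suc 0 then y 3 - \<delta> * y 6 else if l = 2 then y 3 + \<delta> * y 6 else y 0))"

lemma sphere_chart_FF: "sphere_chart \<delta> j l \<in> FF 8 1"
proof -
  have v: "(\<lambda>y. y k) \<in> FF 8 1" if "k \<le> 8" for k using FF_var[OF that] .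
  have e: "(\<lambda>y. y 5 - \<delta> * y 8) \<in> FF 8 1" "(\<lambda>y. y 5 + \<delta> * y 8) \<in> FF 8 1"
    "(\<lambda>y. y 4 - \<delta> * y 7) \<in> FF 8 1" "(\<lambda>y. y 4 + \<delta> * y 7) \<in> FF 8 1"
    "(\<lambda>y. y 3 - \<delta> * y 6) \<in> FF 8 1" "(\<lambda>y. y 3 + \<delta> * y 6) \<in> FF 8 1"
    "(\<lambda>y. y 0) \<in> FF 8 1" "(\<lambda>y. y (Suc 0)) \<in> FF 8 1" "(\<lambda>y. y 2) \<in> FF 8 1"
    by (intro FF_add FF_diff FF_scale v; simp)+
  show ?thesis unfolding sphere_chart_def[abs_def] 
    by (cases "j = 0"; cases "j = Suc 0"; cases "j = 2"; cases "l = 0"; cases "l = Suc 0"; cases "l = 2"; simp add: e[unfolded One_nat_def])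
qed

lemma sphere_chart_sph:
  assumes "\<delta> \<noteq> 0" "z 0 * z 3 = z (Suc 0) * z 2" "j \<le> 3" "l \<le> 3"
  shows "sphere_chart \<delta> j l (\<lambda>i. c * sphere_vec \<delta> z i) = c * (z j * z l)"
proof -
  have h: "(1 / 2) * (a + b) + \<delta> * ((1 / (2 * \<delta>)) * (a - b)) = a"
    "(1 / 2) * (a + b) - \<delta> * ((1 / (2 * \<delta>)) * (a - b)) = b" for a b
    using assms(1) by (simp_all add: field_simps)
  have e: "c * x + \<delta> * (c * y) = c * (x + \<delta> * y)" "c * x - \<delta> * (c * y) = c * (x - \<delta> * y)" for x y
    by (simp_all add: algebra_simps)
  from le3_cases[OF assms(3)] le3_cases[OF assms(4)] show ?thesis
    by (elim disjE; simp only: sphere_chart_def if_True if_False simp_thms sphere_vec_simps e h)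
       (use assms(2) in \<open>simp_all add: mult_ac\<close>)
qed

lemma sphere_vec_nonzero:
  assumes d: "\<delta> \<noteq> 0" and n: "nz s" "nz t" shows "\<exists>k\<le>8. sphere_vec \<delta> (segre_vec s t) k \<noteq> 0"
proof (rule ccontr)
  assume "\<not> ?thesis"
  then have z: "sphere_vec \<delta> (segre_vec s t) k = 0" for k using sphere_vec_beyond[of k] by (cases "k \<le> 8") auto
  obtain l where l: "l \<le> 3" "segre_vec s t l \<noteq> 0" using segre_vec_nonzero[OF n] by blast
  have "sphere_chart \<delta> l l (\<lambda>i. 1 * sphere_vec \<delta> (segre_vec s t) i) = 1 * (segre_vec s t l * segre_vec s t l)"
    by (rule sphere_chart_sph[OF d _ l(1) l(1)]) (simp add: mult_ac)
  moreover have "sphere_chart \<delta> l l (\<lambda>i. 0) = 0" by (simp add: sphere_chart_def)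
  ultimately show False using z l(2) by simp
qed

lemma sphere_entries:
  "(\<Sum>k\<le>8. y k * fixed_basis a k 0 0) = y 0"
  "(\<Sum>k\<le>8. y k * fixed_basis a k 1 1) = y 1"
  "(\<Sum>k\<le>8. y k * fixed_basis a k 2 2) = y 2"
  "(\<Sum>k\<le>8. y k * fixed_basis a k 0 1) = y 3 + sqrt_ac a * y 6"
  "(\<Sum>k\<le>8. y k * fixed_basis a k 1 0) = y 3 - sqrt_ac a * y 6"
  "(\<Sum>k\<le>8. y k * fixed_basis a k 0 2) = y 4 + sqrt_ac a * y 7"
  "(\<Sum>k\<le>8. y k * fixed_basis a k 2 0) = y 4 - sqrt_ac a * y 7"
  "(\<Sum>k\<le>8. y k * fixed_basis a k 1 2) = y 5 + sqrt_ac a * y 8"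
  "(\<Sum>k\<le>8. y k * fixed_basis a k 2 1) = y 5 - sqrt_ac a * y 8"
  by (simp_all add: sum_fixed_basis sym_mat_def skew_mat_def mult.commute del: One_nat_def)

lemma sphere_surface_eq:
  fixes a :: "'f::field_char_0"
  assumes a: "a \<noteq> 0"
  shows "sphere_surface a = {pt (sphere_vec (sqrt_ac a) (segre_vec s t)) | s t. nz s \<and> nz t}"
proof (intro equalityI subsetI)
  let ?\<delta> = "sqrt_ac a"
  have d: "?\<delta> \<noteq> 0" using sqrt_ac_power2[of a] a by auto
  have half: "u = (1 / 2) * (p + q) \<and> v = (1 / (2 * ?\<delta>)) * (p - q)"
    if "u + ?\<delta> * v = p" "u - ?\<delta> * v = q" for u v p q
  proof -
    have "p + q = 2 * u" "p - q = 2 * ?\<delta> * v" using that by (auto simp: algebra_simps)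
    then show ?thesis using d by simp
  qed
  have half': "u + ?\<delta> * v = p \<and> u - ?\<delta> * v = q"
    if "u = (1 / 2) * (p + q)" "v = (1 / (2 * ?\<delta>)) * (p - q)" for u v p q
    unfolding that using d by (simp add: field_simps)
  {
    fix P assume "P \<in> sphere_surface a"
    then obtain y s0 s1 t0 t1 where y: "P = pt y" "y \<in> coord_vecs 8" "(s0, s1) \<noteq> (0, 0)" "(t0, t1) \<noteq> (0, 0)"
      and e: "\<forall>i\<le>2. \<forall>j\<le>2. (\<Sum>k\<le>8. y k * fixed_basis a k i j) = (s0 ^ i * s1 ^ (2 - i)) * (t0 ^ j * t1 ^ (2 - j))"
      unfolding sphere_surface_def by blast
    let ?z = "segre_vec (s0, s1) (t0, t1)"
    have E: "(\<Sum>k\<le>8. y k * fixed_basis a k i j) = (s0 ^ i * s1 ^ (2 - i)) * (t0 ^ j * t1 ^ (2 - j))"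
      if "i \<le> 2" "j \<le> 2" for i j using e that by blast
    have D: "y 0 = ?z 3 * ?z 3" "y 1 = ?z 0 * ?z 3" "y 2 = ?z 0 * ?z 0"
      using E[of 0 0] E[of 1 1] E[of 2 2] unfolding sphere_entries by (simp_all add: power2_eq_square mult_ac)
    have O: "y 3 + ?\<delta> * y 6 = ?z 2 * ?z 3" "y 3 - ?\<delta> * y 6 = ?z (Suc 0) * ?z 3"
      "y 4 + ?\<delta> * y 7 = ?z 2 * ?z 2" "y 4 - ?\<delta> * y 7 = ?z (Suc 0) * ?z (Suc 0)"
      "y 5 + ?\<delta> * y 8 = ?z 0 * ?z 2" "y 5 - ?\<delta> * y 8 = ?z 0 * ?z (Suc 0)"
      using E[of 0 1] E[of 1 0] E[of 0 2] E[of 2 0] E[of 1 2] E[of 2 1]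
      unfolding sphere_entries by (simp_all add: power2_eq_square mult_ac)
    have "y = sphere_vec ?\<delta> ?z"
    proof
      fix k show "y k = sphere_vec ?\<delta> ?z k"
      proof (cases "k \<le> 8")
        case True
        from le8_cases[OF True] show ?thesis
          by (elim disjE; simp only: sphere_vec_simps)
             (use D half[OF O(1,2)] half[OF O(3,4)] half[OF O(5,6)] in simp_all)
      next
        case False
        then show ?thesis using y(2) sphere_vec_beyond[of k ?\<delta> ?z] by (simp add: coord_vecs_def)
      qed
    qed
    then show "P \<in> {pt (sphere_vec ?\<delta> (segre_vec s t)) | s t. nz s \<and> nz t}"
      using y by (auto simp: nz_def)
  next
    fix P assume "P \<in> {pt (sphere_vec ?\<delta> (segre_vec s t)) | s t. nz s \<and> nz t}"
    then obtain s t where st: "nz s" "nz t" "P = pt (sphere_vec ?\<delta> (segre_vec s t))" by blast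
    define y where "y = sphere_vec ?\<delta> (segre_vec s t)"
    let ?z = "segre_vec s t"
    have yc: "y \<in> coord_vecs 8" using sphere_vec_nonzero[OF d st(1,2)] sphere_vec_beyond unfolding y_def coord_vecs_def by blast
    have D: "y 0 = ?z 3 * ?z 3" "y 1 = ?z 0 * ?z 3" "y 2 = ?z 0 * ?z 0" by (simp_all add: y_def sphere_vec_simps)
    have O: "y 3 + ?\<delta> * y 6 = ?z 2 * ?z 3 \<and> y 3 - ?\<delta> * y 6 = ?z (Suc 0) * ?z 3"
      "y 4 + ?\<delta> * y 7 = ?z 2 * ?z 2 \<and> y 4 - ?\<delta> * y 7 = ?z (Suc 0) * ?z (Suc 0)"
      "y 5 + ?\<delta> * y 8 = ?z 0 * ?z 2 \<and> y 5 - ?\<delta> * y 8 = ?z 0 * ?z (Suc 0)"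
      unfolding y_def sphere_vec_simps by (rule half'; rule refl)+
    have c2: "i = 0 \<or> i = 1 \<or> i = 2" if "i \<le> 2" for i :: nat using that by auto
    have "(\<Sum>k\<le>8. y k * fixed_basis a k i j) = (fst s ^ i * snd s ^ (2 - i)) * (fst t ^ j * snd t ^ (2 - j))"
      if ij: "i \<le> 2" "j \<le> 2" for i j
      using c2[OF ij(1)] c2[OF ij(2)]
      by (elim disjE; simp only: sphere_entries D O) (simp_all add: power2_eq_square mult_ac)
    then show "P \<in> sphere_surface a"
      unfolding sphere_surface_def using yc st
      by (intro CollectI exI[of _ y] exI[of _ "fst s"] exI[of _ "snd s"] exI[of _ "fst t"] exI[of _ "snd t"] conjI)
         (auto simp: y_def nz_def)
  }
qed

lemma sphere_subset: "a \<noteq> 0 \<Longrightarrow> sphere_surface a \<subseteq> proj_space 8"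
  unfolding sphere_surface_def by (auto simp: pt_in_proj_space)

text \<open>The embedding is given by quadratic forms everywhere. Its inverse needs the four charts
  \<open>sphere_chart\<close>, one for each Segre coordinate that may be nonzero.\<close>

lemma sphere_isomorphism:
  fixes a :: "'f::field_char_0"
  assumes a: "a \<noteq> 0"
  shows "\<exists>\<Theta> \<Xi>. is_morphism UNIV 3 P1xP1 8 (sphere_surface a) \<Theta> \<and>
    is_morphism UNIV 8 (sphere_surface a) 3 P1xP1 \<Xi> \<and>
    (\<forall>P\<in>P1xP1. \<Xi> (\<Theta> P) = P) \<and> (\<forall>Q\<in>sphere_surface a. \<Theta> (\<Xi> Q) = Q) \<and>
    (\<forall>s t. nz s \<longrightarrow> nz t \<longrightarrow> \<Theta> (segre s t) = pt (sphere_vec (sqrt_ac a) (segre_vec s t)))"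
proof -
  let ?\<delta> = "sqrt_ac a"
  have d: "?\<delta> \<noteq> 0" using sqrt_ac_power2[of a] a by auto
  have sc: "trunc 8 (sphere_vec ?\<delta> (\<lambda>i. c * z i)) = (\<lambda>i. (c * c) * sphere_vec ?\<delta> z i)" for c z
  proof
    fix k show "trunc 8 (sphere_vec ?\<delta> (\<lambda>i. c * z i)) k = (c * c) * sphere_vec ?\<delta> z k"
    proof (cases "k \<le> 8")
      case True
      then show ?thesis using formfun_homog[OF sphere_vec_FF[of ?\<delta> k], of c z] by (simp add: trunc_def power2_eq_square)
    qed (simp add: trunc_def sphere_vec_beyond)
  qed
  have pts: "pt (trunc 8 (sphere_vec ?\<delta> z)) = pt (sphere_vec ?\<delta> (segre_vec s t)) \<and> (\<exists>i\<le>8. sphere_vec ?\<delta> z i \<noteq> 0)"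
    if n: "nz s" "nz t" "pt z = segre s t" for z s t
  proof -
    obtain c where c: "c \<noteq> 0" "z = (\<lambda>i. c * segre_vec s t i)" using n(3) pt_eq_iff[of "segre_vec s t" z] unfolding segre_def by metis
    have e: "trunc 8 (sphere_vec ?\<delta> z) = (\<lambda>i. (c * c) * sphere_vec ?\<delta> (segre_vec s t) i)" unfolding c(2) by (rule sc)
    obtain k where k: "k \<le> 8" "sphere_vec ?\<delta> (segre_vec s t) k \<noteq> 0" using sphere_vec_nonzero[OF d n(1,2)] by blast
    have "sphere_vec ?\<delta> z k \<noteq> 0" using fun_cong[OF e, of k] k c(1) by (simp add: trunc_def)
    then show ?thesis using e pt_scale[of "c * c"] c(1) k(1) by auto
  qed
  have "\<exists>\<Theta>. is_morphism UNIV 3 P1xP1 8 (sphere_surface a) \<Theta> \<and>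
     (\<forall>x. pt x \<in> P1xP1 \<longrightarrow> \<Theta> (pt x) = pt (trunc 8 (\<lambda>i. sphere_vec ?\<delta> x i)))"
  proof (rule morphism_from_forms[OF P1xP1_subset sphere_vec_FF])
    fix x :: "nat \<Rightarrow> 'f alg_closure" assume "pt x \<in> P1xP1"
    then obtain s t where st: "nz s" "nz t" "pt x = segre s t" using P1xP1_segre by blast
    from pts[OF st] st(1,2) show "(\<exists>i\<le>8. sphere_vec ?\<delta> x i \<noteq> 0) \<and> pt (trunc 8 (\<lambda>i. sphere_vec ?\<delta> x i)) \<in> sphere_surface a"
      unfolding sphere_surface_eq[OF a] by blast
  qed
  then obtain \<Theta> where \<Theta>: "is_morphism UNIV 3 P1xP1 8 (sphere_surface a) \<Theta>"
    "\<forall>x. pt x \<in> P1xP1 \<longrightarrow> \<Theta> (pt x) = pt (trunc 8 (\<lambda>i. sphere_vec ?\<delta> x i))" by (elim exE conjE)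
  have \<Theta>s: "\<Theta> (segre s t) = pt (sphere_vec ?\<delta> (segre_vec s t))" if n: "nz s" "nz t" for s t
    using \<Theta>(2) segre_in[OF n] pts[OF n, of "segre_vec s t"] unfolding segre_def by simp
  have rz: "sphere_chart ?\<delta> j l (\<lambda>i. c * sphere_vec ?\<delta> (segre_vec s t) i) = c * (segre_vec s t j * segre_vec s t l)" if "j \<le> 3" "l \<le> 3" for j l c s t
    by (rule sphere_chart_sph[OF d _ that]) (simp add: mult_ac)
  have chart: "pt (trunc 3 (\<lambda>l. sphere_chart ?\<delta> j l y)) = segre s t"
    if n: "nz s" "nz t" "pt y = pt (sphere_vec ?\<delta> (segre_vec s t))" and j: "j \<le> 3" and nzr: "\<exists>l\<le>3. sphere_chart ?\<delta> j l y \<noteq> 0" for y s t j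
  proof -
    obtain c where c: "c \<noteq> 0" "y = (\<lambda>i. c * sphere_vec ?\<delta> (segre_vec s t) i)" using n(3) pt_eq_iff by metis
    have e: "trunc 3 (\<lambda>l. sphere_chart ?\<delta> j l y) = (\<lambda>l. (c * segre_vec s t j) * segre_vec s t l)"
    proof
      fix l show "trunc 3 (\<lambda>l. sphere_chart ?\<delta> j l y) l = (c * segre_vec s t j) * segre_vec s t l"
        unfolding c(2) using rz[OF j, of l c s t] by (cases "l \<le> 3") (simp_all add: trunc_def)
    qed
    obtain l where l: "l \<le> 3" "sphere_chart ?\<delta> j l y \<noteq> 0" using nzr by blast
    then have "c * segre_vec s t j \<noteq> 0" using fun_cong[OF e, of l] by (auto simp: trunc_def)
    then show ?thesis unfolding e segre_def by (rule pt_scale)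
  qed
  have chart_ex: "\<exists>j\<le>3. \<exists>l\<le>3. sphere_chart ?\<delta> j l y \<noteq> 0" if n: "nz s" "nz t" "pt y = pt (sphere_vec ?\<delta> (segre_vec s t))" for y s t
  proof -
    obtain c where c: "c \<noteq> 0" "y = (\<lambda>i. c * sphere_vec ?\<delta> (segre_vec s t) i)" using n(3) pt_eq_iff by metis
    obtain j where j: "j \<le> 3" "segre_vec s t j \<noteq> 0" using segre_vec_nonzero[OF n(1,2)] by blast
    then have "sphere_chart ?\<delta> j j y \<noteq> 0" unfolding c(2) rz[OF j(1) j(1)] using c(1) by simp
    then show ?thesis using j(1) by blast
  qed
  define \<Xi> where "\<Xi> P = (SOME Q. \<exists>s t. nz s \<and> nz t \<and> P = pt (sphere_vec ?\<delta> (segre_vec s t)) \<and> Q = segre s t)" for P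
  have \<Xi>: "\<Xi> (pt (sphere_vec ?\<delta> (segre_vec s t))) = segre s t" if n: "nz s" "nz t" for s t
  proof -
    let ?P = "pt (sphere_vec ?\<delta> (segre_vec s t))"
    have "\<exists>Q. \<exists>s' t'. nz s' \<and> nz t' \<and> ?P = pt (sphere_vec ?\<delta> (segre_vec s' t')) \<and> Q = segre s' t'" using n by blast
    from someI_ex[OF this] obtain s' t' where s': "nz s'" "nz t'" "?P = pt (sphere_vec ?\<delta> (segre_vec s' t'))" "\<Xi> ?P = segre s' t'"
      unfolding \<Xi>_def by blast
    obtain j where j: "j \<le> 3" "\<exists>l\<le>3. sphere_chart ?\<delta> j l (sphere_vec ?\<delta> (segre_vec s t)) \<noteq> 0" using chart_ex[OF n refl] by blast
    show ?thesis using chart[OF n refl j] chart[OF s'(1,2,3) j] s'(4) by simp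
  qed
  have "is_morphism UNIV 8 (sphere_surface a) 3 P1xP1 \<Xi>"
    unfolding is_morphism_iff[OF sphere_subset[OF a] UNIV_I]
  proof (intro allI impI conjI)
    fix y assume "pt y \<in> sphere_surface a"
    then obtain s t where st: "nz s" "nz t" "pt y = pt (sphere_vec ?\<delta> (segre_vec s t))" unfolding sphere_surface_eq[OF a] by blast
    show "\<Xi> (pt y) \<in> P1xP1" using \<Xi>[OF st(1,2)] segre_in[OF st(1,2)] st(3) by simp
    obtain j where j: "j \<le> 3" "\<exists>l\<le>3. sphere_chart ?\<delta> j l y \<noteq> 0" using chart_ex[OF st] by blast
    have "\<Xi> (pt x) = pt (trunc 3 (\<lambda>l. sphere_chart ?\<delta> j l x))"
      if x: "pt x \<in> sphere_surface a" "\<exists>l\<le>3. sphere_chart ?\<delta> j l x \<noteq> 0" for x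
    proof -
      obtain s t where st: "nz s" "nz t" "pt x = pt (sphere_vec ?\<delta> (segre_vec s t))" using x(1) unfolding sphere_surface_eq[OF a] by blast
      show ?thesis using chart[OF st j(1) x(2)] \<Xi>[OF st(1,2)] st(3) by simp
    qed
    then show "\<exists>d f. (\<forall>i\<le>3. f i \<in> FF 8 d) \<and> (\<exists>i\<le>3. f i y \<noteq> 0) \<and>
      (\<forall>x. pt x \<in> sphere_surface a \<longrightarrow> (\<exists>i\<le>3. f i x \<noteq> 0) \<longrightarrow> \<Xi> (pt x) = pt (trunc 3 (\<lambda>i. f i x)))"
      using j(2) by (intro exI[of _ 1] exI[of _ "sphere_chart ?\<delta> j"]) (simp add: sphere_chart_FF del: One_nat_def)
  qed
  moreover have "\<forall>P\<in>P1xP1. \<Xi> (\<Theta> P) = P"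
  proof
    fix P :: "(nat \<Rightarrow> 'f alg_closure) set" assume "P \<in> P1xP1"
    then obtain s t where "nz s" "nz t" "P = segre s t" using P1xP1_segre by blast
    then show "\<Xi> (\<Theta> P) = P" using \<Theta>s \<Xi> by simp
  qed
  moreover have "\<forall>Q\<in>sphere_surface a. \<Theta> (\<Xi> Q) = Q"
  proof
    fix Q assume "Q \<in> sphere_surface a"
    then obtain s t where "nz s" "nz t" "Q = pt (sphere_vec ?\<delta> (segre_vec s t))" unfolding sphere_surface_eq[OF a] by blast
    then show "\<Theta> (\<Xi> Q) = Q" using \<Theta>s \<Xi> by simp
  qed
  ultimately show ?thesis using \<Theta>(1) \<Theta>s by blast
qed

text \<open>The inverse of an equivariant bijection is equivariant, and its domain is stable.\<close>

lemma equivariant_isomorphism_descends: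
  fixes V :: "(nat \<Rightarrow> 'f::field_char_0 alg_closure) set set"
  assumes V: "V \<subseteq> proj_space n" "gal_stable V" and Y: "Y \<subseteq> proj_space m"
    and \<phi>: "is_morphism UNIV n V m Y \<phi>" and \<psi>: "is_morphism UNIV m Y n V \<psi>"
    and inv: "\<And>P. P \<in> V \<Longrightarrow> \<psi> (\<phi> P) = P" "\<And>Q. Q \<in> Y \<Longrightarrow> \<phi> (\<psi> Q) = Q"
    and eq: "\<And>s P. s \<in> gal \<Longrightarrow> P \<in> V \<Longrightarrow> \<phi> (gact s P) = gact s (\<phi> P)"
  shows "isomorphic_over (range to_ac) n V m Y"
proof -
  have sV: "gact s P \<in> V" if "s \<in> gal" "P \<in> V" for s P using V(2) that by (simp add: gal_stable_def)
  have tr: "gact s Q \<in> Y \<and> \<psi> (gact s Q) = gact s (\<psi> Q)" if s: "s \<in> gal" and Q: "Q \<in> Y" for s Q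
  proof -
    have P: "\<psi> Q \<in> V" using morphism_maps[OF \<psi> Q] .
    have "\<phi> (gact s (\<psi> Q)) = gact s Q" using eq[OF s P] inv(2)[OF Q] by simp
    then show ?thesis using morphism_maps[OF \<phi> sV[OF s P]] inv(1)[OF sV[OF s P]] by metis
  qed
  have "gal_stable Y" using tr by (simp add: gal_stable_def)
  then have "is_morphism (range to_ac) m Y n V \<psi>"
    using galois_descent_morphism[OF Y _ V(1) \<psi>] tr by blast
  moreover have "is_morphism (range to_ac) n V m Y \<phi>"
    by (rule galois_descent_morphism[OF V Y \<phi> eq])
  ultimately show ?thesis unfolding isomorphic_over_def using inv by blast
qed

lemma gal_half: 
  assumes s: "s \<in> gal" shows "s (1 / 2) = 1 / 2"
  using galD(4)[OF s, of "1 / 2"] by simp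

lemma gal_inverse_double:
  assumes s: "s \<in> gal" shows "s (1 / (2 * x)) = 1 / (2 * s x)"
proof (cases "x = 0")
  case True
  then show ?thesis by (simp add: gal_simps(1)[OF s])
next
  case False
  have two: "s 2 = 2" using galD(4)[OF s, of 2] by simp
  have "s (1 / (2 * x)) * (2 * s x) = s ((1 / (2 * x)) * (2 * x))"
    unfolding galD(3)[OF s] two ..
  also have "(1 / (2 * x)) * (2 * x) = 1" using False by simp
  finally have "s (1 / (2 * x)) * (2 * s x) = 1" by (simp only: gal_simps(2)[OF s])
  moreover have "2 * s x \<noteq> 0" using False gal_simps(9)[OF s] by simp
  ultimately show ?thesis by (metis nonzero_eq_divide_eq)
qed

text \<open>The skew coordinates are divided by \<open>\<delta>\<close> and the others are not, so that conjugation acts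
  on the coordinates entry by entry when it fixes \<open>\<delta>\<close>.\<close>

lemma sphere_vec_conjugate:
  assumes s: "s \<in> gal" and d: "s \<delta> = \<delta>"
  shows "sphere_vec \<delta> (segre_vec (gal_pair s p) (gal_pair s q)) = s \<circ> sphere_vec \<delta> (segre_vec p q)"
proof
  fix k
  have h: "s (1 / 2) = 1 / 2" "s (1 / (2 * \<delta>)) = 1 / (2 * \<delta>)"
    using gal_half[OF s] gal_inverse_double[OF s, of \<delta>] d by auto
  show "sphere_vec \<delta> (segre_vec (gal_pair s p) (gal_pair s q)) k = (s \<circ> sphere_vec \<delta> (segre_vec p q)) k"
  proof (cases "k \<le> 8")
    case True
    from le8_cases[OF True] show ?thesis
      by (elim disjE; simp only: sphere_vec_simps comp_apply; simp only: galD(2,3)[OF s] gal_simps(4)[OF s] h segre_vec_simps fst_map_prod snd_map_prod)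
  next
    case False
    then show ?thesis by (simp add: sphere_vec_beyond gal_simps[OF s])
  qed
qed

text \<open>Exchanging the factors transposes the matrix and so negates its skew part, which
  compensates for the sign of \<open>\<delta>\<close>.\<close>

lemma sphere_vec_conjugate_swap:
  assumes s: "s \<in> gal" and d: "s \<delta> = - \<delta>"
  shows "sphere_vec \<delta> (segre_vec (gal_pair s q) (gal_pair s p)) = s \<circ> sphere_vec \<delta> (segre_vec p q)"
proof
  fix k
  have h: "s (1 / 2) = 1 / 2" "s (1 / (2 * \<delta>)) = - (1 / (2 * \<delta>))"
    using gal_half[OF s] gal_inverse_double[OF s, of \<delta>] d by auto
  show "sphere_vec \<delta> (segre_vec (gal_pair s q) (gal_pair s p)) k = (s \<circ> sphere_vec \<delta> (segre_vec p q)) k"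
  proof (cases "k \<le> 8")
    case True
    from le8_cases[OF True] show ?thesis
      by (elim disjE; simp only: sphere_vec_simps comp_apply; simp only: galD(2,3)[OF s] gal_simps(4)[OF s] h segre_vec_simps fst_map_prod snd_map_prod; simp add: algebra_simps)
  next
    case False
    then show ?thesis by (simp add: sphere_vec_beyond gal_simps[OF s])
  qed
qed

section \<open>Twists with a parametrization\<close>

theorem mainTheorem3:
  fixes V :: "(nat \<Rightarrow> 'f::field_char_0 alg_closure) set set" and n :: nat
  assumes "is_twist n V 3 P1xP1"
    and "\<not> isomorphic_over (range to_ac) n V 3 P1xP1"
    and "\<forall>a::'f. a \<noteq> 0 \<and> \<not> (\<exists>b. a = b ^ 2) \<longrightarrow>
      \<not> isomorphic_over (range to_ac) n V 8 (sphere_surface a)"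
  shows "\<not> has_parametrization (range to_ac) n V"
proof
  assume par: "has_parametrization (range to_ac) n V"
  have V: "gal_stable V" "V \<subseteq> proj_space n"
    using variety_gal_stable assms(1) unfolding is_twist_def by blast+
  have iso: "isomorphic_over UNIV n V 3 P1xP1" using assms(1) by (simp add: is_twist_def)
  obtain \<phi> \<psi> where \<phi>: "is_morphism UNIV n V 3 P1xP1 \<phi>" and \<psi>: "is_morphism UNIV 3 P1xP1 n V \<psi>"
    and \<psi>\<phi>: "\<forall>P\<in>V. \<psi> (\<phi> P) = P" and \<phi>\<psi>: "\<forall>Q\<in>P1xP1. \<phi> (\<psi> Q) = Q"
    and three: "\<forall>r\<in>{(0, 1), (1, 0), (1, 1)}. \<exists>P\<in>V. (\<forall>s\<in>gal. gact s P = P) \<and> \<phi> P = segre r r"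
    using normalized_isomorphism[OF V(2) par iso] by (elim exE conjE)
  have sV: "gact s P \<in> V" if "s \<in> gal" "P \<in> V" for s P using V(1) that by (simp add: gal_stable_def)
  define fixes_rulings where "fixes_rulings s \<longleftrightarrow> (\<forall>P\<in>V. \<phi> (gact s P) = gact s (\<phi> P))" for s
  define swaps_rulings where "swaps_rulings s \<longleftrightarrow> (\<forall>P\<in>V. \<forall>p q. nz p \<longrightarrow> nz q \<longrightarrow> \<phi> P = segre p q \<longrightarrow>
      \<phi> (gact s P) = segre (gal_pair s q) (gal_pair s p))" for s
  have dich: "fixes_rulings s \<or> swaps_rulings s" if s: "s \<in> gal" for s
  proof -
    obtain t where t: "t \<in> gal" "\<And>x. t (s x) = x" "\<And>x. s (t x) = x" using gal_inv_ex[OF s] by metis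
    \<comment> \<open>The conjugate of \<open>\<phi>\<close> by \<open>s\<close>, composed with the inverse of \<open>\<phi>\<close>; \<open>\<beta>\<close> is its inverse.\<close>
    define \<alpha> where "\<alpha> Q = gact s (\<phi> (gact t (\<psi> Q)))" for Q
    define \<beta> where "\<beta> Q = \<phi> (gact s (\<psi> (gact t Q)))" for Q
    have \<alpha>: "is_morphism UNIV 3 P1xP1 3 P1xP1 \<alpha>"
      unfolding \<alpha>_def
      by (rule is_morphism_comp[OF P1xP1_subset V(2) \<psi> is_morphism_conjugate[OF V(2,1) P1xP1_gal_stable \<phi> s t]])
    have \<beta>: "is_morphism UNIV 3 P1xP1 3 P1xP1 \<beta>"
      unfolding \<beta>_def
      by (rule is_morphism_comp[OF P1xP1_subset V(2) is_morphism_conjugate[OF P1xP1_subset P1xP1_gal_stable V(1) \<psi> s t] \<phi>])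
    have ts: "gact t (gact s P) = P" "gact s (gact t P) = P" for P :: "(nat \<Rightarrow> 'f alg_closure) set"
      using gact_inverse[of t s P] gact_inverse[of s t P] t by auto
    have inv: "\<alpha> (\<beta> Q) = Q" if Q: "Q \<in> P1xP1" for Q
    proof -
      have tQ: "gact t Q \<in> P1xP1" 
        by (rule bspec[OF bspec[OF P1xP1_gal_stable[unfolded gal_stable_def] t(1)] Q])
      have "\<psi> (\<beta> Q) = gact s (\<psi> (gact t Q))"
        unfolding \<beta>_def using \<psi>\<phi> sV[OF s morphism_maps[OF \<psi> tQ]] by simp
      then show ?thesis unfolding \<alpha>_def using \<phi>\<psi> tQ by (simp add: ts)
    qed
    have fx: "\<alpha> (segre r r) = segre r r" if r: "r \<in> {(0, 1), (1, 0), (1, 1)}" for r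
    proof -
      obtain P where P: "P \<in> V" "\<forall>s\<in>gal. gact s P = P" "\<phi> P = segre r r"
        using bspec[OF three r] by (elim bexE conjE)
      have 1: "\<psi> (segre r r) = P" using bspec[OF \<psi>\<phi> P(1)] unfolding P(3) .
      have 2: "gact t P = P" by (rule bspec[OF P(2) t(1)])
      have "\<alpha> (segre r r) = gact s (segre r r)" unfolding \<alpha>_def 1 2 P(3) ..
      also have "\<dots> = segre r r" by (rule segre_fixed_by_gal[OF s r r])
      finally show ?thesis .
    qed
    have ap: "\<alpha> (\<phi> (gact s P)) = gact s (\<phi> P)" if P: "P \<in> V" for P
      unfolding \<alpha>_def using \<psi>\<phi> sV[OF s P] by (simp add: ts)
    have "(\<forall>p q. nz p \<longrightarrow> nz q \<longrightarrow> \<alpha> (segre p q) = segre p q) \<or>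
      (\<forall>p q. nz p \<longrightarrow> nz q \<longrightarrow> \<alpha> (segre p q) = segre q p)"
      by (rule P1xP1_automorphism[OF \<alpha> \<beta> inv fx])
    then show ?thesis
    proof
      assume id: "\<forall>p q. nz p \<longrightarrow> nz q \<longrightarrow> \<alpha> (segre p q) = segre p q"
      have "\<phi> (gact s P) = gact s (\<phi> P)" if P: "P \<in> V" for P
      proof -
        obtain p q where "nz p" "nz q" "\<phi> (gact s P) = segre p q"
          using P1xP1_segre[OF morphism_maps[OF \<phi> sV[OF s P]]] by blast
        then show ?thesis using ap[OF P] id by simp
      qed
      then show ?thesis by (simp add: fixes_rulings_def)
    next
      assume sw: "\<forall>p q. nz p \<longrightarrow> nz q \<longrightarrow> \<alpha> (segre p q) = segre q p"
      have "\<phi> (gact s P) = segre (gal_pair s q) (gal_pair s p)"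
        if P: "P \<in> V" and pq: "nz p" "nz q" "\<phi> P = segre p q" for P p q
      proof -
        obtain p' q' where p': "nz p'" "nz q'" "\<phi> (gact s P) = segre p' q'"
          using P1xP1_segre[OF morphism_maps[OF \<phi> sV[OF s P]]] by blast
        have n: "nz (gal_pair s p)" "nz (gal_pair s q)" using pq gal_pair_nz[OF s] by auto
        have "segre q' p' = segre (gal_pair s p) (gal_pair s q)"
          using ap[OF P] sw p' pq(3) gact_segre[OF s] by simp
        then have "segre p' q' = segre (gal_pair s q) (gal_pair s p)"
          using segre_eq_iff[OF p'(2,1) n] segre_eq_iff[OF p'(1,2) n(2,1)] by blast
        then show ?thesis using p'(3) by simp
      qed
      then show ?thesis unfolding swaps_rulings_def by blast
    qed
  qed
  show False
  proof (cases "\<forall>s\<in>gal. fixes_rulings s")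
    case True
    have "isomorphic_over (range to_ac) n V 3 P1xP1"
      by (rule equivariant_isomorphism_descends[OF V(2,1) P1xP1_subset \<phi> \<psi>])
         (use \<psi>\<phi> \<phi>\<psi> True in \<open>auto simp: fixes_rulings_def\<close>)
    then show False using assms(2) by simp
  next
    case False
    then obtain g where g: "g \<in> gal" "\<not> fixes_rulings g" by blast
    let ?o = "(0, 1) :: 'f alg_closure \<times> 'f alg_closure" and ?i = "(1, 0) :: 'f alg_closure \<times> 'f alg_closure"
    have n: "nz ?o" "nz ?i" by auto
    have in1: "segre ?o ?i \<in> P1xP1" and in2: "segre ?i ?o \<in> P1xP1" by (intro segre_in n)+
    have ne: "segre ?o ?i \<noteq> segre ?i ?o" using segre_eq_iff[OF n n(2,1)] by (simp add: peq_def)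
    define P where "P = \<psi> (segre ?o ?i)"
    define P' where "P' = \<psi> (segre ?i ?o)"
    have PV: "P \<in> V" "P' \<in> V" unfolding P_def P'_def using morphism_maps[OF \<psi>] in1 in2 by blast+
    have \<phi>P: "\<phi> P = segre ?o ?i" "\<phi> P' = segre ?i ?o" unfolding P_def P'_def using \<phi>\<psi> in1 in2 by blast+
    have fixP: "gact s P = P" "gact s P' = P'" if s: "s \<in> gal" "fixes_rulings s" for s
    proof -
      have "\<phi> (gact s P) = \<phi> P" "\<phi> (gact s P') = \<phi> P'"
        using s(2) PV \<phi>P segre_fixed_by_gal[OF s(1)] unfolding fixes_rulings_def by simp_all
      then show "gact s P = P" "gact s P' = P'" using \<psi>\<phi> sV[OF s(1)] PV by metis+
    qed
    have swapP: "gact s P = P'" "gact s P' = P" if s: "s \<in> gal" "swaps_rulings s" for s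
    proof -
      have o: "gal_pair s ?o = ?o" "gal_pair s ?i = ?i" by (simp_all add: gal_simps[OF s(1)])
      have "\<phi> (gact s P) = segre (gal_pair s ?i) (gal_pair s ?o)" "\<phi> (gact s P') = segre (gal_pair s ?o) (gal_pair s ?i)"
        using s(2) PV \<phi>P n unfolding swaps_rulings_def by blast+
      then have "\<phi> (gact s P) = \<phi> P'" "\<phi> (gact s P') = \<phi> P" unfolding o \<phi>P .
      then show "gact s P = P'" "gact s P' = P" using \<psi>\<phi> sV[OF s(1)] PV by metis+
    qed
    have PP': "P \<noteq> P'" using \<phi>P ne by metis
    obtain x0 where x0: "P = pt x0" "x0 \<in> coord_vecs n" using proj_space_ne PV(1) V(2) by blast
    then obtain j where j: "x0 j \<noteq> 0" by (auto simp: coord_vecs_def)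
    \<comment> \<open>With one coordinate equal to 1, equality of points becomes equality of coordinate vectors.\<close>
    define x where "x = (\<lambda>i. inverse (x0 j) * x0 i)"
    have Px: "P = pt x" unfolding x_def x0(1) using j by (intro pt_scale[symmetric]) simp
    have xj: "x j = 1" using j by (simp add: x_def)
    have norm: "u = v" if "pt u = pt v" "u j = 1" "v j = 1" for u v :: "nat \<Rightarrow> 'f alg_closure"
      using that unfolding pt_eq_iff by auto
    have sx: "s \<circ> x = x" if "s \<in> gal" "fixes_rulings s" for s
      by (rule norm) (use fixP(1)[OF that] Px gact_pt[OF that(1)] xj gal_simps(2)[OF that(1)] in auto)
    have gs: "swaps_rulings g" using dich g by blast
    define x' where "x' = g \<circ> x"
    have P'x': "P' = pt x'" using swapP(1)[OF g(1) gs] Px gact_pt[OF g(1)] by (simp add: x'_def)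
    have x'j: "x' j = 1" using xj gal_simps(2)[OF g(1)] by (simp add: x'_def)
    have sx': "s \<circ> x' = x'" if "s \<in> gal" "fixes_rulings s" for s
      by (rule norm) (use fixP(2)[OF that] P'x' gact_pt[OF that(1)] x'j gal_simps(2)[OF that(1)] in auto)
    have wx: "s \<circ> x = x'" "s \<circ> x' = x" if "s \<in> gal" "swaps_rulings s" for s
      by (rule norm; use swapP[OF that] Px P'x' gact_pt[OF that(1)] xj x'j gal_simps(2)[OF that(1)] in auto)+
    have "x \<noteq> x'" using PP' Px P'x' by auto
    then obtain i where i: "x i \<noteq> x' i" by auto
    \<comment> \<open>The automorphisms that exchange the rulings exchange \<open>x\<close> and \<open>x'\<close>, the others fix both.\<close>
    define c where "c = x i - x' i"
    have c0: "c \<noteq> 0" using i by (simp add: c_def)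
    have sc: "s c = c" if "s \<in> gal" "fixes_rulings s" for s
      using fun_cong[OF sx[OF that], of i] fun_cong[OF sx'[OF that], of i] gal_simps(4)[OF that(1)]
      by (simp add: c_def)
    have wc: "s c = - c" if "s \<in> gal" "swaps_rulings s" for s
      using fun_cong[OF wx(1)[OF that], of i] fun_cong[OF wx(2)[OF that], of i] gal_simps(4)[OF that(1)]
      by (simp add: c_def)
    have "s (c ^ 2) = c ^ 2" if "s \<in> gal" for s
      using dich[OF that] sc[OF that] wc[OF that] gal_simps(5)[OF that] by auto
    then have "c ^ 2 \<in> range to_ac" by (rule gal_fixed_field)
    then obtain a where a: "c ^ 2 = to_ac a" by blast
    have a0: "a \<noteq> 0" using a c0 by auto
    have nsq: "\<not> (\<exists>b. a = b ^ 2)"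
    proof
      assume "\<exists>b. a = b ^ 2"
      then obtain b where "c ^ 2 = to_ac b ^ 2" using a by auto
      then have "c = to_ac b \<or> c = - to_ac b" by (simp add: power2_eq_iff)
      then have "g c = c" using galD(4)[OF g(1), of b] gal_simps(3)[OF g(1)] by auto
      then show False using wc[OF g(1) gs] c0 by simp
    qed
    let ?\<delta> = "sqrt_ac a"
    have "?\<delta> ^ 2 = c ^ 2" unfolding a by (rule sqrt_ac_power2)
    then have \<delta>: "?\<delta> = c \<or> ?\<delta> = - c" by (simp only: power2_eq_iff)
    have s\<delta>: "s ?\<delta> = ?\<delta>" if "s \<in> gal" "fixes_rulings s" for s
      using \<delta> sc[OF that] gal_simps(3)[OF that(1)] by auto
    have w\<delta>: "s ?\<delta> = - ?\<delta>" if "s \<in> gal" "swaps_rulings s" for s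
      using \<delta> wc[OF that] gal_simps(3)[OF that(1)] by auto
    obtain \<Theta> \<Xi> where \<Theta>: "is_morphism UNIV 3 P1xP1 8 (sphere_surface a) \<Theta>"
      and \<Xi>: "is_morphism UNIV 8 (sphere_surface a) 3 P1xP1 \<Xi>"
      and \<Xi>\<Theta>: "\<forall>P\<in>P1xP1. \<Xi> (\<Theta> P) = P" and \<Theta>\<Xi>: "\<forall>Q\<in>sphere_surface a. \<Theta> (\<Xi> Q) = Q"
      and \<Theta>s: "\<forall>s t. nz s \<longrightarrow> nz t \<longrightarrow> \<Theta> (segre s t) = pt (sphere_vec ?\<delta> (segre_vec s t))"
      using sphere_isomorphism[OF a0] by (elim exE conjE)
    have "isomorphic_over (range to_ac) n V 8 (sphere_surface a)"
    proof (rule equivariant_isomorphism_descends[OF V(2,1) sphere_subset[OF a0]])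
      show "is_morphism UNIV n V 8 (sphere_surface a) (\<lambda>P. \<Theta> (\<phi> P))"
        by (rule is_morphism_comp[OF V(2) P1xP1_subset \<phi> \<Theta>])
      show "is_morphism UNIV 8 (sphere_surface a) n V (\<lambda>Q. \<psi> (\<Xi> Q))"
        by (rule is_morphism_comp[OF sphere_subset[OF a0] P1xP1_subset \<Xi> \<psi>])
      show "\<psi> (\<Xi> (\<Theta> (\<phi> P))) = P" if "P \<in> V" for P
        using that \<Xi>\<Theta> \<psi>\<phi> morphism_maps[OF \<phi> that] by simp
      show "\<Theta> (\<phi> (\<psi> (\<Xi> Q))) = Q" if "Q \<in> sphere_surface a" for Q
        using that \<Theta>\<Xi> \<phi>\<psi> morphism_maps[OF \<Xi> that] by simp
      show "\<Theta> (\<phi> (gact s R)) = gact s (\<Theta> (\<phi> R))" if s: "s \<in> gal" and R: "R \<in> V" for s R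
      proof -
        obtain p q where pq: "nz p" "nz q" "\<phi> R = segre p q" using P1xP1_segre[OF morphism_maps[OF \<phi> R]] by blast
        have m: "nz (gal_pair s p)" "nz (gal_pair s q)" using pq gal_pair_nz[OF s] by auto
        have r: "gact s (\<Theta> (\<phi> R)) = pt (s \<circ> sphere_vec ?\<delta> (segre_vec p q))"
          unfolding pq(3) \<Theta>s[rule_format, OF pq(1,2)] by (rule gact_pt[OF s])
        from dich[OF s] show ?thesis
        proof
          assume f: "fixes_rulings s"
          then have e: "\<phi> (gact s R) = segre (gal_pair s p) (gal_pair s q)"
            using R pq(3) gact_segre[OF s] by (simp add: fixes_rulings_def)
          show ?thesis
            unfolding r e \<Theta>s[rule_format, OF m] sphere_vec_conjugate[OF s s\<delta>[OF s f]] ..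
        next
          assume f: "swaps_rulings s"
          then have e: "\<phi> (gact s R) = segre (gal_pair s q) (gal_pair s p)"
            using R pq unfolding swaps_rulings_def by blast
          show ?thesis
            unfolding r e \<Theta>s[rule_format, OF m(2,1)] sphere_vec_conjugate_swap[OF s w\<delta>[OF s f]] ..
        qed
      qed
    qed
    then show False using assms(3) a0 nsq by blast
  qed
qed

end
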